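(* Let $\ell$ be a rational prime, let $X$ be a connected multigraph with $\chi(X)\neq 0$, and let $\alpha:S\to\mathbb{Z}_\ell$ be a function such that for every $n\ge 1$ the derived multigraph $X(\mathbb{Z}/\ell^n\mathbb{Z},S,\alpha_n)$ is connected, where $\alpha_n$ is the composition of $\alpha$ with reduction $\mathbb{Z}_\ell\to\mathbb{Z}_\ell/\ell^n\mathbb{Z}_\ell\cong\mathbb{Z}/\ell^n\mathbb{Z}$. Write $\alpha(S)=\{b_1,\dots,b_t\}$ with the $b_y$ distinct $\ell$-adic integers, and let $P\in\mathbb{Z}[X_1,\dots,X_t,Y_1,\dots,Y_t]$ be the polynomial defined in the context. Define $c_1,c_2,\dots\in\mathbb{Z}_\ell$ by $$Q(T)=P\big(Q_{b_1}(T),\dots,Q_{b_t}(T),Q_{-b_1}(T),\dots,Q_{-b_t}(T)\big)=c_1T+c_2T^2+\cdots\in\mathbb{Z}_\ell[[T]],$$ and set $\mu=\min\{v_\ell(c_j): j\ge 1\}$ and $\lambda=\min\{j\in\mathbb{N}: v_\ell(c_j)=\mu\}-1$. If $\kappa_n$ denotes the number of spanning trees of $X(\mathbb{Z}/\ell^n\mathbb{Z},S,\alpha_n)$, then there exist a nonnegative integer $n_0$ and an integer $\nu$ such that $$\mathrm{ord}_\ell(\kappa_n)=\mu\,\ell^n+\lambda n+\nu\quad\text{for all } n\ge n_0.$$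
   Context: A multigraph $X$ consists of a finite vertex set $V_X$, a finite set $\vec E_X$ of directed edges, an incidence map $\mathrm{inc}:\vec E_X\to V_X\times V_X$, $e\mapsto(o(e),t(e))$, and an involution $\mathrm{inv}$ of $\vec E_X$ without fixed points satisfying $\mathrm{inc}(\mathrm{inv}(e))=(t(e),o(e))$. The set of undirected edges is $E_X=\vec E_X/\langle\mathrm{inv}\rangle$. The valency $\mathrm{val}_X(v)$ of a vertex $v$ is the number of $e\in\vec E_X$ with $o(e)=v$ (so a loop contributes $2$). All multigraphs are finite with no vertex of valency one. The Euler characteristic is $\chi(X)=|V_X|-|E_X|$. A section $\omega:E_X\to\vec E_X$ of the quotient map is fixed and $S=\omega(E_X)$ (a choice of direction on each edge). For a finite additive group $G$ and a map $\alpha:S\to G$, the derived multigraph $X(G,S,\alpha)$ has vertex set $V_X\times G$ and, for each $(s,\sigma)\in S\times G$, one undirected edge joining $(o(s),\sigma)$ to $(t(s),\sigma+\alpha(s))$. The polynomial $P$: label $V_X=\{v_1,\dots,v_g\}$. Let $d_{ij}$ be the entries of the diagonal valency matrix ($d_{ii}=\mathrm{val}_X(v_i)$, $d_{ij}=0$ for $i\neq j$), $B_{ij}=|\{s\in S:\mathrm{inc}(s)=(v_i,v_j)\}|$, $C_{ij}=|\{s\in S:\mathrm{inc}(s)=(v_j,v_i)\}|$, $\gamma_{ij}^{(y)}=|\{s\in S:\mathrm{inc}(s)=(v_i,v_j),\ \alpha(s)=b_y\}|$, $\delta_{ij}^{(y)}=|\{s\in S:\mathrm{inc}(s)=(v_j,v_i),\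 \alpha(s)=b_y\}|$, $P_{ij}=\sum_{y=1}^t(\gamma_{ij}^{(y)}X_y+\delta_{ij}^{(y)}Y_y)$, and $P=\det\big(d_{ij}-B_{ij}-C_{ij}+P_{ij}\big)_{1\le i,j\le g}$. For $a\in\mathbb{Z}_\ell$, $Q_a(T)=\sum_{k\ge1}(-1)^{k-1}\binom{a}{k}T^k\in\mathbb{Z}_\ell[[T]]$, where $\binom{a}{k}=a(a-1)\cdots(a-k+1)/k!\in\mathbb{Z}_\ell$; for $a\in\mathbb{Z}_{\ge0}$ this is $1-(1-T)^a$. $v_\ell$ is the $\ell$-adic valuation with $v_\ell(\ell)=1$. *)

theory Defs
  imports
    "Berlekamp_Zassenhaus.Finite_Field"
    "Jordan_Normal_Form.Determinant"
    "Graph_Theory.Graph_Theory"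
    "HOL-Algebra.Elementary_Groups"
    "HOL-Computational_Algebra.Formal_Power_Series"
    "HOL-Library.Poly_Mapping"
    "HOL-Library.Extended_Nat"
begin

section \<open>The ring of \<open>\<ell>\<close>-adic integers\<close>

text \<open>The prime \<open>\<ell>\<close> is the cardinality of the index type \<open>'p\<close>, and the ring of
  \<open>\<ell>\<close>-adic integers is the inverse limit of the rings \<open>\<int>/\<ell>\<^sup>n\<int>\<close>: an element is the compatible
  sequence of its least nonnegative residues modulo \<open>\<ell>\<^sup>n\<close>.\<close>

typedef 'p padic_int =
  "{x :: nat \<Rightarrow> int. \<forall>n. x n \<in> {0..<int CARD('p::prime_card) ^ n} \<and>
      x (Suc n) mod int CARD('p) ^ n = x n}"
  morphisms padic_seq Abs_padic_int
  by (rule exI[of _ "\<lambda>_. 0"]) simp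

definition padic_residue :: "nat \<Rightarrow> 'p::prime_card padic_int \<Rightarrow> int" where
  "padic_residue n x = padic_seq x n"

setup_lifting type_definition_padic_int

lemma card_gt_1: "1 < CARD('p::prime_card)"
  by (rule prime_gt_1_nat) (rule prime_card)

lemma card_pos: "0 < int CARD('p::prime_card) ^ n"
  by simp

lemma mod_mod_pow: "(a::int) mod q ^ Suc n mod q ^ n = a mod q ^ n"
  by (simp add: mod_mod_cancel le_imp_power_dvd)

lemma padic_eqI: "(\<And>n. padic_seq x n = padic_seq y n) \<Longrightarrow> x = y"
  by (metis ext padic_seq_inject)

lemma padic_Suc_mod: "padic_seq (x::'p::prime_card padic_int) (Suc n) mod int CARD('p) ^ n = padic_seq x n"
  using padic_seq[of x] by simp

lemma padic_seq_range: "padic_seq (x::'p::prime_card padic_int) n \<in> {0..<int CARD('p) ^ n}"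
  using padic_seq[of x] by simp

lemma padic_mod:
  fixes x :: "'p::prime_card padic_int"
  assumes "m \<le> n" shows "padic_seq x n mod int CARD('p) ^ m = padic_seq x m"
  using assms
proof (induction n rule: dec_induct)
  case base then show ?case using padic_seq_range[of x m] by simp
next
  case (step k)
  have "padic_seq x (Suc k) mod int CARD('p) ^ m
      = padic_seq x (Suc k) mod int CARD('p) ^ k mod int CARD('p) ^ m"
    using step by (simp add: mod_mod_cancel le_imp_power_dvd)
  then show ?case using step padic_Suc_mod[of x k] by simp
qed

instantiation padic_int :: (prime_card) comm_ring_1
begin

lift_definition zero_padic_int :: "'a padic_int" is "\<lambda>_. 0"
  by (simp add: card_pos)

lift_definition one_padic_int :: "'a padic_int" is "\<lambda>n. 1 mod int CARD('a) ^ n"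
  by (simp only: mod_mod_pow) (simp add: card_pos)

lift_definition plus_padic_int :: "'a padic_int \<Rightarrow> 'a padic_int \<Rightarrow> 'a padic_int"
  is "\<lambda>x y n. (x n + y n) mod int CARD('a) ^ n"
  by (simp only: mod_mod_pow) (metis mod_add_eq atLeastLessThan_iff card_pos pos_mod_bound pos_mod_sign)

lift_definition uminus_padic_int :: "'a padic_int \<Rightarrow> 'a padic_int"
  is "\<lambda>x n. (- x n) mod int CARD('a) ^ n"
  by (simp only: mod_mod_pow) (metis mod_minus_eq atLeastLessThan_iff card_pos pos_mod_bound pos_mod_sign)

lift_definition minus_padic_int :: "'a padic_int \<Rightarrow> 'a padic_int \<Rightarrow> 'a padic_int"
  is "\<lambda>x y n. (x n - y n) mod int CARD('a) ^ n"
  by (simp only: mod_mod_pow) (metis mod_diff_eq atLeastLessThan_iff card_pos pos_mod_bound pos_mod_sign)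

lift_definition times_padic_int :: "'a padic_int \<Rightarrow> 'a padic_int \<Rightarrow> 'a padic_int"
  is "\<lambda>x y n. (x n * y n) mod int CARD('a) ^ n"
  by (simp only: mod_mod_pow) (metis mod_mult_eq atLeastLessThan_iff card_pos pos_mod_bound pos_mod_sign)

instance
proof
  fix a b c :: "'a padic_int"
  show "a + b + c = a + (b + c)"
    by transfer (simp add: mod_simps add.assoc)
  show "a + b = b + a"
    by transfer (simp add: add.commute)
  show "0 + a = a"
    by transfer (simp add: fun_eq_iff)
  show "- a + a = 0"
    by transfer (simp add: mod_simps)
  show "a - b = a + - b"
    by transfer (simp add: mod_simps)
  show "a * b * c = a * (b * c)"
    by transfer (simp add: mod_simps mult.assoc)
  show "a * b = b * a"
    by transfer (simp add: mult.commute)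
  show "1 * a = a"
    by transfer (simp add: fun_eq_iff mod_simps)
  show "(a + b) * c = a * c + b * c"
    by transfer (simp add: mod_simps distrib_right)
  have "(1::int) mod int CARD('a) ^ 1 \<noteq> 0"
    using card_gt_1[where 'p='a] by simp
  then show "(0::'a padic_int) \<noteq> 1"
    by transfer metis
qed

end

lemma padic_seq_of_nat:
  "padic_seq (of_nat k :: 'p::prime_card padic_int) n = int k mod int CARD('p) ^ n"
  by (induction k) (simp_all add: zero_padic_int.rep_eq plus_padic_int.rep_eq one_padic_int.rep_eq mod_simps)

instance padic_int :: (prime_card) ring_char_0
proof
  show "inj (of_nat :: nat \<Rightarrow> 'a padic_int)"
  proof (rule injI)
    fix x y assume eq: "(of_nat x :: 'a padic_int) = of_nat y"
    define n where "n = x + y"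
    have "n < CARD('a) ^ n" using power_gt_expt[of "CARD('a)" n] card_gt_1[where 'p='a] by simp
    then have "int n < int CARD('a) ^ n" by (simp flip: of_nat_power)
    then have "int x < int CARD('a) ^ n" "int y < int CARD('a) ^ n"
      unfolding n_def by linarith+
    then have "int x mod int CARD('a) ^ n = int x" "int y mod int CARD('a) ^ n = int y"
      by (auto intro!: mod_pos_pos_trivial)
    then have "int x = int y"
      unfolding padic_seq_of_nat[where 'p='a, symmetric] eq by (rule trans[OF sym])
    then show "x = y" by simp
  qed
qed

instance padic_int :: (prime_card) idom
proof
  fix a b :: "'a padic_int"
  assume "a \<noteq> 0" "b \<noteq> 0"
  then have "\<exists>m. padic_seq a m \<noteq> 0" "\<exists>n. padic_seq b n \<noteq> 0"
    using padic_eqI[of a 0] padic_eqI[of b 0] by (auto simp: zero_padic_int.rep_eq)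
  then obtain m n where mn: "padic_seq a m \<noteq> 0" "padic_seq b n \<noteq> 0" by blast
  let ?p = "int CARD('a)"
  define A B where "A = padic_seq a (m + n)" and "B = padic_seq b (m + n)"
  have pr: "prime ?p" using prime_card by simp
  have nd: "\<not> ?p ^ m dvd A" "\<not> ?p ^ n dvd B"
    using mn padic_mod[of m "m+n" a] padic_mod[of n "m+n" b] by (auto simp: A_def B_def)
  then have AB: "A \<noteq> 0" "B \<noteq> 0" by auto
  have "multiplicity ?p A < m" "multiplicity ?p B < n"
    using nd by (meson multiplicity_dvd' not_less)+
  then have "multiplicity ?p (A * B) < m + n"
    using pr AB by (simp add: prime_elem_multiplicity_mult_distrib)
  moreover have "m + n \<le> multiplicity ?p (A * B)" if "?p ^ (m + n) dvd A * B"
    using that AB pr by (intro multiplicity_geI) auto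
  ultimately have "\<not> ?p ^ (m + n) dvd A * B" by fastforce
  then have "padic_seq (a * b) (m + n) \<noteq> 0"
    by (simp add: times_padic_int.rep_eq A_def B_def mod_eq_0_iff_dvd)
  then show "a * b \<noteq> 0" by (auto simp: zero_padic_int.rep_eq)
qed

instantiation padic_int :: (prime_card) idom_divide
begin

definition divide_padic_int :: "'a padic_int \<Rightarrow> 'a padic_int \<Rightarrow> 'a padic_int" where
  "divide_padic_int a b = (if b \<noteq> 0 \<and> b dvd a then (THE c. a = c * b) else 0)"

instance
  by standard (auto simp: divide_padic_int_def)

end

instance padic_int :: (prime_card) algebraic_semidom ..

lemma padic_of_nat_unit:
  assumes "\<not> CARD('p::prime_card) dvd u"
  shows "(of_nat u :: 'p padic_int) dvd 1"
proof -
  let ?p = "int CARD('p)"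
  have cop: "coprime (int u) (?p ^ n)" for n
    using assms prime_imp_coprime[OF prime_card[where 'a='p], of u]
    by (metis coprime_commute coprime_int_iff coprime_power_right_iff of_nat_power)
  have ex: "\<exists>y\<in>{0..<?p ^ n}. (int u * y) mod ?p ^ n = 1 mod ?p ^ n" for n
  proof -
    obtain z where "[int u * z = 1] (mod ?p ^ n)"
      using cong_solve_coprime_int[OF cop] by blast
    then show ?thesis
      by (intro bexI[of _ "z mod ?p ^ n"]) (auto simp: cong_def mod_simps card_pos)
  qed
  define y where "y n = (SOME y. y \<in> {0..<?p ^ n} \<and> (int u * y) mod ?p ^ n = 1 mod ?p ^ n)" for n
  have "y n \<in> {0..<?p ^ n} \<and> (int u * y n) mod ?p ^ n = 1 mod ?p ^ n" for n
    unfolding y_def by (rule someI_ex) (use ex[of n] in blast)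
  then have y: "y n \<in> {0..<?p ^ n}" "(int u * y n) mod ?p ^ n = 1 mod ?p ^ n" for n by blast+
  have "y (Suc n) mod ?p ^ n = y n" for n
  proof -
    have "(int u * y (Suc n)) mod ?p ^ n = 1 mod ?p ^ n"
      using y(2)[of "Suc n"] by (metis mod_mod_pow)
    then have "[int u * y (Suc n) = int u * y n] (mod ?p ^ n)"
      using y(2)[of n] by (simp add: cong_def)
    then have "[y (Suc n) = y n] (mod ?p ^ n)"
      using cop cong_mult_lcancel by blast
    then show ?thesis using y(1)[of n] by (simp add: cong_def)
  qed
  then have "padic_seq (Abs_padic_int y :: 'p padic_int) = y"
    using y(1) by (intro Abs_padic_int_inverse) auto
  then have "of_nat u * (Abs_padic_int y :: 'p padic_int) = 1"
    by (intro padic_eqI) (simp add: times_padic_int.rep_eq one_padic_int.rep_eq padic_seq_of_nat mod_simps y)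
  then show ?thesis by (metis dvd_triv_left)
qed

lemma padic_pow_dvd_iff:
  "(of_nat CARD('p) ^ k :: 'p::prime_card padic_int) dvd x \<longleftrightarrow> padic_residue k x = 0"
proof
  let ?p = "int CARD('p)"
  have seqp: "padic_seq (of_nat CARD('p) ^ k :: 'p padic_int) n = ?p ^ k mod ?p ^ n" for n
    using padic_seq_of_nat[of "CARD('p) ^ k" n, where 'p='p] by simp
  {
    assume "(of_nat CARD('p) ^ k :: 'p padic_int) dvd x"
    then show "padic_residue k x = 0"
      by (auto simp: padic_residue_def times_padic_int.rep_eq seqp elim!: dvdE)
  }
  assume 0: "padic_residue k x = 0"
  have dv: "?p ^ k dvd padic_seq x (n + k)" for n
    using 0 padic_mod[of k "n + k" x] by (auto simp: padic_residue_def)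
  define y where "y n = padic_seq x (n + k) div ?p ^ k" for n
  have xy: "padic_seq x (n + k) = ?p ^ k * y n" for n using dv by (simp add: y_def)
  have "y n \<in> {0..<?p ^ n}" for n
    using padic_seq_range[of x "n + k"] card_pos[of k, where 'p='p]
    unfolding xy by (auto simp: power_add zero_le_mult_iff mult.commute)
  moreover have "y (Suc n) mod ?p ^ n = y n" for n
  proof -
    have "?p ^ k * (y (Suc n) mod ?p ^ n) = (?p ^ k * y (Suc n)) mod (?p ^ k * ?p ^ n)"
      by (simp only: mult_mod_right)
    also have "\<dots> = padic_seq x (Suc n + k) mod ?p ^ (n + k)"
      by (simp only: xy power_add mult.commute)
    also have "\<dots> = ?p ^ k * y n"
      using padic_mod[of "n + k" "Suc n + k" x] xy by simp
    finally show ?thesis using card_pos[of k, where 'p='p] by simp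
  qed
  ultimately have ys: "padic_seq (Abs_padic_int y :: 'p padic_int) = y"
    by (intro Abs_padic_int_inverse) auto
  have "x = of_nat CARD('p) ^ k * (Abs_padic_int y :: 'p padic_int)"
  proof (rule padic_eqI)
    fix n
    have "padic_seq x n = padic_seq x (n + k) mod ?p ^ n" using padic_mod[of n "n + k" x] by simp
    then show "padic_seq x n = padic_seq (of_nat CARD('p) ^ k * (Abs_padic_int y :: 'p padic_int)) n"
      by (simp add: times_padic_int.rep_eq seqp ys xy mod_simps)
  qed
  then show "of_nat CARD('p) ^ k dvd x" by (metis dvd_triv_left)
qed

lemma padic_residue_fallfac:
  "padic_residue n (\<Prod>i=0..<k. (a::'p::prime_card padic_int) - of_nat i)
     = (\<Prod>i=0..<k. padic_residue n a - int i) mod int CARD('p) ^ n"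
  by (induction k)
     (simp_all add: padic_residue_def times_padic_int.rep_eq minus_padic_int.rep_eq one_padic_int.rep_eq
        padic_seq_of_nat mod_simps)

lemma fallfac_int: "(\<Prod>i=0..<k. int m - int i) = fact k * int (m choose k)"
proof (induction k)
  case 0 then show ?case by simp
next
  case (Suc k)
  have "int (m choose k) * (int m - int k) = int (Suc k) * int (m choose Suc k)"
  proof (cases "k \<le> m")
    case True
    have "(m - k) * (m choose k) = Suc k * (m choose Suc k)"
      using binomial_absorb_comp[of m k] binomial_absorption[of k m] by simp
    then have "int (m - k) * int (m choose k) = int (Suc k) * int (m choose Suc k)"
      by (metis of_nat_mult)
    then show ?thesis using True by (simp only: of_nat_diff mult.commute)
  next
    case False
    then show ?thesis by (simp add: binomial_eq_0)
  qed
  then show ?case by (simp only: prod.atLeast0_lessThan_Suc Suc.IH fact_Suc mult.assoc mult.left_commute)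
qed

lemma fact_dvd_fallfac_int: "(fact k :: int) dvd (\<Prod>i=0..<k. int m - int i)"
  by (simp add: fallfac_int)

text \<open>This is the term defining \<open>a gchoose k\<close>, whose parsing is restricted to fields. The
  division is exact by the lemma \<open>fact_mult_padic_binom\<close>.\<close>

definition padic_binom :: "'p::prime_card padic_int \<Rightarrow> nat \<Rightarrow> 'p padic_int" where
  "padic_binom a k = (\<Prod>i=0..<k. a - of_nat i) div fact k"

lemma fact_mult_padic_binom:
  fixes a :: "'p::prime_card padic_int"
  shows "fact k * padic_binom a k = (\<Prod>i=0..<k. a - of_nat i)"
proof -
  let ?l = "CARD('p)"
  define v where "v = multiplicity ?l (fact k :: nat)"
  obtain u where u: "fact k = ?l ^ v * u" "\<not> ?l dvd u"
    unfolding v_def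
    by (rule multiplicity_decompose'[of "fact k" ?l])
       (use prime_card[where 'a='p] in \<open>auto\<close>)
  have f: "(fact k :: 'p padic_int) = of_nat ?l ^ v * of_nat u"
    using arg_cong[OF u(1), of "of_nat :: nat \<Rightarrow> 'p padic_int"] by simp
  define m where "m = nat (padic_residue v a)"
  have m: "padic_residue v a = int m"
    using padic_seq_range[of a v] by (simp add: m_def padic_residue_def)
  have "int (?l ^ v) dvd int (fact k)" by (subst u(1)) simp
  then have "int ?l ^ v dvd (\<Prod>i=0..<k. int m - int i)"
    using fact_dvd_fallfac_int[of k m] by (metis dvd_trans of_nat_fact of_nat_power)
  then have "of_nat ?l ^ v dvd (\<Prod>i=0..<k. a - of_nat i)"
    by (simp add: padic_pow_dvd_iff padic_residue_fallfac m)
  moreover have "(of_nat u :: 'p padic_int) dvd 1" using u by (rule_tac padic_of_nat_unit)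
  ultimately have "fact k dvd (\<Prod>i=0..<k. a - of_nat i)"
    unfolding f by (simp add: mult_unit_dvd_iff)
  then show ?thesis by (simp add: padic_binom_def)
qed

definition padic_val :: "'p::prime_card padic_int \<Rightarrow> enat" where
  "padic_val x = (SUP n \<in> {n. of_nat CARD('p) ^ n dvd x}. enat n)"

definition Q_series :: "'p::prime_card padic_int \<Rightarrow> 'p padic_int fps" where
  "Q_series a = Abs_fps (\<lambda>k. if k = 0 then 0 else (- 1) ^ (k - 1) * padic_binom a k)"


section \<open>Multigraphs\<close>

text \<open>A multigraph consists of a digraph \<open>X\<close> whose arcs are the directed edges, and the inversion
  \<open>rv\<close>; following the locale \<open>bidirected_digraph\<close>, \<open>rv\<close> is extended by the identity outside of the
  set of directed edges.\<close>

locale multigraph = fin_digraph X + bidirected_digraph X rv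
  for X :: "('v, 'e) pre_digraph" and rv :: "'e \<Rightarrow> 'e" +
  assumes valency_neq_1: "v \<in> verts X \<Longrightarrow> out_degree X v \<noteq> 1"

definition undirected_edges :: "('v, 'e) pre_digraph \<Rightarrow> ('e \<Rightarrow> 'e) \<Rightarrow> 'e set set" where
  "undirected_edges X rv = (\<lambda>e. {e, rv e}) ` arcs X"

definition euler_char :: "('v, 'e) pre_digraph \<Rightarrow> ('e \<Rightarrow> 'e) \<Rightarrow> int" where
  "euler_char X rv = int (card (verts X)) - int (card (undirected_edges X rv))"

definition edge_section :: "('v, 'e) pre_digraph \<Rightarrow> ('e \<Rightarrow> 'e) \<Rightarrow> ('e set \<Rightarrow> 'e) \<Rightarrow> bool" where
  "edge_section X rv \<omega> \<longleftrightarrow>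
     (\<forall>E \<in> undirected_edges X rv. \<omega> E \<in> arcs X \<and> {\<omega> E, rv (\<omega> E)} = E)"

text \<open>The undirected edge of the derived multigraph belonging to \<open>(s, \<sigma>)\<close> is
  \<open>{(s, \<sigma>), (rv s, \<sigma>)}\<close>: the arc \<open>(s, \<sigma>)\<close> goes from \<open>(o s, \<sigma>)\<close> to \<open>(t s, \<sigma> + \<alpha> s)\<close>, and
  \<open>(rv s, \<sigma>)\<close> is its inverse.\<close>

definition derived_graph ::
  "('v, 'e) pre_digraph \<Rightarrow> ('e \<Rightarrow> 'e) \<Rightarrow> 'e set \<Rightarrow> 'g monoid \<Rightarrow> ('e \<Rightarrow> 'g)
     \<Rightarrow> ('v \<times> 'g, 'e \<times> 'g) pre_digraph" where
  "derived_graph X rv S G \<alpha> =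
     \<lparr> verts = verts X \<times> carrier G,
       arcs = arcs X \<times> carrier G,
       tail = (\<lambda>(e, \<sigma>). (tail X e, if e \<in> S then \<sigma> else \<sigma> \<otimes>\<^bsub>G\<^esub> \<alpha> (rv e))),
       head = (\<lambda>(e, \<sigma>). (head X e, if e \<in> S then \<sigma> \<otimes>\<^bsub>G\<^esub> \<alpha> e else \<sigma>)) \<rparr>"

definition derived_inv ::
  "('e \<Rightarrow> 'e) \<Rightarrow> 'g monoid \<Rightarrow> 'e \<times> 'g \<Rightarrow> 'e \<times> 'g" where
  "derived_inv rv G = (\<lambda>(e, \<sigma>). if \<sigma> \<in> carrier G then (rv e, \<sigma>) else (e, \<sigma>))"

lemma (in multigraph) edge_section_mem:
  assumes "edge_section X rv \<omega>" and "S = \<omega> ` undirected_edges X rv" and e: "e \<in> arcs X"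
  shows "rv e \<in> S \<longleftrightarrow> e \<notin> S"
proof -
  have S: "{s, rv s} \<in> undirected_edges X rv \<and> \<omega> {s, rv s} = s" if "s \<in> S" for s
    using that assms(1,2) by (auto simp: edge_section_def)
  have "{e, rv e} \<in> undirected_edges X rv" using e by (simp add: undirected_edges_def)
  then have "\<omega> {e, rv e} \<in> S" "{\<omega> {e, rv e}, rv (\<omega> {e, rv e})} = {e, rv e}"
    using assms(1,2) by (auto simp: edge_section_def)
  then have "e \<in> S \<or> rv e \<in> S" by (auto simp: doubleton_eq_iff)
  moreover have "\<not> (e \<in> S \<and> rv e \<in> S)"
    using S[of e] S[of "rv e"] arev_neq[OF e] by (auto simp: insert_commute)
  ultimately show ?thesis by blast
qed

lemma (in multigraph) multigraph_derived_graph: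
  assumes G: "group G" "finite (carrier G)"
    and S: "edge_section X rv \<omega>" "S = \<omega> ` undirected_edges X rv"
    and \<alpha>: "\<alpha> ` S \<subseteq> carrier G"
  shows "multigraph (derived_graph X rv S G \<alpha>) (derived_inv rv G)"
proof -
  interpret G: group G by fact
  let ?Y = "derived_graph X rv S G \<alpha>"
  note mem = edge_section_mem[OF S]
  have \<alpha>': "\<alpha> s \<in> carrier G" if "s \<in> S" for s using \<alpha> that by blast
  have out: "out_degree ?Y v \<noteq> 1" if v: "v \<in> verts ?Y" for v
  proof -
    obtain u \<tau> where v': "v = (u, \<tau>)" "u \<in> verts X" "\<tau> \<in> carrier G"
      using v by (auto simp: derived_graph_def)
    have "bij_betw fst (out_arcs ?Y v) (out_arcs X u)"
    proof (rule bij_betwI[where g = "\<lambda>e. (e, if e \<in> S then \<tau> else \<tau> \<otimes>\<^bsub>G\<^esub> inv\<^bsub>G\<^esub> \<alpha> (rv e))"])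
      show "fst \<in> out_arcs ?Y v \<rightarrow> out_arcs X u"
        by (auto simp: out_arcs_def derived_graph_def v')
      show "(\<lambda>e. (e, if e \<in> S then \<tau> else \<tau> \<otimes>\<^bsub>G\<^esub> inv\<^bsub>G\<^esub> \<alpha> (rv e))) \<in> out_arcs X u \<rightarrow> out_arcs ?Y v"
        using v' by (auto simp: out_arcs_def derived_graph_def mem \<alpha>' G.m_assoc)
      show "(fst x, if fst x \<in> S then \<tau> else \<tau> \<otimes>\<^bsub>G\<^esub> inv\<^bsub>G\<^esub> \<alpha> (rv (fst x))) = x"
        if "x \<in> out_arcs ?Y v" for x
        using that v' by (auto simp: out_arcs_def derived_graph_def mem \<alpha>' G.m_assoc)
    qed simp
    then have "out_degree ?Y v = out_degree X u"
      unfolding out_degree_def by (rule bij_betw_same_card)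
    then show ?thesis using valency_neq_1 v' by simp
  qed
  show ?thesis
  proof (unfold_locales)
    show "tail ?Y e \<in> verts ?Y" "head ?Y e \<in> verts ?Y" if "e \<in> arcs ?Y" for e
      using that by (auto simp: derived_graph_def mem \<alpha>')
    show "finite (verts ?Y)" "finite (arcs ?Y)" using G by (auto simp: derived_graph_def)
    show "(a \<in> arcs ?Y) = (derived_inv rv G a \<noteq> a)" for a
      by (cases a) (auto simp: derived_graph_def derived_inv_def arev_dom)
    show "derived_inv rv G (derived_inv rv G a) = a" for a
      by (cases a) (auto simp: derived_inv_def)
    show "tail ?Y (derived_inv rv G a) = head ?Y a" if "a \<in> arcs ?Y" for a
      using that by (cases a) (auto simp: derived_graph_def derived_inv_def mem)
  qed (rule out)
qed

text \<open>A cycle of the multigraph is a cycle of the underlying digraph whose undirected edges are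
  distinct; the extra condition only rules out the walks \<open>e, rv e\<close>.\<close>

definition acyclic_multigraph :: "('v, 'e) pre_digraph \<Rightarrow> ('e \<Rightarrow> 'e) \<Rightarrow> bool" where
  "acyclic_multigraph H rv \<longleftrightarrow>
     \<not> (\<exists>p. pre_digraph.cycle H p \<and> distinct (map (\<lambda>e. {e, rv e}) p))"

definition spanning_trees ::
  "('v, 'e) pre_digraph \<Rightarrow> ('e \<Rightarrow> 'e) \<Rightarrow> ('v, 'e) pre_digraph set" where
  "spanning_trees X rv =
     {H. spanning H X \<and> rv ` arcs H \<subseteq> arcs H \<and>
         Digraph_Component.connected H \<and> acyclic_multigraph H rv}"


section \<open>The polynomial \<open>P\<close>\<close>

text \<open>Multivariate integer polynomials are finitely supported maps from monomials to coefficients;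
  \<open>Inl y\<close> indexes the variable \<open>X\<^sub>y\<close>, and \<open>Inr y\<close> the variable \<open>Y\<^sub>y\<close>. Indices of vertices and of
  variables start at 0.\<close>

type_synonym xy_poly = "(nat + nat \<Rightarrow>\<^sub>0 nat) \<Rightarrow>\<^sub>0 int"

definition mvar :: "nat + nat \<Rightarrow> xy_poly" where
  "mvar z = Poly_Mapping.single (Poly_Mapping.single z 1) 1"

definition eval_xy :: "(nat + nat \<Rightarrow> 'r::comm_ring_1) \<Rightarrow> xy_poly \<Rightarrow> 'r" where
  "eval_xy f p = (\<Sum>m \<in> Poly_Mapping.keys p. of_int (Poly_Mapping.lookup p m) *
       (\<Prod>z \<in> Poly_Mapping.keys m. f z ^ Poly_Mapping.lookup m z))"

definition voltage_poly ::
  "('v, 'e) pre_digraph \<Rightarrow> 'e set \<Rightarrow> ('e \<Rightarrow> 'a) \<Rightarrow> nat \<Rightarrow> (nat \<Rightarrow> 'v) \<Rightarrow> nat \<Rightarrow> (nat \<Rightarrow> 'a) \<Rightarrow> xy_poly"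
  where
  "voltage_poly X S \<alpha> g vs t b =
    (let d = (\<lambda>i j. if i = j then out_degree X (vs i) else 0);
         B = (\<lambda>i j. card {s \<in> S. (tail X s, head X s) = (vs i, vs j)});
         C = (\<lambda>i j. card {s \<in> S. (tail X s, head X s) = (vs j, vs i)});
         \<gamma> = (\<lambda>y i j. card {s \<in> S. (tail X s, head X s) = (vs i, vs j) \<and> \<alpha> s = b y});
         \<delta> = (\<lambda>y i j. card {s \<in> S. (tail X s, head X s) = (vs j, vs i) \<and> \<alpha> s = b y});
         P = (\<lambda>i j. \<Sum>y<t. of_nat (\<gamma> y i j) * mvar (Inl y) + of_nat (\<delta> y i j) * mvar (Inr y))
     in Determinant.det (mat g g (\<lambda>(i, j).
          of_nat (d i j) - of_nat (B i j) - of_nat (C i j) + P i j)))"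

end

theory Submission
  imports Defs "HOL-Computational_Algebra.Polynomial_FPS"
begin

text \<open>Write \<open>N = \<ell>\<^sup>n\<close>. By the matrix-tree theorem \<open>(gN)\<^sup>2 \<kappa>\<^sub>n\<close> is the determinant of the Laplacian of
  the derived multigraph plus the all-one matrix. This matrix is block circulant, so the discrete
  Fourier transform turns its determinant into a product over \<open>\<zeta>\<^sup>N = 1\<close>, which gives
  \<open>N \<kappa>\<^sub>n = \<kappa>(X) \<Prod>\<^sub>\<zeta>\<^sub>\<noteq>\<^sub>1 R(\<zeta>)\<close>, hence \<open>\<ell> \<kappa>\<^sub>n = \<kappa>\<^sub>n\<^sub>-\<^sub>1 \<Prod> R(\<zeta>)\<close> over the primitive \<open>N\<close>-th roots of unity.
  Here \<open>R\<close> is any integer polynomial obtained from \<open>Q(1 - x)\<close> by replacing the voltages \<open>\<plusminus>b\<close>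
  by nonnegative integers congruent to them modulo a power \<open>\<ell>\<^sup>K\<close> with \<open>K \<ge> n\<close>. By continuity of
  binomial coefficients, for large \<open>K\<close> the expansion of \<open>R\<close> in powers of \<open>\<pi> = 1 - \<zeta>\<close> agrees with \<open>Q\<close>
  modulo \<open>\<ell>\<^sup>\<mu>\<^sup>+\<^sup>1\<close> up to a high degree, and \<open>\<pi>\<^sup>N\<close> is divisible by \<open>\<ell>\<close> in \<open>\<int>[\<zeta>]\<close>. For
  \<open>\<phi>(N) > \<lambda> + 1\<close> and primitive \<open>\<zeta>\<close>, where \<open>\<ell>\<close> is a unit times \<open>\<pi>\<^sup>\<phi>\<close>, it follows that
  \<open>R(\<zeta>)\<close> is \<open>\<ell>\<^sup>\<mu> \<pi>\<^sup>\<lambda>\<^sup>+\<^sup>1\<close> times an \<open>\<ell>\<close>-adic unit, so the product has valuation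
  \<open>\<mu> \<phi>(N) + \<lambda> + 1\<close>, and \<open>ord\<^sub>\<ell> \<kappa>\<^sub>n - ord\<^sub>\<ell> \<kappa>\<^sub>n\<^sub>-\<^sub>1 = \<mu> (\<ell>\<^sup>n - \<ell>\<^sup>n\<^sup>-\<^sup>1) + \<lambda>\<close>.\<close>


section \<open>Determinants over finite index sets\<close>

text \<open>The coefficients of \<open>Q\<close> are l-adic while the roots of unity are complex,
  and no ring containing both is built. Integer polynomials bridge the two: at one level n only
  finitely many coefficients of \<open>Q\<close>, modulo a power of l, matter. So K is chosen afresh
  for each n, and the product formula holds exactly for every K \<ge> n because \<zeta>^N = 1 allows
  exponents to be changed modulo N. Valuations are likewise taken of rational integers only. The
  product of h(\<zeta>) over all N-th roots of unity is the determinant of an integer circulant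
  matrix, hence an integer, and it is prime to l if h(1) is. The product over the primitive roots is
  reached through the full products of two consecutive levels, without Galois theory. An l-adic unit
  thus appears as the value of an integer polynomial h with h(1) prime to l. That \<mu> is finite
  needs its own argument, at level 1: it rests on \<kappa> 1 being positive. The matrix-tree theorem
  is proved for a set of roots, a form that is stable under contraction of an edge.\<close>

definition set_det :: "'i set \<Rightarrow> ('i \<Rightarrow> 'i \<Rightarrow> 'a::comm_ring_1) \<Rightarrow> 'a" where
  "set_det A f = (let h = SOME h. bij_betw h {0..<card A} A in
     Determinant.det (mat (card A) (card A) (\<lambda>(i, j). f (h i) (h j))))"

text \<open>Two enumerations of \<open>A\<close> differ by a permutation \<open>q\<close>. It acts
  on rows and on columns alike, so its sign enters twice and cancels.\<close>

lemma set_det_bij: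
  assumes h: "bij_betw h {0..<n::nat} A"
  shows "set_det A f = Determinant.det (mat n n (\<lambda>(i, j). f (h i) (h j)))"
proof -
  have n: "card A = n" using bij_betw_same_card[OF h] by simp
  define h' where "h' = (SOME h. bij_betw h {0..<card A} A)"
  have h': "bij_betw h' {0..<n} A"
    unfolding h'_def n by (rule someI[of "\<lambda>h. bij_betw h {0..<n} A", OF h])
  define q where "q i = (if i \<in> {0..<n} then inv_into {0..<n} h (h' i) else i)" for i
  have "bij_betw (inv_into {0..<n} h \<circ> h') {0..<n} {0..<n}"
    using bij_betw_trans[OF h' bij_betw_inv_into[OF h]] .
  then have "bij_betw q {0..<n} {0..<n}"
    by (rule bij_betw_cong[THEN iffD1, rotated]) (simp add: q_def)
  then have q: "q permutes {0..<n}" by (rule bij_imp_permutes) (auto simp: q_def)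
  have hq: "h (q i) = h' i" if "i < n" for i
  proof -
    have "h' i \<in> h ` {0..<n}" using that h h' by (auto simp: bij_betw_def)
    then show ?thesis using that by (simp add: q_def f_inv_into_f)
  qed
  have qn: "q i < n" if "i < n" for i using permutes_in_image[OF q, of i] that by simp
  define M where "M = mat n n (\<lambda>(i, j). f (h i) (h j))"
  have M: "M \<in> carrier_mat n n" by (simp add: M_def)
  define M1 where "M1 = mat n n (\<lambda>(i, j). M $$ (q i, j))"
  have M1: "M1 \<in> carrier_mat n n" "M1\<^sup>T \<in> carrier_mat n n" by (simp_all add: M1_def)
  have d1: "Determinant.det M1 = of_int (sign q) * Determinant.det M"
    unfolding M1_def by (rule det_permute_rows[OF M q])
  define M2 where "M2 = mat n n (\<lambda>(i, j). M1\<^sup>T $$ (q i, j))"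
  have M2: "M2 \<in> carrier_mat n n" by (simp add: M2_def)
  have d2: "Determinant.det M2 = of_int (sign q) * Determinant.det (M1\<^sup>T)"
    unfolding M2_def by (rule det_permute_rows[OF M1(2) q])
  have "mat n n (\<lambda>(i, j). f (h' i) (h' j)) = M2\<^sup>T"
    by (rule eq_matI) (auto simp: M2_def M1_def M_def qn hq)
  then have "set_det A f = Determinant.det (M2\<^sup>T)"
    by (simp add: set_det_def Let_def h'_def[unfolded n, symmetric] n)
  also have "\<dots> = of_int (sign q) * (of_int (sign q) * Determinant.det M)"
    by (simp only: det_transpose[OF M2] d2 det_transpose[OF M1(1)] d1)
  also have "\<dots> = of_int (sign q * sign q) * Determinant.det M" by (simp only: of_int_mult mult.assoc)
  also have "sign q * sign q = 1" by (simp add: sign_def)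
  finally show ?thesis by (simp add: M_def)
qed

lemma ex_enum: "finite A \<Longrightarrow> \<exists>h. bij_betw h {0..<card A} A"
  using ex_bij_betw_nat_finite by blast

lemma set_det_reindex:
  assumes "finite A" "bij_betw h A B"
  shows "set_det B f = set_det A (\<lambda>i j. f (h i) (h j))"
proof -
  obtain k where k: "bij_betw k {0..<card A} A" using ex_enum assms by blast
  show ?thesis
    by (subst set_det_bij[OF bij_betw_trans[OF k assms(2)]]) (simp add: set_det_bij[OF k])
qed

lemma set_det_Leibniz:
  assumes h: "bij_betw h {0..<n::nat} A"
  shows "set_det A f = (\<Sum>p | p permutes {0..<n}. of_int (sign p) * (\<Prod>i=0..<n. f (h i) (h (p i))))"
proof -
  have "p i < n" if "p permutes {0..<n}" "i < n" for p i
    using permutes_in_image[OF that(1), of i] that(2) by simp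
  then show ?thesis
    unfolding set_det_bij[OF h]
    by (subst det_def'[of _ n], simp) (intro sum.cong refl arg_cong2[of _ _ _ _ "(*)"] prod.cong, auto)
qed

lemma sum_rel:
  assumes "R 0 0" "\<And>x y x' y'. R x y \<Longrightarrow> R x' y' \<Longrightarrow> R (x + x') (y + y')"
    and "\<And>x. x \<in> B \<Longrightarrow> R (u x) (v x)"
  shows "R (sum u B) (sum v B)"
  using assms(3) by (induction B rule: infinite_finite_induct) (auto intro: assms(1,2))

lemma prod_rel:
  assumes "R 1 1" "\<And>x y x' y'. R x y \<Longrightarrow> R x' y' \<Longrightarrow> R (x * x') (y * y')"
    and "\<And>x. x \<in> B \<Longrightarrow> R (u x) (v x)"
  shows "R (prod u B) (prod v B)"
  using assms(3) by (induction B rule: infinite_finite_induct) (auto intro: assms(1,2))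

text \<open>A determinant is a polynomial in its entries, so a relation compatible with the ring
  operations passes from entries to determinants. This serves both homomorphisms
  (\<open>R x y\<close> is \<open>f x = y\<close>) and congruences (\<open>R x y\<close> is
  divisibility of \<open>x - y\<close>).\<close>

lemma set_det_rel:
  fixes R :: "'a::comm_ring_1 \<Rightarrow> 'b::comm_ring_1 \<Rightarrow> bool"
  assumes "finite A" and f: "\<And>i j. i \<in> A \<Longrightarrow> j \<in> A \<Longrightarrow> R (f i j) (g i j)"
    and R: "R 0 0" "R 1 1" "\<And>x y. R x y \<Longrightarrow> R (- x) (- y)"
    "\<And>x y x' y'. R x y \<Longrightarrow> R x' y' \<Longrightarrow> R (x + x') (y + y')"
    "\<And>x y x' y'. R x y \<Longrightarrow> R x' y' \<Longrightarrow> R (x * x') (y * y')"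
  shows "R (set_det A f) (set_det A g)"
proof -
  let ?n = "card A"
  obtain h where h: "bij_betw h {0..<card A} A" using ex_enum assms(1) by blast
  have hA: "h i \<in> A" if "i < card A" for i using h that by (auto simp: bij_betw_def)
  have perm: "p i < card A" if "p permutes {0..<card A}" "i < card A" for p i
    using permutes_in_image[OF that(1), of i] that(2) by simp
  have "R (of_int (sign p) * (\<Prod>i=0..<?n. f (h i) (h (p i))))
       (of_int (sign p) * (\<Prod>i=0..<?n. g (h i) (h (p i))))" if p: "p permutes {0..<?n}" for p
  proof -
    have "R (f (h i) (h (p i))) (g (h i) (h (p i)))" if "i < ?n" for i
      by (intro f hA perm[OF p] that)
    then have "R (\<Prod>i=0..<?n. f (h i) (h (p i))) (\<Prod>i=0..<?n. g (h i) (h (p i)))"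
      by (intro prod_rel[where R = R, OF R(2,5)]) simp_all
    then show ?thesis using R(3) by (cases p rule: sign_cases) simp_all
  qed
  then show ?thesis
    unfolding set_det_Leibniz[OF h]
    by (intro sum_rel[where R = R, OF R(1,4)]) simp_all
qed

lemma set_det_cong:
  assumes "finite A" "\<And>i j. i \<in> A \<Longrightarrow> j \<in> A \<Longrightarrow> f i j = g i j"
  shows "set_det A f = set_det A g"
  using assms by (rule set_det_rel[where R = "(=)"]) auto

lemma set_det_of_int: "finite A \<Longrightarrow> of_int (set_det A f) = set_det A (\<lambda>i j. of_int (f i j))"
  by (rule set_det_rel[where R = "\<lambda>x y. of_int x = y"]) auto

lemma set_det_empty: "set_det {} f = 1"
  by (subst set_det_bij[of "\<lambda>i. undefined" 0]) (auto simp: bij_betw_def)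

lemma set_det_singleton: "set_det {a} f = f a a"
  by (subst set_det_bij[of "\<lambda>i. a" 1]) (auto simp: bij_betw_def det_single)

lemma set_det_const_diag:
  assumes "finite A" shows "set_det A (\<lambda>i j. if i = j then c else 0) = c ^ card A"
proof -
  obtain h where h: "bij_betw h {0..<card A} A" using ex_enum assms by blast
  have "mat (card A) (card A) (\<lambda>(i, j). if h i = h j then c else 0) = c \<cdot>\<^sub>m 1\<^sub>m (card A)"
    using h by (intro eq_matI) (auto simp: bij_betw_def inj_on_def)
  then show ?thesis by (simp add: set_det_bij[OF h])
qed

lemma set_det_mult:
  assumes "finite A"
  shows "set_det A f * set_det A g = set_det A (\<lambda>i j. \<Sum>k\<in>A. f i k * g k j)"
proof -
  let ?n = "card A"
  obtain h where h: "bij_betw h {0..<?n} A" using ex_enum assms by blast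
  have "set_det A f * set_det A g =
      Determinant.det (mat ?n ?n (\<lambda>(i, j). f (h i) (h j)) * mat ?n ?n (\<lambda>(i, j). g (h i) (h j)))"
    unfolding set_det_bij[OF h] by (subst det_mult[of _ ?n]) auto
  also have "mat ?n ?n (\<lambda>(i, j). f (h i) (h j)) * mat ?n ?n (\<lambda>(i, j). g (h i) (h j))
      = mat ?n ?n (\<lambda>(i, j). \<Sum>k\<in>A. f (h i) k * g k (h j))"
    by (intro eq_matI) (auto simp: scalar_prod_def sum.reindex_bij_betw[OF h, symmetric])
  finally show ?thesis unfolding set_det_bij[OF h] .
qed

lemma set_det_block:
  fixes f :: "'i \<Rightarrow> 'i \<Rightarrow> 'a::idom"
  assumes fin: "finite A" "finite B" and disj: "A \<inter> B = {}"
    and 0: "\<And>i j. i \<in> B \<Longrightarrow> j \<in> A \<Longrightarrow> f i j = 0"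
  shows "set_det (A \<union> B) f = set_det A f * set_det B f"
proof -
  let ?a = "card A" and ?b = "card B"
  obtain h where h: "bij_betw h {0..<?a} A" using ex_enum fin by blast
  obtain k where k: "bij_betw k {0..<?b} B" using ex_enum fin by blast
  have hA: "h i \<in> A" if "i < ?a" for i using h that by (auto simp: bij_betw_def)
  have kB: "k i \<in> B" if "i < ?b" for i using k that by (auto simp: bij_betw_def)
  define u where "u i = (if i < ?a then h i else k (i - ?a))" for i
  have "bij_betw u ({0..<?a} \<union> {?a..<?a+?b}) (A \<union> B)"
  proof (rule bij_betw_combine)
    show "bij_betw u {0..<?a} A" using h by (rule bij_betw_cong[THEN iffD1, rotated]) (simp add: u_def)
    have "bij_betw (\<lambda>i. i - ?a) {?a..<?a+?b} {0..<?b}"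
      by (rule bij_betw_byWitness[where f' = "\<lambda>i. i + ?a"]) auto
    from bij_betw_trans[OF this k] show "bij_betw u {?a..<?a+?b} B"
      by (rule bij_betw_cong[THEN iffD1, rotated]) (simp add: u_def)
  qed (rule disj)
  moreover have "{0..<?a} \<union> {?a..<?a+?b} = {0..<?a+?b}" by auto
  ultimately have u: "bij_betw u {0..<?a+?b} (A \<union> B)" by simp
  have "mat (?a+?b) (?a+?b) (\<lambda>(i, j). f (u i) (u j)) =
     four_block_mat (mat ?a ?a (\<lambda>(i, j). f (h i) (h j))) (mat ?a ?b (\<lambda>(i, j). f (h i) (k j)))
       (0\<^sub>m ?b ?a) (mat ?b ?b (\<lambda>(i, j). f (k i) (k j)))"
    by (rule eq_matI) (auto simp: u_def 0 hA kB)
  then show ?thesis unfolding set_det_bij[OF u] set_det_bij[OF h] set_det_bij[OF k]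
    by (metis det_four_block_mat_lower_left_zero mat_carrier)
qed

lemma set_det_row_add:
  assumes "finite A" "r \<in> A"
  shows "set_det A (\<lambda>i j. if i = r then u j + v j else f i j)
    = set_det A (\<lambda>i j. if i = r then u j else f i j) + set_det A (\<lambda>i j. if i = r then v j else f i j)"
proof -
  let ?n = "card A"
  obtain h where h: "bij_betw h {0..<?n} A" using ex_enum assms by blast
  have "r \<in> h ` {0..<?n}" using h assms by (simp add: bij_betw_def)
  then obtain k where k: "k < ?n" "h k = r" by auto
  have hk: "h i = r \<longleftrightarrow> i = k" if "i < ?n" for i
    using that k h by (auto simp: bij_betw_def inj_on_def)
  have m: "mat ?n ?n (\<lambda>(i, j). if h i = r then w (h j) else f (h i) (h j))
     = mat\<^sub>r ?n ?n (\<lambda>i. if i = k then vec ?n (\<lambda>j. w (h j)) else vec ?n (\<lambda>j. f (h i) (h j)))" for w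
    by (rule eq_matI) (auto simp: hk)
  have uv: "vec ?n (\<lambda>j. u (h j) + v (h j)) = vec ?n (\<lambda>j. u (h j)) + vec ?n (\<lambda>j. v (h j))"
    by auto
  show ?thesis
    unfolding set_det_bij[OF h] m[where w = u] m[where w = v] m[where w = "\<lambda>j. u j + v j"] uv
    using k det_row_add[of "\<lambda>_. vec ?n (\<lambda>j. u (h j))" k ?n "\<lambda>_. vec ?n (\<lambda>j. v (h j))"
        "\<lambda>i. vec ?n (\<lambda>j. f (h i) (h j))"]
    by (metis (mono_tags, lifting) Pi_I vec_carrier)
qed

text \<open>Linearity in row \<open>r\<close> splits off a matrix whose row \<open>r\<close>
  vanishes off the diagonal and whose determinant therefore factors. This is the algebraic side of
  deletion and contraction.\<close>

lemma set_det_add_diag: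
  fixes f :: "'i \<Rightarrow> 'i \<Rightarrow> 'a::idom"
  assumes A: "finite A" "r \<in> A"
  shows "set_det A (\<lambda>i j. f i j + (if i = r \<and> j = r then c else 0)) = set_det A f + c * set_det (A - {r}) f"
proof -
  have "set_det A (\<lambda>i j. f i j + (if i = r \<and> j = r then c else 0))
      = set_det A (\<lambda>i j. if i = r then f r j + (if j = r then c else 0) else f i j)"
    using A(1) by (rule set_det_cong) auto
  also have "\<dots> = set_det A (\<lambda>i j. if i = r then f r j else f i j)
      + set_det A (\<lambda>i j. if i = r then (if j = r then c else 0) else f i j)"
    by (rule set_det_row_add[OF A])
  also have "set_det A (\<lambda>i j. if i = r then f r j else f i j) = set_det A f"
    using A(1) by (rule set_det_cong) auto
  also have "A = (A - {r}) \<union> {r}" using A by auto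
  also have "set_det \<dots> (\<lambda>i j. if i = r then (if j = r then c else 0) else f i j)
     = set_det (A - {r}) (\<lambda>i j. if i = r then (if j = r then c else 0) else f i j) * c"
    using A by (subst set_det_block) (auto simp: set_det_singleton)
  also have "set_det (A - {r}) (\<lambda>i j. if i = r then (if j = r then c else 0) else f i j) = set_det (A - {r}) f"
    using A(1) by (intro set_det_cong) auto
  finally show ?thesis using A by (simp add: mult.commute insert_absorb)
qed

lemma set_det_row_sums_zero:
  fixes f :: "'i \<Rightarrow> 'i \<Rightarrow> 'a::idom"
  assumes "finite A" "A \<noteq> {}" and s: "\<And>i. i \<in> A \<Longrightarrow> (\<Sum>j\<in>A. f i j) = 0"
  shows "set_det A f = 0"
proof -
  let ?n = "card A"
  obtain h where h: "bij_betw h {0..<?n} A" using ex_enum assms by blast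
  have hA: "h i \<in> A" if "i < card A" for i using h that by (auto simp: bij_betw_def)
  let ?M = "mat ?n ?n (\<lambda>(i, j). f (h i) (h j))" and ?v = "vec ?n (\<lambda>_. 1::'a)"
  have "?M *\<^sub>v ?v = 0\<^sub>v ?n"
    by (intro eq_vecI) (auto simp: scalar_prod_def sum.reindex_bij_betw[OF h] s hA)
  moreover have "?v \<noteq> 0\<^sub>v ?n"
  proof
    assume "?v = 0\<^sub>v ?n"
    then have "?v $ 0 = 0\<^sub>v ?n $ 0" by simp
    then show False using assms by (simp add: card_gt_0_iff)
  qed
  ultimately have "Determinant.det ?M = 0"
    using det_0_iff_vec_prod_zero[of ?M ?n] vec_carrier[of ?n "\<lambda>_. 1::'a"] by (metis mat_carrier)
  then show ?thesis by (simp add: set_det_bij[OF h])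
qed

lemma set_det_block_diag:
  fixes f :: "'k \<Rightarrow> 'i \<Rightarrow> 'i \<Rightarrow> 'a::idom"
  assumes A: "finite A" and K: "finite K"
  shows "set_det (A \<times> K) (\<lambda>(i, k) (j, m). if k = m then f k i j else 0) = (\<Prod>k\<in>K. set_det A (f k))"
  using K
proof (induction K rule: finite_induct)
  case empty
  then show ?case by (simp add: set_det_empty)
next
  case (insert x K)
  let ?F = "\<lambda>(i, k) (j, m). if k = m then f k i j else 0"
  have "A \<times> insert x K = A \<times> {x} \<union> A \<times> K" by auto
  moreover have "set_det (A \<times> {x} \<union> A \<times> K) ?F = set_det (A \<times> {x}) ?F * set_det (A \<times> K) ?F"
    by (rule set_det_block) (use A insert in auto)
  moreover have "bij_betw (\<lambda>i. (i, x)) A (A \<times> {x})" by (auto simp: bij_betw_def inj_on_def)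
  ultimately show ?case using insert A by (simp only: prod.insert set_det_reindex[OF A] split simp_thms if_True)
qed

text \<open>Adding all rows to row \<open>r\<close> and all columns to column \<open>r\<close> makes both constant up to the
  corner; subtracting a multiple of row \<open>r\<close> from the other ones then removes the summand \<open>c\<close>.\<close>

lemma set_det_add_const:
  fixes L :: "'i \<Rightarrow> 'i \<Rightarrow> 'a::field_char_0"
  assumes A: "finite A" "r \<in> A"
    and rows: "\<And>i. i \<in> A \<Longrightarrow> (\<Sum>j\<in>A. L i j) = 0" and cols: "\<And>j. j \<in> A \<Longrightarrow> (\<Sum>i\<in>A. L i j) = 0"
  shows "set_det A (\<lambda>i j. L i j + c) = c * of_nat (card A) ^ 2 * set_det (A - {r}) L"
proof -
  let ?N = "of_nat (card A) :: 'a"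
  have N: "?N \<noteq> 0" using A by auto
  define P where "P i j = (if i = j then 1 else if i = r then 1 else (0::'a))" for i j
  define S where "S i j = (if i = j then 1 else if j = r then - 1 / ?N else (0::'a))" for i j
  have one: "set_det (A - {r}) F = 1" if "\<And>i j. i \<in> A - {r} \<Longrightarrow> j \<in> A - {r} \<Longrightarrow> F i j = (if i = j then 1 else 0)"
    for F :: "'i \<Rightarrow> 'i \<Rightarrow> 'a"
  proof -
    have "set_det (A - {r}) F = set_det (A - {r}) (\<lambda>i j. if i = j then 1 else 0)"
      using that A by (intro set_det_cong) auto
    then show ?thesis using A by (simp add: set_det_const_diag)
  qed
  have blk1: "set_det A F = F r r * set_det (A - {r}) F" if "\<And>i. i \<in> A - {r} \<Longrightarrow> F i r = 0" for F :: "'i \<Rightarrow> 'i \<Rightarrow> 'a"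
    using set_det_block[of "{r}" "A - {r}" F] A that by (simp add: insert_absorb set_det_singleton)
  have blk2: "set_det A F = F r r * set_det (A - {r}) F" if "\<And>i. i \<in> A - {r} \<Longrightarrow> F r i = 0" for F :: "'i \<Rightarrow> 'i \<Rightarrow> 'a"
    using set_det_block[of "A - {r}" "{r}" F] A that by (simp add: insert_absorb set_det_singleton)
  have P: "set_det A P = 1" using blk1[of "P"] one[of "P"] by (auto simp: P_def)
  have Pt: "set_det A (\<lambda>i j. P j i) = 1" using blk2[of "\<lambda>i j. P j i"] one[of "\<lambda>i j. P j i"] by (auto simp: P_def)
  have "set_det (A - {r}) S = 1" by (rule one) (auto simp: S_def)
  moreover have "S r i = 0" if "i \<in> A - {r}" for i using that by (auto simp: S_def)
  ultimately have S: "set_det A S = 1" using blk2[of S] by (simp add: S_def)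
  define M where "M i j = L i j + c" for i j
  define M1 where "M1 i j = (if i = r then c * ?N else M i j)" for i j
  define M2 where "M2 i j = (if j = r then (if i = r then c * ?N * ?N else c * ?N) else M1 i j)" for i j
  define M3 where "M3 i j = (if i = r then M2 i j else if j = r then 0 else L i j)" for i j
  have d: "x \<in> A \<Longrightarrow> (\<Sum>j\<in>A. (if x = j then g j else 0)) = g x" for x and g :: "'i \<Rightarrow> 'a"
    using A by (simp add: sum.delta)
  have 1: "(\<Sum>k\<in>A. P i k * M k j) = M1 i j" if "i \<in> A" "j \<in> A" for i j
  proof (cases "i = r")
    case True
    then have "(\<Sum>k\<in>A. P i k * M k j) = (\<Sum>k\<in>A. M k j)" by (intro sum.cong) (auto simp: P_def)
    then show ?thesis using True that by (simp add: M1_def M_def sum.distrib cols mult.commute)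
  next
    case False
    then have "(\<Sum>k\<in>A. P i k * M k j) = (\<Sum>k\<in>A. if i = k then M k j else 0)"
      by (intro sum.cong) (auto simp: P_def)
    then show ?thesis using False that by (simp add: d M1_def)
  qed
  have 2: "(\<Sum>k\<in>A. M1 i k * P j k) = M2 i j" if "i \<in> A" "j \<in> A" for i j
  proof (cases "j = r")
    case True
    then have "(\<Sum>k\<in>A. M1 i k * P j k) = (\<Sum>k\<in>A. M1 i k)" by (intro sum.cong) (auto simp: P_def)
    then show ?thesis using True that by (simp add: M2_def M1_def M_def sum.distrib rows mult.commute)
  next
    case False
    then have "(\<Sum>k\<in>A. M1 i k * P j k) = (\<Sum>k\<in>A. if j = k then M1 i k else 0)"
      by (intro sum.cong) (auto simp: P_def)
    then show ?thesis using False that by (simp add: d M2_def)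
  qed
  have 3: "(\<Sum>k\<in>A. S i k * M2 k j) = M3 i j" if "i \<in> A" "j \<in> A" for i j
  proof (cases "i = r")
    case True
    then have "(\<Sum>k\<in>A. S i k * M2 k j) = (\<Sum>k\<in>A. if i = k then M2 k j else 0)"
      by (intro sum.cong) (auto simp: S_def)
    then show ?thesis using True that by (simp add: d M3_def)
  next
    case False
    have "(\<Sum>k\<in>A. S i k * M2 k j) = (\<Sum>k\<in>A. (if i = k then M2 k j else 0) + (if r = k then - 1 / ?N * M2 k j else 0))"
      using False by (intro sum.cong) (auto simp: S_def)
    also have "\<dots> = M2 i j - M2 r j / ?N" using that A by (simp add: sum.distrib d)
    also have "\<dots> = M3 i j" using False N by (auto simp: M3_def M2_def M1_def M_def)
    finally show ?thesis .
  qed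
  have "set_det A M = set_det A P * set_det A M" by (simp add: P)
  also have "\<dots> = set_det A M1" unfolding set_det_mult[OF A(1)] by (rule set_det_cong[OF A(1)]) (rule 1)
  also have "\<dots> = set_det A M1 * set_det A (\<lambda>i j. P j i)" by (simp add: Pt)
  also have "\<dots> = set_det A M2" unfolding set_det_mult[OF A(1)] by (rule set_det_cong[OF A(1)]) (rule 2)
  also have "\<dots> = set_det A S * set_det A M2" by (simp add: S)
  also have "\<dots> = set_det A M3" unfolding set_det_mult[OF A(1)] by (rule set_det_cong[OF A(1)]) (rule 3)
  also have "\<dots> = M3 r r * set_det (A - {r}) M3" by (rule blk1) (auto simp: M3_def)
  also have "set_det (A - {r}) M3 = set_det (A - {r}) L"
    using A by (intro set_det_cong) (auto simp: M3_def)
  finally show ?thesis by (simp add: M3_def M2_def M_def power2_eq_square)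
qed

section \<open>Rooted forests\<close>

definition edge_rel :: "('e \<Rightarrow> 'v) \<Rightarrow> ('e \<Rightarrow> 'v) \<Rightarrow> 'e set \<Rightarrow> ('v \<times> 'v) set" where
  "edge_rel s t F = (\<lambda>e. (s e, t e)) ` F \<union> (\<lambda>e. (t e, s e)) ` F"

text \<open>The incidence matrix times its transpose, written edge by edge: deleting an edge removes
  one summand of rank at most one, and a loop contributes zero.\<close>

definition laplacian :: "('e \<Rightarrow> 'v) \<Rightarrow> ('e \<Rightarrow> 'v) \<Rightarrow> 'e set \<Rightarrow> 'v \<Rightarrow> 'v \<Rightarrow> int" where
  "laplacian s t E x y =
     (\<Sum>e\<in>E. (of_bool (x = s e) - of_bool (x = t e)) * (of_bool (y = s e) - of_bool (y = t e)))"

text \<open>No vertex set occurs: the root is everything in the type outside \<open>U\<close>.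
  Acyclicity is not mentioned either; the cardinality condition below takes its place,
  \<open>card U\<close> being the least size of a finite rooted edge set.\<close>

definition rooted :: "('e \<Rightarrow> 'v) \<Rightarrow> ('e \<Rightarrow> 'v) \<Rightarrow> 'e set \<Rightarrow> 'v set \<Rightarrow> bool" where
  "rooted s t F U \<longleftrightarrow> (\<forall>u\<in>U. \<exists>w. w \<notin> U \<and> (u, w) \<in> (edge_rel s t F)\<^sup>*)"

text \<open>These are the spanning trees of the graph in which the complement of \<open>U\<close> is contracted to a
  single vertex.\<close>

definition rooted_forests :: "('e \<Rightarrow> 'v) \<Rightarrow> ('e \<Rightarrow> 'v) \<Rightarrow> 'e set \<Rightarrow> 'v set \<Rightarrow> 'e set set" where
  "rooted_forests s t E U = {F. F \<subseteq> E \<and> card F = card U \<and> rooted s t F U}"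

lemma edge_rel_mono: "F \<subseteq> F' \<Longrightarrow> (edge_rel s t F)\<^sup>* \<subseteq> (edge_rel s t F')\<^sup>*"
  by (rule rtrancl_mono) (auto simp: edge_rel_def)

lemma edge_relE:
  assumes "(x, y) \<in> edge_rel s t F"
  obtains e where "e \<in> F" "x = s e \<and> y = t e \<or> x = t e \<and> y = s e"
  using assms by (auto simp: edge_rel_def)

lemma edge_relI: "e \<in> F \<Longrightarrow> (s e, t e) \<in> edge_rel s t F" "e \<in> F \<Longrightarrow> (t e, s e) \<in> edge_rel s t F"
  by (auto simp: edge_rel_def)

lemma rooted_border:
  assumes "rooted s t F U" "U \<noteq> {}"
  shows "\<exists>e\<in>F. (s e \<in> U) \<noteq> (t e \<in> U)"
proof (rule ccontr)
  assume no: "\<not> ?thesis"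
  obtain u w where uw: "u \<in> U" "w \<notin> U" "(u, w) \<in> (edge_rel s t F)\<^sup>*"
    using assms unfolding rooted_def by blast
  from uw(3,1) have "w \<in> U"
    by (induction rule: rtrancl_induct) (use no in \<open>auto elim!: edge_relE\<close>)
  with uw show False by simp
qed

text \<open>The walk is followed only until it first leaves \<open>U\<close>. Each edge used before
  that starts in \<open>U\<close>, so \<open>e\<close> is not among them.\<close>

lemma reach_avoiding:
  assumes "(u, w) \<in> (edge_rel s t F)\<^sup>*" "w \<notin> U" and e: "s e \<notin> U" "t e \<notin> U"
  shows "\<exists>w'. w' \<notin> U \<and> (u, w') \<in> (edge_rel s t (F - {e}))\<^sup>*"
  using assms(1,2)
proof (induction rule: converse_rtrancl_induct)
  case base
  then show ?case by blast
next
  case (step x y)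
  obtain e' where e': "e' \<in> F" "x = s e' \<and> y = t e' \<or> x = t e' \<and> y = s e'"
    using step(1) by (rule edge_relE)
  show ?case
  proof (cases "e' = e")
    case True
    then have "x \<notin> U" using e' e by auto
    then show ?thesis by blast
  next
    case False
    then have "(x, y) \<in> edge_rel s t (F - {e})" using e' by (auto simp: edge_rel_def)
    then show ?thesis using step by (meson converse_rtrancl_into_rtrancl)
  qed
qed

text \<open>Contraction of \<open>e\<close>: its end \<open>b\<close> joins the root. Forwards, both
  ends of \<open>e\<close> lie outside \<open>U - {b}\<close>, so \<open>reach_avoiding\<close>
  applies; backwards, a walk that ends in \<open>b\<close> is continued along
  \<open>e\<close>.\<close>

lemma rooted_remove:
  assumes e: "e \<in> F" and b: "b \<in> U" and ends: "s e = b \<and> t e \<notin> U \<or> t e = b \<and> s e \<notin> U"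
  shows "rooted s t F U \<longleftrightarrow> rooted s t (F - {e}) (U - {b})"
proof
  assume L: "rooted s t F U"
  have "s e \<notin> U - {b}" "t e \<notin> U - {b}" using ends by auto
  then have "\<exists>w'. w' \<notin> U - {b} \<and> (u, w') \<in> (edge_rel s t (F - {e}))\<^sup>*"
    if "(u, w) \<in> (edge_rel s t F)\<^sup>*" "w \<notin> U" for u w
    by (rule reach_avoiding[where U = "U - {b}" and w = w, rotated 2]) (use that in auto)
  then show "rooted s t (F - {e}) (U - {b})" using L unfolding rooted_def by (meson DiffD1)
next
  assume R: "rooted s t (F - {e}) (U - {b})"
  have sub: "(edge_rel s t (F - {e}))\<^sup>* \<subseteq> (edge_rel s t F)\<^sup>*" by (rule edge_rel_mono) auto
  have bw: "\<exists>w. w \<notin> U \<and> (b, w) \<in> (edge_rel s t F)\<^sup>*"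
    using ends edge_relI[OF e, where s = s and t = t] by blast
  show "rooted s t F U"
    unfolding rooted_def
  proof
    fix u assume u: "u \<in> U"
    show "\<exists>w. w \<notin> U \<and> (u, w) \<in> (edge_rel s t F)\<^sup>*"
    proof (cases "u = b")
      case False
      then obtain w where w: "w \<notin> U - {b}" "(u, w) \<in> (edge_rel s t F)\<^sup>*"
        using R u sub unfolding rooted_def by blast
      show ?thesis
      proof (cases "w = b")
        case True
        then show ?thesis using bw w by (meson rtrancl_trans)
      next
        case False
        then show ?thesis using w by blast
      qed
    qed (use bw in simp)
  qed
qed

text \<open>A border edge is chosen and its end in \<open>U\<close> is moved to the root, until
  \<open>U\<close> is empty; each of the \<open>card U\<close> rounds uses one edge.\<close>

lemma rooted_subset:
  assumes "finite U" "rooted s t F U"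
  shows "\<exists>F'\<subseteq>F. finite F' \<and> card F' = card U \<and> rooted s t F' U"
  using assms
proof (induction "card U" arbitrary: U F)
  case 0
  then show ?case by (intro exI[of _ "{}"]) (auto simp: rooted_def)
next
  case (Suc n)
  then have "U \<noteq> {}" by auto
  then obtain e where e: "e \<in> F" "(s e \<in> U) \<noteq> (t e \<in> U)"
    using rooted_border Suc by blast
  define b where "b = (if s e \<in> U then s e else t e)"
  have b: "b \<in> U" "s e = b \<and> t e \<notin> U \<or> t e = b \<and> s e \<notin> U" using e by (auto simp: b_def)
  have "rooted s t (F - {e}) (U - {b})"
    using rooted_remove[of e F b U s t, OF e(1) b] Suc by simp
  moreover have c: "n = card (U - {b})" using Suc b by simp
  ultimately obtain F' where F': "F' \<subseteq> F - {e}" "finite F'" "card F' = card (U - {b})" "rooted s t F' (U - {b})"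
    using Suc.hyps(1)[of "U - {b}" "F - {e}"] Suc.prems by auto
  have e': "e \<notin> F'" using F' by auto
  then have "insert e F' - {e} = F'" by auto
  then have "rooted s t (insert e F') U" using rooted_remove[of e "insert e F'" b U s t, OF _ b] F' by simp
  moreover have "card (insert e F') = card U" using F' e' b c Suc(2) by simp
  ultimately show ?case using F' e by (intro exI[of _ "insert e F'"]) auto
qed

lemma rooted_card:
  assumes "finite U" "finite F" "rooted s t F U"
  shows "card U \<le> card F"
  using rooted_subset[OF assms(1,3)] assms(2) card_mono by metis

lemma laplacian_row_sum:
  assumes "finite V" "\<And>e. e \<in> E \<Longrightarrow> s e \<in> V \<and> t e \<in> V"
  shows "(\<Sum>y\<in>V. laplacian s t E x y) = 0"
proof -
  have "(\<Sum>y\<in>V. laplacian s t E x y) = (\<Sum>e\<in>E. \<Sum>y\<in>V.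
      (of_bool (x = s e) - of_bool (x = t e)) * (of_bool (y = s e) - of_bool (y = t e)))"
    unfolding laplacian_def by (rule sum.swap)
  also have "\<dots> = 0"
    using assms
    by (intro sum.neutral) (auto simp: sum_distrib_left[symmetric] sum_subtractf of_bool_def)
  finally show ?thesis .
qed

text \<open>Deletion and contraction of an edge that leaves \<open>U\<close>: contracting it removes its end from \<open>U\<close>.\<close>

theorem matrix_forest:
  assumes "finite E" "finite U"
  shows "set_det U (laplacian s t E) = int (card (rooted_forests s t E U))"
  using assms
proof (induction "card E" arbitrary: E U rule: less_induct)
  case less
  show ?case
  proof (cases "U = {}")
    case True
    then have "rooted_forests s t E U = {{}}"
      using finite_subset[OF _ less(2)] by (auto simp: rooted_forests_def rooted_def)
    then show ?thesis using True by (simp add: set_det_empty)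
  next
    case U: False
    show ?thesis
    proof (cases "\<exists>e\<in>E. s e \<notin> U \<or> t e \<notin> U")
      \<comment> \<open>Every edge lies inside \<open>U\<close>: nothing can reach the outside, and
        the all-one vector is in the kernel of the matrix.\<close>
      case False
      have "rooted_forests s t E U = {}"
        using rooted_border[of s t _ U] False U by (fastforce simp: rooted_forests_def)
      moreover have "set_det U (laplacian s t E) = 0"
        using False less(3) U by (intro set_det_row_sums_zero laplacian_row_sum) auto
      ultimately show ?thesis by simp
    next
      case True
      then obtain e where e: "e \<in> E" "s e \<notin> U \<or> t e \<notin> U" by blast
      define E' where "E' = E - {e}"
      have E': "finite E'" "card E' < card E" using e less(2) card_Diff1_less[of E e] by (auto simp: E'_def simp del: card_Diff_singleton)
      have lap: "laplacian s t E x y = laplacian s t E' x y +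
          (of_bool (x = s e) - of_bool (x = t e)) * (of_bool (y = s e) - of_bool (y = t e))" for x y
        using e less(2) by (simp add: laplacian_def E'_def sum.remove[of E e])
      show ?thesis
      proof (cases "s e \<notin> U \<and> t e \<notin> U")
        case out: True
        have "set_det U (laplacian s t E) = set_det U (laplacian s t E')"
          using less(3) by (rule set_det_cong) (use out lap in auto)
        moreover have "rooted_forests s t E U = rooted_forests s t E' U"
        proof -
          \<comment> \<open>An edge with both ends outside \<open>U\<close> could be dropped from
            \<open>F\<close>, leaving a rooted set with fewer than \<open>card U\<close>
            edges.\<close>
          have "e \<notin> F" if F: "F \<subseteq> E" "card F = card U" "rooted s t F U" for F
          proof
            assume eF: "e \<in> F"
            have fin: "finite F" using F less(2) finite_subset by blast
            have "rooted s t (F - {e}) U"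
              using F(3) reach_avoiding[where U = U and e = e and F = F and s = s and t = t] out
              unfolding rooted_def by meson
            then have "card U \<le> card (F - {e})" using less fin by (intro rooted_card) auto
            moreover have "card (F - {e}) < card F" using fin eF by (rule card_Diff1_less)
            ultimately show False using F by simp
          qed
          then show ?thesis by (auto simp: rooted_forests_def E'_def)
        qed
        ultimately show ?thesis using less E' by simp
      next
        case False
        define b where "b = (if s e \<in> U then s e else t e)"
        have b: "b \<in> U" "s e = b \<and> t e \<notin> U \<or> t e = b \<and> s e \<notin> U" using e False by (auto simp: b_def)
        \<comment> \<open>Within \<open>U\<close> the edge \<open>e\<close> contributes only to the
          diagonal entry at \<open>b\<close>. The two determinants that result count the forests
          without \<open>e\<close> and those with \<open>e\<close>.\<close>
        have "set_det U (laplacian s t E) = set_det U (\<lambda>x y. laplacian s t E' x y + (if x = b \<and> y = b then 1 else 0))"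
          using less(3) by (rule set_det_cong) (use b in \<open>auto simp: lap\<close>)
        also have "\<dots> = set_det U (laplacian s t E') + set_det (U - {b}) (laplacian s t E')"
          using less(3) b by (simp add: set_det_add_diag)
        also have "\<dots> = int (card (rooted_forests s t E' U)) + int (card (rooted_forests s t E' (U - {b})))"
          using less E' by simp
        also have "\<dots> = int (card (rooted_forests s t E U))"
        proof -
          have "rooted_forests s t E U = rooted_forests s t E' U \<union> insert e ` rooted_forests s t E' (U - {b})"
          proof (intro equalityI subsetI)
            fix F assume F: "F \<in> rooted_forests s t E U"
            show "F \<in> rooted_forests s t E' U \<union> insert e ` rooted_forests s t E' (U - {b})"
            proof (cases "e \<in> F")
              case True
              have "finite F" using F less(2) finite_subset by (auto simp: rooted_forests_def)
              then have "F - {e} \<in> rooted_forests s t E' (U - {b})"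
                using F True b rooted_remove[of e F b U s t, OF True b] by (auto simp: rooted_forests_def E'_def)
              moreover have "F = insert e (F - {e})" using True by auto
              ultimately show ?thesis by blast
            qed (use F in \<open>auto simp: rooted_forests_def E'_def\<close>)
          next
            fix F assume "F \<in> rooted_forests s t E' U \<union> insert e ` rooted_forests s t E' (U - {b})"
            then show "F \<in> rooted_forests s t E U"
            proof
              assume "F \<in> insert e ` rooted_forests s t E' (U - {b})"
              then obtain F' where F': "F = insert e F'" "F' \<subseteq> E'" "card F' = card (U - {b})" "rooted s t F' (U - {b})"
                by (auto simp: rooted_forests_def)
              have "finite F'" "e \<notin> F'" using F' E' finite_subset by (auto simp: E'_def)
              moreover have "card U > 0" using b less by (auto simp: card_gt_0_iff)
              moreover have "F - {e} = F'" using \<open>e \<notin> F'\<close> F' by auto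
              ultimately show ?thesis using F' b less rooted_remove[of e F b U s t, OF _ b] e
                by (auto simp: rooted_forests_def E'_def)
            qed (auto simp: rooted_forests_def E'_def)
          qed
          moreover have "inj_on (insert e) (rooted_forests s t E' (U - {b}))"
            by (rule inj_onI) (auto simp: rooted_forests_def E'_def)
          moreover have "rooted_forests s t E' U \<inter> insert e ` rooted_forests s t E' (U - {b}) = {}"
            by (auto simp: rooted_forests_def E'_def)
          moreover have "finite (rooted_forests s t E' A)" for A
            using E' by (auto simp: rooted_forests_def)
          ultimately show ?thesis by (simp add: card_Un_disjoint card_image)
        qed
        finally show ?thesis .
      qed
    qed
  qed
qed

section \<open>The matrix-tree theorem for multigraphs\<close>

text \<open>Connectedness is defined by walks confined to \<open>verts H\<close>; a step along an
  arc cannot leave that set, so the plain closure gives the same.\<close>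

lemma connected_iff_edge_rel:
  assumes "wf_digraph H"
  shows "Digraph_Component.connected H \<longleftrightarrow>
    verts H \<noteq> {} \<and> (\<forall>u\<in>verts H. \<forall>v\<in>verts H. (u, v) \<in> (edge_rel (tail H) (head H) (arcs H))\<^sup>*)"
proof -
  interpret wf_digraph H by fact
  have ends: "arcs_ends (with_proj (mk_symmetric H)) = edge_rel (tail H) (head H) (arcs H)"
    unfolding arcs_ends_def arc_to_ends_def edge_rel_def by (simp add: parcs_mk_symmetric) blast
  have V: "x \<in> verts H" "y \<in> verts H" if "(x, y) \<in> edge_rel (tail H) (head H) (arcs H)" for x y
    using that by (auto elim: edge_relE)
  have "u \<rightarrow>\<^sup>*\<^bsub>with_proj (mk_symmetric H)\<^esub> v \<longleftrightarrow> (u, v) \<in> (edge_rel (tail H) (head H) (arcs H))\<^sup>*"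
    if u: "u \<in> verts H" for u v
    unfolding reachable_def ends
  proof
    assume "(u, v) \<in> rtrancl_on (verts (with_proj (mk_symmetric H))) (edge_rel (tail H) (head H) (arcs H))"
    then show "(u, v) \<in> (edge_rel (tail H) (head H) (arcs H))\<^sup>*"
      by (rule rtrancl_on_rtranclI)
  next
    assume "(u, v) \<in> (edge_rel (tail H) (head H) (arcs H))\<^sup>*"
    then show "(u, v) \<in> rtrancl_on (verts (with_proj (mk_symmetric H))) (edge_rel (tail H) (head H) (arcs H))"
    proof (induction rule: rtrancl_induct)
      case base
      show ?case using u by simp
    next
      case (step y z)
      show ?case by (rule rtrancl_on_into_rtrancl_on[OF step(3,2)]) (simp add: V(2)[OF step(2)])
    qed
  qed
  then show ?thesis unfolding Digraph_Component.connected_def strongly_connected_def by simp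
qed

lemma sym_edge_rel: "(u, v) \<in> (edge_rel s t F)\<^sup>* \<longleftrightarrow> (v, u) \<in> (edge_rel s t F)\<^sup>*"
  using sym_rtrancl[of "edge_rel s t F"] by (auto simp: sym_def edge_rel_def)

context multigraph
begin

context
  fixes S :: "'e set" and r :: 'v
  assumes S: "S \<subseteq> arcs X" and orient: "\<And>e. e \<in> arcs X \<Longrightarrow> rv e \<in> S \<longleftrightarrow> e \<notin> S"
    and r: "r \<in> verts X"
begin

definition edge_subgraph :: "'e set \<Rightarrow> ('v, 'e) pre_digraph" where
  "edge_subgraph F = \<lparr>verts = verts X, arcs = F \<union> rv ` F, tail = tail X, head = head X\<rparr>"

lemma edge_subgraph_simps [simp]:
  "verts (edge_subgraph F) = verts X" "arcs (edge_subgraph F) = F \<union> rv ` F"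
  "tail (edge_subgraph F) = tail X" "head (edge_subgraph F) = head X"
  by (simp_all add: edge_subgraph_def)

lemma arcs_edge_subgraph: "F \<subseteq> S \<Longrightarrow> F \<union> rv ` F \<subseteq> arcs X"
  using S by auto

lemma wf_edge_subgraph: "F \<subseteq> S \<Longrightarrow> wf_digraph (edge_subgraph F)"
  using S by unfold_locales auto

lemma edge_rel_edge_subgraph:
  "F \<subseteq> S \<Longrightarrow> edge_rel (tail X) (head X) (F \<union> rv ` F) = edge_rel (tail X) (head X) F"
  using S by (fastforce simp: edge_rel_def image_iff)

lemma connected_edge_subgraph:
  assumes F: "F \<subseteq> S"
  shows "Digraph_Component.connected (edge_subgraph F) \<longleftrightarrow> rooted (tail X) (head X) F (verts X - {r})"
proof
  assume "Digraph_Component.connected (edge_subgraph F)"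
  then show "rooted (tail X) (head X) F (verts X - {r})"
    unfolding connected_iff_edge_rel[OF wf_edge_subgraph[OF F]] rooted_def
    using r by (auto simp: edge_rel_edge_subgraph[OF F])
next
  assume R: "rooted (tail X) (head X) F (verts X - {r})"
  let ?E = "(edge_rel (tail X) (head X) F)\<^sup>*"
  \<comment> \<open>Walks stay in \<open>verts X\<close>, so a walk that leaves
    \<open>verts X - {r}\<close> has arrived at \<open>r\<close>.\<close>
  have V: "w \<in> verts X" if "(u, w) \<in> ?E" "u \<in> verts X" for u w
    using that by (induction rule: rtrancl_induct) (use F S in \<open>auto elim!: edge_relE\<close>)
  have "(u, r) \<in> ?E" if "u \<in> verts X" for u
  proof (cases "u = r")
    case False
    then obtain w where "w \<notin> verts X - {r}" "(u, w) \<in> ?E" using R that unfolding rooted_def by blast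
    then show ?thesis using V[of u w] that by auto
  qed simp
  then have "(u, v) \<in> ?E" if "u \<in> verts X" "v \<in> verts X" for u v
    using that sym_edge_rel by (metis rtrancl_trans)
  then show "Digraph_Component.connected (edge_subgraph F)"
    unfolding connected_iff_edge_rel[OF wf_edge_subgraph[OF F]]
    using r by (auto simp: edge_rel_edge_subgraph[OF F])
qed

text \<open>A repeated undirected edge would bring the path back to the vertex from which it first
  took that edge.\<close>

lemma apath_distinct_edges:
  assumes F: "F \<subseteq> S" and p: "pre_digraph.apath (edge_subgraph F) u p v"
  shows "distinct (map (\<lambda>e. {e, rv e}) p)"
  using p
proof (induction p arbitrary: u)
  case (Cons c p)
  interpret H: wf_digraph "edge_subgraph F" by (rule wf_edge_subgraph[OF F])
  from Cons.prems have c: "c \<in> arcs (edge_subgraph F)" "H.apath (head X c) p v"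
    "tail X c \<notin> set (H.awalk_verts (head X c) p)"
    by (auto simp: H.apath_Cons_iff)
  have "{c, rv c} \<noteq> {d, rv d}" if d: "d \<in> set p" for d
  proof
    assume eq: "{c, rv c} = {d, rv d}"
    have "set p \<subseteq> F \<union> rv ` F" using c(2) by (simp add: H.apath_def H.awalk_def)
    then have "d \<in> arcs X" using d arcs_edge_subgraph[OF F] by blast
    then have "tail X c \<in> {tail X d, head X d}" using eq by (auto simp: doubleton_eq_iff)
    moreover have "tail X d \<in> set (H.awalk_verts (head X c) p)" "head X d \<in> set (H.awalk_verts (head X c) p)"
      using H.awalk_verts_arc1[OF d] H.awalk_verts_arc2[OF H.awalkI_apath[OF c(2)] d] by simp_all
    ultimately show False using c(3) by auto
  qed
  then show ?case using Cons.IH[OF c(2)] by auto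
qed simp

text \<open>Acyclic means minimal. A cycle makes its first edge redundant, so a smaller rooted set
  remains; conversely, an edge outside a minimal rooted subset closes a cycle with the path that the
  subset provides between its ends.\<close>

lemma acyclic_edge_subgraph:
  assumes F: "F \<subseteq> S" and R: "rooted (tail X) (head X) F (verts X - {r})"
  shows "acyclic_multigraph (edge_subgraph F) rv \<longleftrightarrow> card F = card (verts X - {r})"
proof -
  let ?E = "\<lambda>F. (edge_rel (tail X) (head X) F)\<^sup>*"
  have fin: "finite F" using F S finite_subset[OF _ finite_arcs] by blast
  interpret H: wf_digraph "edge_subgraph F" by (rule wf_edge_subgraph[OF F])
  have le: "card (verts X - {r}) \<le> card F" by (rule rooted_card[OF _ fin R]) simp
  have "card (verts X - {r}) < card F"
    if p: "H.cycle p" "distinct (map (\<lambda>e. {e, rv e}) p)" for p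
  proof -
    obtain e q where eq: "p = e # q" "H.awalk (head X e) q (tail X e)" "e \<in> F \<union> rv ` F"
    proof -
      from p obtain u where "H.awalk u p u" "p \<noteq> []" by (auto simp: H.cycle_def)
      then show ?thesis using that by (cases p) (auto simp: H.awalk_Cons_iff)
    qed
    \<comment> \<open>The cycle may run against the orientation, in which case it is
      \<open>rv e\<close> that lies in \<open>F\<close>.\<close>
    define F' where "F' = F - {e, rv e}"
    have eG: "e \<in> arcs X" using eq(3) arcs_edge_subgraph[OF F] by blast
    have "\<exists>f\<in>F. f \<in> {e, rv e}" using eq(3) by auto
    then have "F' \<subset> F" by (auto simp: F'_def)
    then have less: "card F' < card F" using fin by (rule psubset_card_mono[rotated])
    have path: "(u, v) \<in> ?E F'" if "H.awalk u q v" "\<forall>d\<in>set q. {d, rv d} \<noteq> {e, rv e}" for u v q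
      using that
    proof (induction q arbitrary: u)
      case (Cons d q)
      then have d: "d \<in> F \<union> rv ` F" "tail X d = u" "H.awalk (head X d) q v" by (auto simp: H.awalk_Cons_iff)
      have ne: "{d, rv d} \<noteq> {e, rv e}" using Cons.prems(2) by simp
      obtain f where f: "f \<in> F" "d = f \<or> d = rv f" using d(1) by blast
      have fX: "f \<in> arcs X" using f(1) F S by blast
      have fd: "{f, rv f} = {d, rv d}" using f(2) by (elim disjE) auto
      have "f \<notin> {e, rv e}"
      proof
        assume "f \<in> {e, rv e}"
        then have "{f, rv f} = {e, rv e}" by (elim insertE) auto
        then show False using fd ne by simp
      qed
      then have f': "f \<in> F'" using f(1) by (simp add: F'_def)
      have "u = tail X f \<and> head X d = head X f \<or> u = head X f \<and> head X d = tail X f"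
        using f(2) d(2) fX by (elim disjE) auto
      then have "(u, head X d) \<in> edge_rel (tail X) (head X) F'"
        by (elim disjE conjE) (simp_all add: edge_relI[OF f'])
      moreover have "(head X d, v) \<in> ?E F'" using Cons.IH[OF d(3)] Cons.prems(2) by simp
      ultimately show ?case by (rule converse_rtrancl_into_rtrancl)
    qed (simp add: H.awalk_Nil_iff)
    have "(head X e, tail X e) \<in> ?E F'" by (rule path[OF eq(2)]) (use p(2) eq(1) in auto)
    then have "(tail X f, head X f) \<in> ?E F' \<and> (head X f, tail X f) \<in> ?E F'" if "f \<in> F" for f
    proof (cases "f \<in> {e, rv e}")
      case True
      with \<open>(head X e, tail X e) \<in> ?E F'\<close> sym_edge_rel[of "head X e" "tail X e"] eG
      show ?thesis by auto
    next
      case False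
      then have "f \<in> F'" using that by (simp add: F'_def)
      then show ?thesis by (intro conjI r_into_rtrancl edge_relI)
    qed
    then have "edge_rel (tail X) (head X) F \<subseteq> ?E F'" unfolding edge_rel_def[of _ _ F] by blast
    then have "?E F \<subseteq> ?E F'" by (rule rtrancl_subset_rtrancl)
    then have "rooted (tail X) (head X) F' (verts X - {r})" using R unfolding rooted_def by blast
    then have "card (verts X - {r}) \<le> card F'" by (rule rooted_card[rotated 2]) (use fin in \<open>auto simp: F'_def\<close>)
    with less show ?thesis by simp
  qed
  moreover have "\<exists>p. H.cycle p \<and> distinct (map (\<lambda>e. {e, rv e}) p)" if ne: "card F \<noteq> card (verts X - {r})"
  proof -
    obtain F' where F': "F' \<subseteq> F" "card F' = card (verts X - {r})" "rooted (tail X) (head X) F' (verts X - {r})"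
      using rooted_subset[OF _ R] by auto
    have F'S: "F' \<subseteq> S" using F F' by auto
    have "F' \<noteq> F" using F'(2) ne by blast
    then obtain e where e: "e \<in> F" "e \<notin> F'" using F'(1) by blast
    have eG: "e \<in> arcs X" using e F S by blast
    interpret H': wf_digraph "edge_subgraph F'" by (rule wf_edge_subgraph[OF F'S])
    have "Digraph_Component.connected (edge_subgraph F')" using connected_edge_subgraph[OF F'S] F' by simp
    moreover have "symmetric (edge_subgraph F')"
      unfolding symmetric_conv
    proof
      fix d assume "d \<in> arcs (edge_subgraph F')"
      then have d: "d \<in> F' \<union> rv ` F'" "d \<in> arcs X" using arcs_edge_subgraph[OF F'S] by auto
      then have "rv d \<in> arcs (edge_subgraph F')" by auto
      then show "\<exists>e2\<in>arcs (edge_subgraph F'). tail (edge_subgraph F') d = head (edge_subgraph F') e2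
          \<and> head (edge_subgraph F') d = tail (edge_subgraph F') e2"
        using d by (intro bexI[of _ "rv d"]) auto
    qed
    ultimately have "head X e \<rightarrow>\<^sup>*\<^bsub>edge_subgraph F'\<^esub> tail X e"
      using H'.reachable_mk_symmetric_eq eG by (simp add: Digraph_Component.connected_def strongly_connected_def)
    then obtain q where q: "H'.apath (head X e) q (tail X e)" unfolding H'.reachable_apath by blast
    have arcs: "set q \<subseteq> F' \<union> rv ` F'" using q by (auto simp: H'.apath_def H'.awalk_def)
    have "compatible (edge_subgraph F) (edge_subgraph F')" by (simp add: compatible_def)
    then have "H.cas = H'.cas" "H.awalk_verts = H'.awalk_verts"
      using compatible_cas compatible_awalk_verts by blast+
    then have "H.awalk (head X e) q (tail X e)" "distinct (H.awalk_verts (head X e) q)"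
      using q subset_trans[OF arcs Un_mono[OF F'(1) image_mono[OF F'(1)]]]
      by (simp_all add: H'.apath_def H'.awalk_def H.awalk_def)
    then have "H.cycle (e # q)"
      unfolding H.cycle_def using e by (intro exI[of _ "tail X e"]) (auto simp: H.awalk_Cons_iff)
    \<comment> \<open>\<open>S\<close> contains only one arc of each inverse pair, so
      \<open>e\<close>, which is not in \<open>F'\<close>, is not the inverse of an arc of
      \<open>F'\<close> either.\<close>
    moreover have "{e, rv e} \<noteq> {d, rv d}" if "d \<in> set q" for d
    proof
      assume "{e, rv e} = {d, rv d}"
      then have "e \<in> F' \<union> rv ` F'" using that arcs by (auto simp: doubleton_eq_iff)
      then obtain f where f: "f \<in> F'" "e = rv f" using e by blast
      then have "f \<in> arcs X" "f \<in> S" "rv f \<in> S" using e F F'S S by auto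
      then show False using orient[of f] by simp
    qed
    then have "distinct (map (\<lambda>e. {e, rv e}) (e # q))"
      using apath_distinct_edges[OF F'S q] by auto
    ultimately show ?thesis by blast
  qed
  ultimately show ?thesis unfolding acyclic_multigraph_def using le by (metis less_irrefl)
qed

lemma spanning_trees_eq:
  "spanning_trees X rv = edge_subgraph ` rooted_forests (tail X) (head X) S (verts X - {r})"
proof (intro equalityI subsetI)
  fix H assume H: "H \<in> spanning_trees X rv"
  define F where "F = arcs H \<inter> S"
  have sub: "arcs H \<subseteq> arcs X" "verts H = verts X" "tail H = tail X" "head H = head X" "rv ` arcs H \<subseteq> arcs H"
    using H by (auto simp: spanning_trees_def spanning_def subgraph_def compatible_def)
  have "arcs H = F \<union> rv ` F"
  proof (intro equalityI subsetI)
    fix e assume e: "e \<in> arcs H"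
    show "e \<in> F \<union> rv ` F"
    proof (cases "e \<in> S")
      case False
      then have "rv e \<in> F" using e sub orient[of e] by (auto simp: F_def)
      then have "rv (rv e) \<in> rv ` F" by (rule imageI)
      then show ?thesis by simp
    qed (use e in \<open>simp add: F_def\<close>)
  qed (use sub in \<open>auto simp: F_def\<close>)
  then have HF: "H = edge_subgraph F" using sub by (simp add: edge_subgraph_def)
  have F: "F \<subseteq> S" by (simp add: F_def)
  have "Digraph_Component.connected (edge_subgraph F)" "acyclic_multigraph (edge_subgraph F) rv"
    using H HF by (auto simp: spanning_trees_def)
  then have "F \<in> rooted_forests (tail X) (head X) S (verts X - {r})"
    using F connected_edge_subgraph[OF F] acyclic_edge_subgraph[OF F] by (simp add: rooted_forests_def)
  then show "H \<in> edge_subgraph ` rooted_forests (tail X) (head X) S (verts X - {r})" using HF by blast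
next
  fix H assume "H \<in> edge_subgraph ` rooted_forests (tail X) (head X) S (verts X - {r})"
  then obtain F where HF: "H = edge_subgraph F" and F: "F \<subseteq> S" "card F = card (verts X - {r})"
    "rooted (tail X) (head X) F (verts X - {r})" by (auto simp: rooted_forests_def)
  have "spanning H X"
    using F S wf_edge_subgraph[OF F(1)] wf_digraph by (auto simp: spanning_def subgraph_def HF compatible_def)
  moreover have "rv ` arcs H \<subseteq> arcs H" by (auto simp: HF)
  ultimately show "H \<in> spanning_trees X rv"
    using connected_edge_subgraph[OF F(1)] acyclic_edge_subgraph[OF F(1,3)] F
    by (simp add: spanning_trees_def HF)
qed

theorem matrix_tree:
  "int (card (spanning_trees X rv)) = set_det (verts X - {r}) (laplacian (tail X) (head X) S)"
proof -
  have inj: "inj_on edge_subgraph (rooted_forests (tail X) (head X) S (verts X - {r}))"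
  proof (rule inj_onI)
    fix F F'
    assume FF: "F \<in> rooted_forests (tail X) (head X) S (verts X - {r})"
      "F' \<in> rooted_forests (tail X) (head X) S (verts X - {r})" "edge_subgraph F = edge_subgraph F'"
    have "F = (F \<union> rv ` F) \<inter> S" if "F \<subseteq> S" for F
      using that S orient by auto
    moreover have "F \<union> rv ` F = F' \<union> rv ` F'" using FF(3) by (simp add: edge_subgraph_def)
    ultimately show "F = F'" using FF(1,2) by (metis (mono_tags, lifting) mem_Collect_eq rooted_forests_def)
  qed
  have "finite S" using S finite_subset[OF _ finite_arcs] by blast
  then show ?thesis
    unfolding spanning_trees_eq card_image[OF inj] by (subst matrix_forest) auto
qed

lemma spanning_trees_pos:
  assumes "Digraph_Component.connected X"
  shows "card (spanning_trees X rv) > 0"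
proof -
  have "S \<union> rv ` S = arcs X"
  proof (intro equalityI subsetI)
    fix e assume e: "e \<in> arcs X"
    show "e \<in> S \<union> rv ` S"
    proof (cases "e \<in> S")
      case False
      then have "rv (rv e) \<in> rv ` S" using orient[OF e] by (intro imageI) simp
      then show ?thesis by simp
    qed simp
  qed (use S in auto)
  then have "edge_subgraph S = X" by (simp add: edge_subgraph_def)
  then have "rooted (tail X) (head X) S (verts X - {r})" using assms connected_edge_subgraph[of S] by simp
  then obtain F where "F \<subseteq> S" "card F = card (verts X - {r})" "rooted (tail X) (head X) F (verts X - {r})"
    using rooted_subset[of "verts X - {r}" "tail X" "head X" S] by auto
  then have "edge_subgraph F \<in> spanning_trees X rv" by (auto simp: spanning_trees_eq rooted_forests_def)
  moreover have "finite (spanning_trees X rv)"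
    using finite_subset[OF S finite_arcs] by (simp add: spanning_trees_eq rooted_forests_def)
  ultimately show ?thesis by (auto simp: card_gt_0_iff)
qed

end

end

section \<open>Block-circulant determinants\<close>

definition chi :: "nat \<Rightarrow> int \<Rightarrow> complex" where
  "chi N m = cis (2 * pi * of_int m / of_nat N)"

lemma chi_add: "chi N (a + b) = chi N a * chi N b"
  by (simp add: chi_def cis_mult distrib_left add_divide_distrib)

lemma chi_0 [simp]: "chi N 0 = 1"
  by (simp add: chi_def)

lemma chi_eq_1_iff:
  assumes "N > 0"
  shows "chi N m = 1 \<longleftrightarrow> int N dvd m"
proof
  assume "chi N m = 1"
  then have "cos (2 * pi * of_int m / of_nat N) = 1" by (simp add: chi_def complex_eq_iff)
  then obtain n :: int where "2 * pi * of_int m / of_nat N = of_int n * 2 * pi" using cos_one_2pi_int by blast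
  then have "of_int m = of_int n * (of_nat N :: real)" using assms by (simp add: field_simps)
  then have "m = n * int N" by (metis of_int_eq_iff of_int_mult of_int_of_nat_eq)
  then show "int N dvd m" by simp
next
  assume "int N dvd m"
  then obtain n where "m = int N * n" by (auto elim: dvdE)
  then have "2 * pi * of_int m / of_nat N = 2 * pi * of_int n" using assms by (simp add: field_simps)
  then show "chi N m = 1" by (simp add: chi_def)
qed

lemma chi_power: "chi N m ^ k = chi N (m * int k)"
  by (induction k) (simp_all add: chi_add distrib_left mult.commute)

lemma chi_mod:
  assumes "N > 0"
  shows "chi N (k * (m mod int N)) = chi N (k * m)"
proof -
  have "k * m = k * (m mod int N) + int N * (k * (m div int N))"
    by (metis distrib_left mult.left_commute mod_mult_div_eq)
  moreover have "chi N (int N * (k * (m div int N))) = 1" using chi_eq_1_iff[OF assms] by simp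
  ultimately show ?thesis by (metis chi_add mult.right_neutral)
qed

lemma sum_chi:
  assumes "N > 0"
  shows "(\<Sum>k\<in>{0..<int N}. chi N (k * d)) = (if int N dvd d then of_nat N else 0)"
proof -
  have *: "(\<Sum>k\<in>{0..<int N}. chi N (k * d)) = (\<Sum>k<N. chi N d ^ k)"
    by (rule sum.reindex_bij_witness[of _ int nat]) (auto simp: chi_power mult.commute)
  have "chi N d ^ N = 1" using chi_eq_1_iff[OF assms] by (simp add: chi_power)
  then show ?thesis
    unfolding * by (simp add: sum_gp_strict chi_eq_1_iff[OF assms] flip: lessThan_atLeast0)
qed

lemma bij_betw_shift_mod:
  "bij_betw (\<lambda>\<tau>. (\<tau> - \<sigma>) mod int N) {0..<int N} {0..<int N}"
proof (rule bij_betw_byWitness[where f' = "\<lambda>\<tau>. (\<tau> + \<sigma>) mod int N"])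
  show "\<forall>a\<in>{0..<int N}. ((a - \<sigma>) mod int N + \<sigma>) mod int N = a"
    by (auto simp: mod_simps)
  show "\<forall>a\<in>{0..<int N}. ((a + \<sigma>) mod int N - \<sigma>) mod int N = a"
    by (auto simp: mod_simps)
qed auto

text \<open>The Fourier matrix \<open>F\<close> intertwines the circulant matrix \<open>C\<close>
  with the block-diagonal matrix \<open>B\<close>. Its determinant occurs on both sides, so it is
  enough that it is nonzero.\<close>

lemma set_det_circulant:
  fixes c :: "'v \<Rightarrow> 'v \<Rightarrow> int \<Rightarrow> complex"
  assumes N: "N > 0" and V: "finite V"
  shows "set_det (V \<times> {0..<int N}) (\<lambda>(i, \<sigma>) (j, \<tau>). c i j ((\<tau> - \<sigma>) mod int N))
    = (\<Prod>k\<in>{0..<int N}. set_det V (\<lambda>i j. \<Sum>\<tau>\<in>{0..<int N}. c i j \<tau> * chi N (k * \<tau>)))"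
proof -
  let ?Z = "{0..<int N}"
  let ?A = "V \<times> ?Z"
  define M where "M k i j = (\<Sum>\<tau>\<in>?Z. c i j \<tau> * chi N (k * \<tau>))" for k i j
  define C where "C = (\<lambda>(i, \<sigma>) (j, \<tau>). c i j ((\<tau> - \<sigma>) mod int N))"
  define F where "F = (\<lambda>(i, \<sigma>) (j, k). if i = (j::'v) then chi N (k * \<sigma>) else 0)"
  define F' where "F' = (\<lambda>(i, k) (j, \<tau>). if i = (j::'v) then chi N (k * - \<tau>) else 0)"
  define B where "B = (\<lambda>(i, k) (j, m). if k = m then M k i j else 0)"
  have fin: "finite ?A" using V by simp
  \<comment> \<open>Orthogonality of characters: \<open>F\<close> times its conjugate transpose
    \<open>F'\<close> is \<open>N\<close> times the identity.\<close>
  have "set_det ?A F * set_det ?A F' = set_det ?A (\<lambda>x y. if x = y then of_nat N else 0)"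
    unfolding set_det_mult[OF fin]
  proof (rule set_det_cong[OF fin])
    fix x y assume "x \<in> ?A" "y \<in> ?A"
    then obtain i \<sigma> j \<tau> where xy: "x = (i, \<sigma>)" "y = (j, \<tau>)" "i \<in> V" "j \<in> V" "\<sigma> \<in> ?Z" "\<tau> \<in> ?Z" by auto
    have "(\<Sum>z\<in>?A. F x z * F' z y) = (\<Sum>i'\<in>V. \<Sum>k\<in>?Z. if i = i' then (if i = j then chi N (k * (\<sigma> - \<tau>)) else 0) else 0)"
      unfolding sum.cartesian_product
      by (rule sum.cong) (auto simp: F_def F'_def xy chi_add[symmetric] algebra_simps)
    also have "\<dots> = (\<Sum>i'\<in>V. if i = i' then \<Sum>k\<in>?Z. (if i = j then chi N (k * (\<sigma> - \<tau>)) else 0) else 0)"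
      by (rule sum.cong) auto
    also have "\<dots> = (if i = j then \<Sum>k\<in>?Z. chi N (k * (\<sigma> - \<tau>)) else 0)"
      using V xy by (simp add: sum.delta)
    also have "\<dots> = (if x = y then of_nat N else 0)"
    proof -
      have "int N dvd \<sigma> - \<tau> \<longleftrightarrow> \<sigma> = \<tau>"
        using xy by (auto simp: mod_eq_dvd_iff[symmetric])
      then show ?thesis by (simp add: sum_chi[OF N] xy)
    qed
    finally show "(\<Sum>z\<in>?A. F x z * F' z y) = (if x = y then of_nat N else 0)" .
  qed
  also have "\<dots> \<noteq> 0" using N by (simp add: set_det_const_diag fin)
  finally have F0: "set_det ?A F \<noteq> 0" by auto
  have "set_det ?A C * set_det ?A F = set_det ?A F * set_det ?A B"
    unfolding set_det_mult[OF fin]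
  proof (rule set_det_cong[OF fin])
    fix x y assume "x \<in> ?A" "y \<in> ?A"
    then obtain i \<sigma> j k where xy: "x = (i, \<sigma>)" "y = (j, k)" "i \<in> V" "j \<in> V" "\<sigma> \<in> ?Z" "k \<in> ?Z" by auto
    have "(\<Sum>z\<in>?A. C x z * F z y) = (\<Sum>j'\<in>V. \<Sum>\<tau>\<in>?Z. if j' = j then c i j ((\<tau> - \<sigma>) mod int N) * chi N (k * \<tau>) else 0)"
      unfolding sum.cartesian_product by (rule sum.cong) (auto simp: C_def F_def xy)
    also have "\<dots> = (\<Sum>j'\<in>V. if j' = j then \<Sum>\<tau>\<in>?Z. c i j ((\<tau> - \<sigma>) mod int N) * chi N (k * \<tau>) else 0)"
      by (rule sum.cong) auto
    also have "\<dots> = (\<Sum>\<tau>\<in>?Z. c i j ((\<tau> - \<sigma>) mod int N) * chi N (k * \<tau>))"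
      using V xy by (simp add: sum.delta)
    also have "\<dots> = (\<Sum>\<tau>\<in>?Z. c i j ((\<tau> - \<sigma>) mod int N) * chi N (k * ((\<tau> - \<sigma>) mod int N))) * chi N (k * \<sigma>)"
      unfolding sum_distrib_right
    proof (rule sum.cong[OF refl])
      fix \<tau>
      have "chi N (k * ((\<tau> - \<sigma>) mod int N)) * chi N (k * \<sigma>) = chi N (k * \<tau>)"
        by (simp add: chi_mod[OF N] chi_add[symmetric] algebra_simps)
      then show "c i j ((\<tau> - \<sigma>) mod int N) * chi N (k * \<tau>) = c i j ((\<tau> - \<sigma>) mod int N) * chi N (k * ((\<tau> - \<sigma>) mod int N)) * chi N (k * \<sigma>)"
        by (simp add: mult.assoc)
    qed
    also have "(\<Sum>\<tau>\<in>?Z. c i j ((\<tau> - \<sigma>) mod int N) * chi N (k * ((\<tau> - \<sigma>) mod int N))) = M k i j"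
      unfolding M_def by (rule sum.reindex_bij_betw[OF bij_betw_shift_mod])
    finally have l: "(\<Sum>z\<in>?A. C x z * F z y) = M k i j * chi N (k * \<sigma>)" .
    have "(\<Sum>z\<in>?A. F x z * B z y) = (\<Sum>z\<in>?A. if z = (i, k) then chi N (k * \<sigma>) * M k i j else 0)"
      by (rule sum.cong) (auto simp: F_def B_def xy split: if_splits)
    also have "\<dots> = chi N (k * \<sigma>) * M k i j" using fin xy by (simp add: sum.delta)
    finally show "(\<Sum>z\<in>?A. C x z * F z y) = (\<Sum>z\<in>?A. F x z * B z y)" using l by simp
  qed
  then have "set_det ?A C = set_det ?A B" using F0 by simp
  also have "\<dots> = (\<Prod>k\<in>?Z. set_det V (M k))" unfolding B_def by (rule set_det_block_diag[OF V]) simp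
  finally show ?thesis unfolding C_def M_def[abs_def] .
qed

section \<open>Evaluation of polynomials\<close>

text \<open>Supports change under addition and multiplication; sums over a common finite superset
  make the homomorphism laws termwise.\<close>

lemma eval_xy_superset:
  assumes "finite K" "Poly_Mapping.keys p \<subseteq> K"
  shows "eval_xy f p = (\<Sum>m\<in>K. of_int (Poly_Mapping.lookup p m) *
       (\<Prod>z \<in> Poly_Mapping.keys m. f z ^ Poly_Mapping.lookup m z))"
  unfolding eval_xy_def using assms
  by (intro sum.mono_neutral_left) (auto simp: in_keys_iff)

lemma eval_xy_add: "eval_xy f (p + q) = eval_xy f p + eval_xy f q"
proof -
  define K where "K = Poly_Mapping.keys p \<union> Poly_Mapping.keys q"
  have "finite K" "Poly_Mapping.keys p \<subseteq> K" "Poly_Mapping.keys q \<subseteq> K" "Poly_Mapping.keys (p + q) \<subseteq> K"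
    using Poly_Mapping.keys_add[of p q] by (auto simp: K_def)
  then show ?thesis
    by (simp add: eval_xy_superset[of K] lookup_add distrib_right sum.distrib)
qed

lemma eval_xy_0 [simp]: "eval_xy f 0 = 0"
  by (simp add: eval_xy_def)

lemma eval_xy_uminus: "eval_xy f (- p) = - eval_xy f p"
  using eval_xy_add[of f p "- p"] by (simp add: eq_neg_iff_add_eq_0 add.commute)

lemma eval_xy_diff: "eval_xy f (p - q) = eval_xy f p - eval_xy f q"
  using eval_xy_add[of f p "- q"] by (simp add: eval_xy_uminus)

lemma eval_xy_sum: "eval_xy f (sum g A) = (\<Sum>x\<in>A. eval_xy f (g x))"
  by (induction A rule: infinite_finite_induct) (simp_all add: eval_xy_add)

lemma eval_xy_single:
  "eval_xy f (Poly_Mapping.single m c) = of_int c * (\<Prod>z \<in> Poly_Mapping.keys m. f z ^ Poly_Mapping.lookup m z)"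
  by (cases "c = 0") (simp_all add: eval_xy_def)

lemma prod_keys_superset:
  assumes "finite K" "Poly_Mapping.keys m \<subseteq> K"
  shows "(\<Prod>z \<in> Poly_Mapping.keys m. f z ^ Poly_Mapping.lookup m z)
    = (\<Prod>z\<in>K. (f z :: 'r::comm_ring_1) ^ Poly_Mapping.lookup m z)"
  using assms by (intro prod.mono_neutral_left) (auto simp: in_keys_iff)

lemma eval_xy_single_mult:
  "eval_xy f (Poly_Mapping.single m c * Poly_Mapping.single n d)
    = eval_xy f (Poly_Mapping.single m c) * eval_xy f (Poly_Mapping.single n d)"
proof -
  define K where "K = Poly_Mapping.keys m \<union> Poly_Mapping.keys n"
  have "finite K" "Poly_Mapping.keys m \<subseteq> K" "Poly_Mapping.keys n \<subseteq> K" "Poly_Mapping.keys (m + n) \<subseteq> K"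
    using Poly_Mapping.keys_add[of m n] by (auto simp: K_def)
  then have "(\<Prod>z\<in>Poly_Mapping.keys (m + n). f z ^ Poly_Mapping.lookup (m + n) z) =
      (\<Prod>z\<in>Poly_Mapping.keys m. f z ^ Poly_Mapping.lookup m z) * (\<Prod>z\<in>Poly_Mapping.keys n. f z ^ Poly_Mapping.lookup n z)"
    using prod_keys_superset[of K m f] prod_keys_superset[of K n f] prod_keys_superset[of K "m + n" f]
    by (simp add: lookup_add power_add prod.distrib)
  then show ?thesis
    by (simp add: mult_single eval_xy_single mult_ac)
qed

lemma poly_mapping_sum_singles: "p = (\<Sum>m\<in>Poly_Mapping.keys p. Poly_Mapping.single m (Poly_Mapping.lookup p m))"
proof (rule poly_mapping_eqI)
  fix m
  show "Poly_Mapping.lookup p m = Poly_Mapping.lookup (\<Sum>m\<in>Poly_Mapping.keys p. Poly_Mapping.single m (Poly_Mapping.lookup p m)) m"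
    by (cases "m \<in> Poly_Mapping.keys p") (auto simp: lookup_sum lookup_single when_def in_keys_iff sum.delta)
qed

lemma eval_xy_mult: "eval_xy f (p * q) = eval_xy f p * eval_xy f q"
proof -
  let ?s = "\<lambda>p m. Poly_Mapping.single m (Poly_Mapping.lookup p m)"
  have "eval_xy f (p * q) = eval_xy f ((\<Sum>m\<in>Poly_Mapping.keys p. ?s p m) * (\<Sum>n\<in>Poly_Mapping.keys q. ?s q n))"
    using poly_mapping_sum_singles[of p] poly_mapping_sum_singles[of q] by simp
  also have "\<dots> = eval_xy f (\<Sum>m\<in>Poly_Mapping.keys p. ?s p m) * eval_xy f (\<Sum>n\<in>Poly_Mapping.keys q. ?s q n)"
    by (simp add: sum_product eval_xy_sum eval_xy_single_mult)
  also have "\<dots> = eval_xy f p * eval_xy f q"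
    using poly_mapping_sum_singles[of p] poly_mapping_sum_singles[of q] by simp
  finally show ?thesis .
qed

lemma eval_xy_1 [simp]: "eval_xy f 1 = 1"
  using eval_xy_single[of f 0 1] by (simp add: single_one)

lemma eval_xy_of_nat [simp]: "eval_xy f (of_nat n) = of_nat n"
  by (induction n) (simp_all add: eval_xy_add)

lemma eval_xy_mvar [simp]: "eval_xy f (mvar z) = f z"
  by (simp add: mvar_def eval_xy_single)

lemma eval_xy_set_det:
  "finite A \<Longrightarrow> eval_xy f (set_det A M) = set_det A (\<lambda>i j. eval_xy f (M i j))"
  by (rule set_det_rel[where R = "\<lambda>x y. eval_xy f x = y"])
     (auto simp: eval_xy_uminus eval_xy_add eval_xy_mult)

section \<open>The voltage matrix\<close>

text \<open>Degree matrix minus a weighted adjacency matrix. The weight \<open>w\<close> is left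
  open because the same determinant is needed in several rings: \<open>1 - Q_series\<close> gives
  \<open>Q\<close>, monomials give integer polynomials, powers of a complex number give the Fourier
  blocks, and the constant 1 gives the Laplacian. Backward steps carry
  \<open>w (- \<alpha> e)\<close> and not an inverse, which a monomial need not have.\<close>

definition voltage_matrix ::
  "('e \<Rightarrow> 'v) \<Rightarrow> ('e \<Rightarrow> 'v) \<Rightarrow> 'e set \<Rightarrow> ('e \<Rightarrow> 'a::uminus) \<Rightarrow> ('a \<Rightarrow> 'r::comm_ring_1) \<Rightarrow> 'v \<Rightarrow> 'v \<Rightarrow> 'r" where
  "voltage_matrix s t S \<alpha> w i j = (\<Sum>e\<in>S. of_bool (i = s e \<and> j = s e) + of_bool (i = t e \<and> j = t e)
     - of_bool (i = s e \<and> j = t e) * w (\<alpha> e) - of_bool (i = t e \<and> j = s e) * w (- \<alpha> e))"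

lemma voltage_det_rel:
  fixes R :: "'r::comm_ring_1 \<Rightarrow> 'q::comm_ring_1 \<Rightarrow> bool"
  assumes "finite V" and w: "\<And>a. a \<in> \<alpha> ` S \<union> uminus ` \<alpha> ` S \<Longrightarrow> R (w a) (w' a)"
    and R: "R 0 0" "R 1 1" "\<And>x y. R x y \<Longrightarrow> R (- x) (- y)"
    "\<And>x y x' y'. R x y \<Longrightarrow> R x' y' \<Longrightarrow> R (x + x') (y + y')"
    "\<And>x y x' y'. R x y \<Longrightarrow> R x' y' \<Longrightarrow> R (x * x') (y * y')"
  shows "R (set_det V (voltage_matrix s t S \<alpha> w)) (set_det V (voltage_matrix s t S \<alpha> w'))"
proof (rule set_det_rel[where R = R, OF assms(1) _ R])
  fix i j
  have d: "R (x - x') (y - y')" if "R x y" "R x' y'" for x x' y y'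
    using R(4)[OF that(1) R(3)[OF that(2)]] by simp
  have b: "R (of_bool P) (of_bool P)" for P using R(1,2) by (cases P) simp_all
  show "R (voltage_matrix s t S \<alpha> w i j) (voltage_matrix s t S \<alpha> w' i j)"
    unfolding voltage_matrix_def
  proof (rule sum_rel[where R = R])
    fix e assume "e \<in> S"
    then have we: "R (w (\<alpha> e)) (w' (\<alpha> e))" "R (w (- \<alpha> e)) (w' (- \<alpha> e))" by (auto intro!: w)
    show "R (of_bool (i = s e \<and> j = s e) + of_bool (i = t e \<and> j = t e)
        - of_bool (i = s e \<and> j = t e) * w (\<alpha> e) - of_bool (i = t e \<and> j = s e) * w (- \<alpha> e))
      (of_bool (i = s e \<and> j = s e) + of_bool (i = t e \<and> j = t e)
        - of_bool (i = s e \<and> j = t e) * w' (\<alpha> e) - of_bool (i = t e \<and> j = s e) * w' (- \<alpha> e))"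
      by (rule d[OF d[OF R(4)[OF b b] R(5)[OF b we(1)]] R(5)[OF b we(2)]])
  qed (rule R(1), rule R(4))
qed

context multigraph
begin

text \<open>An arc leaving \<open>v\<close> either lies in \<open>S\<close> or is the inverse of an
  arc of \<open>S\<close> that enters \<open>v\<close>; a loop of \<open>S\<close> is counted in
  both sets.\<close>

lemma out_degree_orientation:
  assumes S: "S \<subseteq> arcs X" and orient: "\<And>e. e \<in> arcs X \<Longrightarrow> rv e \<in> S \<longleftrightarrow> e \<notin> S"
  shows "out_degree X v = card {e\<in>S. tail X e = v} + card {e\<in>S. head X e = v}"
proof -
  have fin: "finite S" using S finite_subset[OF _ finite_arcs] by blast
  have "out_arcs X v = {e\<in>S. tail X e = v} \<union> rv ` {e\<in>S. head X e = v}"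
  proof (intro equalityI subsetI)
    fix e assume e: "e \<in> out_arcs X v"
    show "e \<in> {e\<in>S. tail X e = v} \<union> rv ` {e\<in>S. head X e = v}"
    proof (cases "e \<in> S")
      case False
      then have "rv e \<in> {e\<in>S. head X e = v}" using e orient[of e] by simp
      then have "rv (rv e) \<in> rv ` {e\<in>S. head X e = v}" by (rule imageI)
      then show ?thesis by simp
    qed (use e in simp)
  next
    fix e assume "e \<in> {e\<in>S. tail X e = v} \<union> rv ` {e\<in>S. head X e = v}"
    then show "e \<in> out_arcs X v" using S by auto
  qed
  moreover have "{e\<in>S. tail X e = v} \<inter> rv ` {e\<in>S. head X e = v} = {}" using S orient by auto
  moreover have "card (rv ` {e\<in>S. head X e = v}) = card {e\<in>S. head X e = v}"
    by (rule card_image) (rule inj_on_arev)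
  ultimately show ?thesis using fin by (simp add: out_degree_def card_Un_disjoint)
qed

text \<open>Grouping by edges instead of by voltage values, an edge contributes -1 from B or C and
  \<open>Q_series (\<alpha> e)\<close> from P, together minus the weight
  \<open>1 - Q_series (\<alpha> e)\<close>; likewise backwards with
  \<open>- \<alpha> e\<close>.\<close>

lemma eval_voltage_poly:
  fixes \<alpha> :: "'e \<Rightarrow> 'p::prime_card padic_int"
  assumes S: "S \<subseteq> arcs X" and orient: "\<And>e. e \<in> arcs X \<Longrightarrow> rv e \<in> S \<longleftrightarrow> e \<notin> S"
    and vs: "bij_betw vs {..<g} (verts X)" and b: "bij_betw b {..<t} (\<alpha> ` S)"
  shows "eval_xy (case_sum (\<lambda>y. Q_series (b y)) (\<lambda>y. Q_series (- b y))) (voltage_poly X S \<alpha> g vs t b)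
    = set_det (verts X) (voltage_matrix (tail X) (head X) S \<alpha> (\<lambda>a. 1 - Q_series a))"
proof -
  have fin: "finite S" using S finite_subset[OF _ finite_arcs] by blast
  let ?f = "case_sum (\<lambda>y. Q_series (b y)) (\<lambda>y. Q_series (- b y))"
  have vs': "bij_betw vs {0..<g} (verts X)" using vs by (simp add: atLeast0LessThan)
  define M :: "nat \<Rightarrow> nat \<Rightarrow> xy_poly" where "M i j = of_nat (if i = j then out_degree X (vs i) else 0)
     - of_nat (card {s \<in> S. (tail X s, head X s) = (vs i, vs j)})
     - of_nat (card {s \<in> S. (tail X s, head X s) = (vs j, vs i)})
     + (\<Sum>y<t. of_nat (card {s \<in> S. (tail X s, head X s) = (vs i, vs j) \<and> \<alpha> s = b y}) * mvar (Inl y)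
         + of_nat (card {s \<in> S. (tail X s, head X s) = (vs j, vs i) \<and> \<alpha> s = b y}) * mvar (Inr y))" for i j
  have "voltage_poly X S \<alpha> g vs t b = Determinant.det (mat g g (\<lambda>(i, j). M i j))"
    by (simp add: voltage_poly_def Let_def M_def)
  also have "\<dots> = set_det {0..<g} M"
    by (subst set_det_bij[of id g]) simp_all
  finally have "eval_xy ?f (voltage_poly X S \<alpha> g vs t b) = set_det {0..<g} (\<lambda>i j. eval_xy ?f (M i j))"
    by (simp add: eval_xy_set_det)
  also have "\<dots> = set_det {0..<g} (\<lambda>i j. voltage_matrix (tail X) (head X) S \<alpha> (\<lambda>a. 1 - Q_series a) (vs i) (vs j))"
  proof (rule set_det_cong)
    fix i j assume ij: "i \<in> {0..<g}" "j \<in> {0..<g}"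
    have vsij: "vs i = vs j \<longleftrightarrow> i = j" using vs' ij by (auto simp: bij_betw_def inj_on_def)
    have card: "of_nat (card {s\<in>S. P s}) = (\<Sum>s\<in>S. of_bool (P s) :: 'p padic_int fps)" for P
      using fin by (simp add: of_bool_def sum.If_cases Int_def)
    \<comment> \<open>\<open>b\<close> enumerates the voltages without repetition, so exactly one
      \<open>y\<close> survives.\<close>
    have pick: "(\<Sum>y<t. of_bool (\<alpha> s = b y) * w (b y)) = (w (\<alpha> s) :: 'p padic_int fps)" if "s \<in> S" for s w
    proof -
      have "\<alpha> s \<in> b ` {..<t}" using b that by (simp add: bij_betw_def)
      then obtain y where y: "y < t" "b y = \<alpha> s" by auto
      have "(\<Sum>y<t. of_bool (\<alpha> s = b y) * w (b y)) = (\<Sum>y'<t. if y' = y then w (\<alpha> s) else 0)"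
        using b y by (intro sum.cong) (auto simp: bij_betw_def inj_on_def)
      then show ?thesis using y by (simp add: sum.delta)
    qed
    have sumy: "(\<Sum>y<t. of_nat (card {s\<in>S. P s \<and> \<alpha> s = b y}) * w (b y)) = (\<Sum>s\<in>S. of_bool (P s) * (w (\<alpha> s) :: 'p padic_int fps))"
      for P w
    proof -
      have "(\<Sum>y<t. of_nat (card {s\<in>S. P s \<and> \<alpha> s = b y}) * w (b y))
          = (\<Sum>y<t. \<Sum>s\<in>S. of_bool (P s) * (of_bool (\<alpha> s = b y) * w (b y)))"
        unfolding card sum_distrib_right of_bool_conj mult.assoc ..
      also have "\<dots> = (\<Sum>s\<in>S. of_bool (P s) * (\<Sum>y<t. of_bool (\<alpha> s = b y) * w (b y)))"
        unfolding sum_distrib_left by (rule sum.swap)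
      also have "\<dots> = (\<Sum>s\<in>S. of_bool (P s) * w (\<alpha> s))"
        by (intro sum.cong refl arg_cong2[of _ _ _ _ "(*)"] pick)
      finally show ?thesis .
    qed
    have deg: "of_nat (if i = j then out_degree X (vs i) else 0)
       = (\<Sum>s\<in>S. of_bool (vs i = tail X s \<and> vs j = tail X s) + of_bool (vs i = head X s \<and> vs j = head X s) :: 'p padic_int fps)"
    proof (cases "i = j")
      case True
      then show ?thesis
        by (simp add: out_degree_orientation[OF S orient] card sum.distrib eq_commute)
    next
      case False
      then have "vs i \<noteq> vs j" using vsij by simp
      then show ?thesis using False by (intro sum.neutral[symmetric, THEN trans[rotated]]) auto
    qed
    have ev: "eval_xy ?f (M i j) = of_nat (if i = j then out_degree X (vs i) else 0)
       - of_nat (card {s \<in> S. (tail X s, head X s) = (vs i, vs j)})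
       - of_nat (card {s \<in> S. (tail X s, head X s) = (vs j, vs i)})
       + ((\<Sum>y<t. of_nat (card {s \<in> S. (tail X s, head X s) = (vs i, vs j) \<and> \<alpha> s = b y}) * Q_series (b y))
         + (\<Sum>y<t. of_nat (card {s \<in> S. (tail X s, head X s) = (vs j, vs i) \<and> \<alpha> s = b y}) * Q_series (- b y)))"
      by (simp add: M_def eval_xy_add eval_xy_diff eval_xy_sum eval_xy_mult sum.distrib del: of_nat_0)
    note ev = ev[unfolded sumy[of "\<lambda>s. (tail X s, head X s) = (vs i, vs j)" Q_series]
      sumy[of "\<lambda>s. (tail X s, head X s) = (vs j, vs i)" "\<lambda>a. Q_series (- a)"]]
    have "eval_xy ?f (M i j) = voltage_matrix (tail X) (head X) S \<alpha> (\<lambda>a. 1 - Q_series a) (vs i) (vs j)"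
      unfolding ev deg card voltage_matrix_def sum.distrib[symmetric] sum_subtractf[symmetric]
    proof (rule sum.cong[OF refl])
      fix e
      have A: "(tail X e, head X e) = (vs i, vs j) \<longleftrightarrow> vs i = tail X e \<and> vs j = head X e"
        "(tail X e, head X e) = (vs j, vs i) \<longleftrightarrow> vs i = head X e \<and> vs j = tail X e" by auto
      show "of_bool (vs i = tail X e \<and> vs j = tail X e) + of_bool (vs i = head X e \<and> vs j = head X e)
          - of_bool ((tail X e, head X e) = (vs i, vs j)) - of_bool ((tail X e, head X e) = (vs j, vs i))
          + (of_bool ((tail X e, head X e) = (vs i, vs j)) * Q_series (\<alpha> e)
             + of_bool ((tail X e, head X e) = (vs j, vs i)) * Q_series (- \<alpha> e))
        = of_bool (vs i = tail X e \<and> vs j = tail X e) + of_bool (vs i = head X e \<and> vs j = head X e)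
          - of_bool (vs i = tail X e \<and> vs j = head X e) * (1 - Q_series (\<alpha> e))
          - of_bool (vs i = head X e \<and> vs j = tail X e) * (1 - Q_series (- \<alpha> e))"
        unfolding A by (simp only: right_diff_distrib mult_1_right) (simp only: algebra_simps)
    qed
    then show "eval_xy ?f (M i j) = voltage_matrix (tail X) (head X) S \<alpha> (\<lambda>a. 1 - Q_series a) (vs i) (vs j)" .
  qed simp
  also have "\<dots> = set_det (verts X) (voltage_matrix (tail X) (head X) S \<alpha> (\<lambda>a. 1 - Q_series a))"
    by (rule set_det_reindex[OF _ vs', symmetric]) simp
  finally show ?thesis .
qed

end

section \<open>Integer approximation of the power series\<close>

lemma padic_residue_of_int: "padic_residue n (of_int z :: 'p::prime_card padic_int) = z mod int CARD('p) ^ n"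
  by (cases z rule: int_cases2)
     (simp_all add: padic_residue_def padic_seq_of_nat uminus_padic_int.rep_eq mod_simps)

lemma padic_pow_dvd_of_int_iff:
  "(of_nat CARD('p) ^ k :: 'p::prime_card padic_int) dvd of_int z \<longleftrightarrow> int CARD('p) ^ k dvd z"
  by (simp add: padic_pow_dvd_iff padic_residue_of_int mod_eq_0_iff_dvd)

text \<open>Later arguments use valuations only through divisibility by powers of l. If the k-th
  power does not divide \<open>x\<close>, all admissible exponents are at most \<open>k - 1\<close>,
  and \<open>k = 0\<close> cannot occur.\<close>

lemma padic_val_ge_iff: "enat k \<le> padic_val x \<longleftrightarrow> (of_nat CARD('p) ^ k :: 'p::prime_card padic_int) dvd x"
proof
  assume k: "enat k \<le> padic_val x"
  show "of_nat CARD('p) ^ k dvd x"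
  proof (rule ccontr)
    assume n: "\<not> of_nat CARD('p) ^ k dvd x"
    have "n < k" if "of_nat CARD('p) ^ n dvd x" for n
    proof (rule ccontr)
      assume "\<not> n < k"
      then have "(of_nat CARD('p) ^ k :: 'p padic_int) dvd of_nat CARD('p) ^ n" by (intro le_imp_power_dvd) simp
      with that n show False using dvd_trans by blast
    qed
    then have "padic_val x \<le> enat (k - 1)"
      unfolding padic_val_def by (intro SUP_least) fastforce
    moreover have "k > 0" using n by (cases k) auto
    ultimately have "enat k \<le> enat (k - 1)" using k order_trans by blast
    with \<open>k > 0\<close> show False by simp
  qed
next
  assume "of_nat CARD('p) ^ k dvd x"
  then show "enat k \<le> padic_val x" unfolding padic_val_def by (intro SUP_upper) simp
qed

text \<open>A natural number, because it serves as the exponent of a monomial, for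
  \<open>\<alpha> e\<close> and for \<open>- \<alpha> e\<close> alike.\<close>

definition padic_approx :: "nat \<Rightarrow> 'p::prime_card padic_int \<Rightarrow> nat" where
  "padic_approx K a = nat (padic_residue K a)"

lemma int_padic_approx: "int (padic_approx K a) = padic_residue K a"
  using padic_seq_range[of a K] by (simp add: padic_approx_def padic_residue_def)

lemma padic_approx_dvd:
  "(of_nat CARD('p) ^ K :: 'p::prime_card padic_int) dvd a - of_nat (padic_approx K a)"
  unfolding padic_pow_dvd_iff
  using padic_seq_range[of a K]
  by (simp add: padic_residue_def minus_padic_int.rep_eq padic_seq_of_nat int_padic_approx[unfolded padic_residue_def])

lemma fact_mult_padic_binom_of_nat:
  "fact k * (of_nat (m choose k) :: 'p::prime_card padic_int) = (\<Prod>i=0..<k. of_nat m - of_nat i)"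
proof -
  have "of_int (\<Prod>i=0..<k. int m - int i) = (of_int (fact k * int (m choose k)) :: 'p padic_int)"
    by (simp only: fallfac_int)
  then show ?thesis by (simp add: of_int_fact)
qed

text \<open>Continuity in \<open>a\<close>: the falling factorials agree modulo l^K, and division by
  \<open>fact k\<close> costs only its l-part l^v. Hence the bound
  \<open>K \<ge> M + v\<close>.\<close>

lemma padic_binom_approx:
  fixes a :: "'p::prime_card padic_int"
  shows "\<exists>K0. \<forall>K\<ge>K0. of_nat CARD('p) ^ M dvd padic_binom a k - of_nat (padic_approx K a choose k)"
proof -
  let ?l = "CARD('p)" and ?L = "of_nat CARD('p) :: 'p padic_int"
  define v where "v = multiplicity ?l (fact k :: nat)"
  obtain u where u: "fact k = ?l ^ v * u" "\<not> ?l dvd u"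
    unfolding v_def
    by (rule multiplicity_decompose'[of "fact k" ?l])
       (use prime_card[where 'a='p] in \<open>auto\<close>)
  have f: "(fact k :: 'p padic_int) = ?L ^ v * of_nat u"
    using arg_cong[OF u(1), of "of_nat :: nat \<Rightarrow> 'p padic_int"] by simp
  have unit: "(of_nat u :: 'p padic_int) dvd 1" using u by (rule_tac padic_of_nat_unit)
  have "?L ^ M dvd padic_binom a k - of_nat (padic_approx K a choose k)" if K: "K \<ge> M + v" for K
  proof -
    define d where "d = padic_binom a k - of_nat (padic_approx K a choose k)"
    have "?L ^ K dvd (\<Prod>i=0..<k. a - of_nat i) - (\<Prod>i=0..<k. of_nat (padic_approx K a) - of_nat i)"
    proof (rule prod_rel[where R = "\<lambda>x y. ?L ^ K dvd x - y"])
      fix x y x' y' assume "?L ^ K dvd x - y" "?L ^ K dvd x' - y'"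
      then have "?L ^ K dvd (x - y) * x' + y * (x' - y')" by (intro dvd_add dvd_mult dvd_mult2)
      then show "?L ^ K dvd x * x' - y * y'" by (simp add: algebra_simps)
    qed (use padic_approx_dvd[of K a] in auto)
    then have "?L ^ K dvd fact k * d"
      by (simp add: d_def right_diff_distrib fact_mult_padic_binom fact_mult_padic_binom_of_nat)
    moreover have "?L ^ (v + M) dvd ?L ^ K" using K by (intro le_imp_power_dvd) simp
    ultimately have "?L ^ (v + M) dvd fact k * d" by (rule dvd_trans[rotated])
    then have "?L ^ v * ?L ^ M dvd ?L ^ v * (of_nat u * d)" by (simp only: f power_add mult.assoc)
    moreover have "?L ^ v \<noteq> 0" by simp
    ultimately have "?L ^ M dvd of_nat u * d" by (simp only: dvd_mult_cancel_left) simp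
    then have "?L ^ M dvd d" using unit dvd_mult_unit_iff'[of "of_nat u" "?L ^ M" d] by blast
    then show ?thesis by (simp only: d_def)
  qed
  then show ?thesis by blast
qed

lemma fps_nth_one_minus_X_power:
  "fps_nth ((1 - fps_X) ^ m) k = (- 1) ^ k * (of_nat (m choose k) :: 'a::comm_ring_1)"
proof (induction m arbitrary: k)
  case 0
  then show ?case by (cases k) simp_all
next
  case (Suc m)
  have "(1 - fps_X :: 'a fps) ^ Suc m = (1 - fps_X) ^ m - fps_X * (1 - fps_X :: 'a fps) ^ m"
    by (simp only: power_Suc left_diff_distrib mult_1_left)
  then show ?case using Suc by (cases k) (simp_all add: algebra_simps)
qed

text \<open>So 1 - Q_a is the binomial series of (1 - T)^a, the coefficientwise limit of (1 - T)^m
  as the natural number m tends to a.\<close>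

lemma fps_nth_one_minus_Q_series: "fps_nth (1 - Q_series a) k = (- 1) ^ k * padic_binom a k"
  by (cases k) (simp_all add: Q_series_def padic_binom_def)

lemma Q_series_approx:
  fixes A :: "'p::prime_card padic_int set"
  assumes "finite A"
  shows "\<exists>K0. \<forall>K\<ge>K0. \<forall>a\<in>A. \<forall>k<J. of_nat CARD('p) ^ M dvd
    fps_nth (1 - Q_series a) k - fps_nth ((1 - fps_X) ^ padic_approx K a) k"
proof -
  have "eventually (\<lambda>K. \<forall>(a, k)\<in>A \<times> {..<J}. of_nat CARD('p) ^ M dvd
      padic_binom a k - of_nat (padic_approx K a choose k)) sequentially"
    using assms padic_binom_approx
    by (subst eventually_ball_finite_distrib) (auto simp: eventually_sequentially)
  then obtain K0 where K0: "\<And>K a k. K \<ge> K0 \<Longrightarrow> a \<in> A \<Longrightarrow> k < J \<Longrightarrow>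
      of_nat CARD('p) ^ M dvd padic_binom a k - of_nat (padic_approx K a choose k)"
    unfolding eventually_sequentially by fastforce
  have "of_nat CARD('p) ^ M dvd
    fps_nth (1 - Q_series a) k - fps_nth ((1 - fps_X) ^ padic_approx K a) k"
    if "K \<ge> K0" "a \<in> A" "k < J" for K a k
    unfolding fps_nth_one_minus_Q_series fps_nth_one_minus_X_power right_diff_distrib[symmetric]
    using K0[OF that] by (rule dvd_mult)
  then show ?thesis by blast
qed

text \<open>The polynomial R of the overview, in the variable x = 1 - T, one for each precision
  \<open>K\<close>.\<close>

definition approx_poly ::
  "'v set \<Rightarrow> ('e \<Rightarrow> 'v) \<Rightarrow> ('e \<Rightarrow> 'v) \<Rightarrow> 'e set \<Rightarrow> ('e \<Rightarrow> 'p::prime_card padic_int) \<Rightarrow> nat \<Rightarrow> int poly" where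
  "approx_poly V s t S \<alpha> K = set_det V (voltage_matrix s t S \<alpha> (\<lambda>a. monom 1 (padic_approx K a)))"

lemma fps_of_shifted_approx_poly:
  fixes \<alpha> :: "'e \<Rightarrow> 'p::prime_card padic_int"
  assumes "finite V"
  shows "fps_of_poly (map_poly of_int (approx_poly V s t S \<alpha> K \<circ>\<^sub>p [:1, -1:]))
    = set_det V (voltage_matrix s t S \<alpha> (\<lambda>a. (1 - fps_X :: 'p padic_int fps) ^ padic_approx K a))"
proof -
  let ?\<phi> = "\<lambda>p. fps_of_poly (map_poly (of_int :: int \<Rightarrow> 'p padic_int) (p \<circ>\<^sub>p [:1, -1:]))"
  have lin: "fps_of_poly [:1, -1:] = (1 - fps_X :: 'p padic_int fps)"
    by (rule fps_ext) (auto simp: coeff_pCons split: nat.splits)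
  have "?\<phi> (monom 1 m) = (1 - fps_X) ^ m" for m
  proof (induction m)
    case 0
    then show ?case by (simp add: monom_0)
  next
    case (Suc m)
    have "monom 1 (Suc m) \<circ>\<^sub>p [:1, -1:] = [:1, -1:] * (monom (1::int) m \<circ>\<^sub>p [:1, -1:])"
      by (simp add: monom_Suc pcompose_pCons)
    moreover have "map_poly (of_int :: int \<Rightarrow> 'p padic_int) [:1, -1:] = [:1, -1:]" by simp
    ultimately show ?case using Suc lin
      by (simp only: fps_of_poly_mult of_int_poly_hom.hom_mult power_Suc)
  qed
  then show ?thesis
    unfolding approx_poly_def
    by (intro voltage_det_rel[where R = "\<lambda>x y. ?\<phi> x = y"] assms)
       (auto simp: pcompose_add pcompose_mult pcompose_uminus fps_of_poly_add fps_of_poly_mult fps_of_poly_uminus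
         of_int_poly_hom.hom_add of_int_poly_hom.hom_mult of_int_poly_hom.hom_uminus)
qed

text \<open>Agreement of the coefficients below \<open>J\<close> modulo l^M is congruence modulo the
  ideal generated by l^M and T^J. It respects sums and products, hence passes from the weights to
  the determinant.\<close>

lemma voltage_det_approx:
  fixes \<alpha> :: "'e \<Rightarrow> 'p::prime_card padic_int"
  assumes V: "finite V" and S: "finite S"
  shows "\<exists>K0. \<forall>K\<ge>K0. \<forall>k<J. of_nat CARD('p) ^ M dvd
    fps_nth (set_det V (voltage_matrix s t S \<alpha> (\<lambda>a. 1 - Q_series a))) k
    - of_int (coeff (approx_poly V s t S \<alpha> K \<circ>\<^sub>p [:1, -1:]) k)"
proof -
  let ?L = "of_nat CARD('p) ^ M :: 'p padic_int"
  obtain K0 where K0: "\<forall>K\<ge>K0. \<forall>a\<in>\<alpha> ` S \<union> uminus ` \<alpha> ` S. \<forall>k<J. ?L dvd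
      fps_nth (1 - Q_series a) k - fps_nth ((1 - fps_X) ^ padic_approx K a) k"
    using Q_series_approx[of "\<alpha> ` S \<union> uminus ` \<alpha> ` S" J M] S by auto
  let ?R = "\<lambda>x y. \<forall>k<J. ?L dvd fps_nth x k - fps_nth y k"
  have "?R (set_det V (voltage_matrix s t S \<alpha> (\<lambda>a. 1 - Q_series a)))
      (set_det V (voltage_matrix s t S \<alpha> (\<lambda>a. (1 - fps_X) ^ padic_approx K a)))" if "K \<ge> K0" for K
  proof (rule voltage_det_rel[where R = ?R, OF V])
    fix x y x' y' :: "'p padic_int fps" assume R: "?R x y" "?R x' y'"
    have "?R (x + x') (y + y')"
    proof (intro allI impI)
      fix k assume "k < J"
      then have "?L dvd (fps_nth x k - fps_nth y k) + (fps_nth x' k - fps_nth y' k)" using R by (intro dvd_add) auto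
      then show "?L dvd fps_nth (x + x') k - fps_nth (y + y') k" by (simp add: algebra_simps)
    qed
    then show "?R (x + x') (y + y')" .
    show "?R (x * x') (y * y')"
    proof (intro allI impI)
      fix k assume k: "k < J"
      have "?L dvd fps_nth x i * fps_nth x' (k - i) - fps_nth y i * fps_nth y' (k - i)" if "i \<in> {0..k}" for i
      proof -
        have "?L dvd (fps_nth x i - fps_nth y i) * fps_nth x' (k - i) + fps_nth y i * (fps_nth x' (k - i) - fps_nth y' (k - i))"
          using R k that by (intro dvd_add dvd_mult dvd_mult2) auto
        then show ?thesis by (simp add: algebra_simps)
      qed
      then show "?L dvd fps_nth (x * x') k - fps_nth (y * y') k"
        unfolding fps_mult_nth sum_subtractf[symmetric] by (rule dvd_sum)
    qed
  next
    fix x y :: "'p padic_int fps" assume R: "?R x y"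
    show "?R (- x) (- y)"
    proof (intro allI impI)
      fix k assume "k < J"
      then have "?L dvd - (fps_nth x k - fps_nth y k)" using R by (subst dvd_minus_iff) auto
      then show "?L dvd fps_nth (- x) k - fps_nth (- y) k" by simp
    qed
  next
    fix a assume "a \<in> \<alpha> ` S \<union> uminus ` \<alpha> ` S"
    then show "?R (1 - Q_series a) ((1 - fps_X) ^ padic_approx K a)" using K0 that by blast
  qed auto
  then show ?thesis
    unfolding fps_of_shifted_approx_poly[OF V, symmetric] by (intro exI[of _ K0]) simp
qed

lemma poly_approx_poly:
  assumes "finite V"
  shows "poly (map_poly of_int (approx_poly V s t S \<alpha> K)) z
    = set_det V (voltage_matrix s t S \<alpha> (\<lambda>a. (z :: complex) ^ padic_approx K a))"
proof -
  show ?thesis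
    unfolding approx_poly_def
    by (rule voltage_det_rel[where R = "\<lambda>x y. poly (map_poly of_int x) z = y"])
       (auto simp: assms poly_monom of_int_poly_hom.hom_add of_int_poly_hom.hom_mult of_int_poly_hom.hom_uminus map_poly_monom)
qed

section \<open>Products over roots of unity\<close>

abbreviation cpoly :: "int poly \<Rightarrow> complex \<Rightarrow> complex" where
  "cpoly h z \<equiv> poly (map_poly of_int h) z"

lemma cpoly_of_int: "cpoly h (of_int x) = of_int (poly h x)"
  by (induction h) (simp_all add: map_poly_pCons)

lemma cpoly_simps:
  "cpoly (p + q) z = cpoly p z + cpoly q z" "cpoly (p - q) z = cpoly p z - cpoly q z"
  "cpoly (- p) z = - cpoly p z"
  "cpoly (p * q) z = cpoly p z * cpoly q z" "cpoly (p ^ n) z = cpoly p z ^ n"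
  "cpoly (smult c p) z = of_int c * cpoly p z" "cpoly (monom 1 n) z = z ^ n"
  "cpoly 1 z = 1" "cpoly [:a, b:] z = of_int a + z * of_int b" "cpoly [:a:] z = of_int a"
  "cpoly (p \<circ>\<^sub>p q) z = cpoly p (cpoly q z)" "cpoly (of_nat k) z = of_nat k"
proof -
  have m: "map_poly of_int (monom 1 n) = (monom 1 n :: complex poly)" by (simp add: map_poly_monom)
  show "cpoly (monom 1 n) z = z ^ n" unfolding m by (simp add: poly_monom)
  show "cpoly (smult c p) z = of_int c * cpoly p z" by (simp add: hom_distribs)
  show "cpoly (p \<circ>\<^sub>p q) z = cpoly p (cpoly q z)"
    by (induction p) (simp_all add: pcompose_pCons map_poly_pCons hom_distribs)
  show "cpoly (of_nat k) z = of_nat k" by (induction k) (simp_all add: hom_distribs)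
qed (simp_all add: hom_distribs)

lemma chi_power_self: "N > 0 \<Longrightarrow> chi N k ^ N = 1"
  by (simp add: chi_power chi_eq_1_iff)

text \<open>The product is the determinant of multiplication by \<open>h\<close> on Z[x]/(x^N - 1),
  an integer circulant matrix. If \<open>h\<close> is 1 modulo \<open>l\<close>, this matrix is the
  identity modulo \<open>l\<close>.\<close>

lemma prod_roots_unity_int:
  assumes N: "N > 0"
  shows "\<exists>z. (\<Prod>k\<in>{0..<int N}. cpoly h (chi N k)) = of_int z \<and> (\<forall>l s. h = 1 + smult l s \<longrightarrow> l dvd z - 1)"
proof -
  \<comment> \<open>The coefficients of \<open>h\<close> reduced modulo x^N - 1.\<close>
  define c where "c \<tau> = (\<Sum>i\<le>degree h. of_bool (int i mod int N = \<tau>) * coeff h i)" for \<tau> :: int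
  let ?A = "{()} \<times> {0..<int N}"
  define C where "C = (\<lambda>(_ :: unit, \<sigma>) (_ :: unit, \<tau>). c ((\<tau> - \<sigma>) mod int N))"
  define z where "z = set_det ?A C"
  have sum: "(\<Sum>\<tau>\<in>{0..<int N}. of_int (c \<tau>) * chi N (k * \<tau>)) = cpoly h (chi N k)" for k
  proof -
    have "(\<Sum>\<tau>\<in>{0..<int N}. of_int (c \<tau>) * chi N (k * \<tau>))
        = (\<Sum>i\<le>degree h. \<Sum>\<tau>\<in>{0..<int N}. of_bool (int i mod int N = \<tau>) * of_int (coeff h i) * chi N (k * \<tau>))"
      unfolding c_def of_int_sum of_int_mult of_int_of_bool sum_distrib_right by (rule sum.swap)
    also have "\<dots> = (\<Sum>i\<le>degree h. of_int (coeff h i) * chi N (k * (int i mod int N)))"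
    proof (rule sum.cong[OF refl])
      fix i
      have "(\<Sum>\<tau>\<in>{0..<int N}. of_bool (int i mod int N = \<tau>) * of_int (coeff h i) * chi N (k * \<tau>))
        = (\<Sum>\<tau>\<in>{0..<int N}. if \<tau> = int i mod int N then of_int (coeff h i) * chi N (k * (int i mod int N)) else 0)"
        by (rule sum.cong) auto
      then show "(\<Sum>\<tau>\<in>{0..<int N}. of_bool (int i mod int N = \<tau>) * of_int (coeff h i) * chi N (k * \<tau>))
        = of_int (coeff h i) * chi N (k * (int i mod int N))" using N by (simp add: sum.delta)
    qed
    also have "\<dots> = cpoly h (chi N k)"
      by (simp add: poly_altdef chi_mod[OF N] chi_power)
    finally show ?thesis .
  qed
  have "of_int z = set_det ?A (\<lambda>x y. of_int (C x y) :: complex)" unfolding z_def by (rule set_det_of_int) simp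
  also have "\<dots> = set_det ?A (\<lambda>(i, \<sigma>) (j, \<tau>). (\<lambda>i j \<tau>. of_int (c \<tau>)) i j ((\<tau> - \<sigma>) mod int N))"
    by (rule set_det_cong) (auto simp: C_def)
  also have "\<dots> = (\<Prod>k\<in>{0..<int N}. cpoly h (chi N k))"
    by (subst set_det_circulant[OF N]) (simp_all add: set_det_singleton sum)
  finally have "(\<Prod>k\<in>{0..<int N}. cpoly h (chi N k)) = of_int z" by simp
  moreover have "l dvd z - 1" if h: "h = 1 + smult l s" for l s
  proof -
    have c: "l dvd c \<tau> - of_bool (\<tau> = 0)" for \<tau>
    proof -
      have "coeff h i = of_bool (i = 0) + l * coeff s i" for i by (simp add: h)
      then have "c \<tau> = (\<Sum>i\<le>degree h. of_bool (int i mod int N = \<tau>) * of_bool (i = 0) + l * (of_bool (int i mod int N = \<tau>) * coeff s i))"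
        unfolding c_def by (intro sum.cong) (auto simp: algebra_simps)
      also have "\<dots> = (\<Sum>i\<le>degree h. of_bool (int i mod int N = \<tau>) * of_bool (i = 0))
          + l * (\<Sum>i\<le>degree h. of_bool (int i mod int N = \<tau>) * coeff s i)"
        by (simp only: sum.distrib sum_distrib_left)
      also have "(\<Sum>i\<le>degree h. of_bool (int i mod int N = \<tau>) * of_bool (i = 0)) = (\<Sum>i\<le>degree h. if i = 0 then of_bool (\<tau> = 0) else (0::int))"
        by (rule sum.cong) auto
      also have "\<dots> = of_bool (\<tau> = 0)" by (simp add: sum.delta)
      finally show ?thesis by simp
    qed
    have "l dvd set_det ?A C - set_det ?A (\<lambda>x y. if x = y then 1 else 0)"
    proof (rule set_det_rel[where R = "\<lambda>x y. l dvd x - y"])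
      fix x y assume "x \<in> ?A" "y \<in> ?A"
      then obtain \<sigma> \<tau> where xy: "x = ((), \<sigma>)" "y = ((), \<tau>)" "0 \<le> \<sigma>" "\<sigma> < int N" "0 \<le> \<tau>" "\<tau> < int N" by auto
      have "(\<tau> - \<sigma>) mod int N = 0 \<longleftrightarrow> \<sigma> = \<tau>"
        using xy by (auto simp: mod_eq_0_iff_dvd mod_eq_dvd_iff[symmetric])
      then show "l dvd C x y - (if x = y then 1 else 0)" using c[of "(\<tau> - \<sigma>) mod int N"] by (auto simp: C_def xy)
    next
      fix x y x' y' :: int assume R: "l dvd x - y" "l dvd x' - y'"
      have "l dvd (x - y) + (x' - y')" using R by (rule dvd_add)
      then show "l dvd x + x' - (y + y')" by (simp add: algebra_simps)
      have "l dvd (x - y) * x' + y * (x' - y')" using R by (intro dvd_add dvd_mult dvd_mult2)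
      then show "l dvd x * x' - y * y'" by (simp add: algebra_simps)
    next
      fix x y :: int assume "l dvd x - y"
      then have "l dvd - (x - y)" by (subst dvd_minus_iff)
      then show "l dvd - x - - y" by simp
    qed simp_all
    then show ?thesis by (simp add: z_def set_det_const_diag)
  qed
  ultimately show ?thesis by blast
qed

lemma prime_dvd_power_minus_one:
  fixes a :: "'a::comm_ring_1"
  assumes l: "prime (l::nat)"
  shows "of_nat l dvd (a - 1) ^ l ^ n - (a ^ l ^ n - 1)"
proof (induction n)
  case (Suc n)
  let ?A = "a ^ l ^ n"
  have pow: "of_nat l dvd x ^ k - y ^ k" if "of_nat l dvd x - y" for x y :: 'a and k
  proof (induction k)
    case (Suc k)
    have "of_nat l dvd (x - y) * x ^ k + y * (x ^ k - y ^ k)" using Suc that by (intro dvd_add dvd_mult dvd_mult2)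
    then show ?case by (simp add: algebra_simps)
  qed simp
  have "(?A - 1) ^ l = (\<Sum>k\<le>l. of_nat (l choose k) * ?A ^ k * (- 1) ^ (l - k))"
    using binomial_ring[of ?A "- 1" l] by simp
  also have "\<dots> = (\<Sum>k\<in>{0<..<l}. of_nat (l choose k) * ?A ^ k * (- 1) ^ (l - k)) + (- 1) ^ l + ?A ^ l"
  proof -
    have "{..l} = insert 0 (insert l {0<..<l})" using prime_gt_0_nat[OF l] by auto
    then show ?thesis using prime_gt_0_nat[OF l] by (simp add: algebra_simps)
  qed
  finally have eq: "(?A - 1) ^ l - (?A ^ l - 1) =
      (\<Sum>k\<in>{0<..<l}. of_nat (l choose k) * ?A ^ k * (- 1) ^ (l - k)) + ((- 1) ^ l + 1)"
    by simp
  have s1: "of_nat l dvd (\<Sum>k\<in>{0<..<l}. of_nat (l choose k) * ?A ^ k * (- 1) ^ (l - k) :: 'a)"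
  proof (rule dvd_sum)
    fix k assume "k \<in> {0<..<l}"
    then have "l dvd (l choose k)" using l prime_gt_0_nat[OF l] by (intro dvd_choose_prime) auto
    then have "of_nat l dvd (of_nat (l choose k) :: 'a)" by (auto elim!: dvdE)
    then show "of_nat l dvd (of_nat (l choose k) * ?A ^ k * (- 1) ^ (l - k) :: 'a)" by (intro dvd_mult2)
  qed
  \<comment> \<open>This is zero for odd \<open>l\<close> and equal to \<open>l\<close> for
    \<open>l = 2\<close>.\<close>
  have s2: "of_nat l dvd ((- 1) ^ l + 1 :: 'a)"
    using prime_odd_nat[OF l] prime_ge_2_nat[OF l] by (cases "l = 2") auto
  have "of_nat l dvd (?A - 1) ^ l - (?A ^ l - 1)" unfolding eq by (rule dvd_add[OF s1 s2])
  moreover have "of_nat l dvd ((a - 1) ^ l ^ n) ^ l - (?A - 1) ^ l" by (rule pow) (rule Suc)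
  moreover have "((a - 1) ^ l ^ n) ^ l - (?A ^ l - 1)
      = (((a - 1) ^ l ^ n) ^ l - (?A - 1) ^ l) + ((?A - 1) ^ l - (?A ^ l - 1))" by (simp add: algebra_simps)
  ultimately have "of_nat l dvd ((a - 1) ^ l ^ n) ^ l - (?A ^ l - 1)" by (simp only: dvd_add)
  then show ?case by (simp only: power_Suc2 power_mult)
qed simp

text \<open>Modulo \<open>\<ell>\<close> we have \<open>x\<^sup>N - 1 = (x - 1)\<^sup>N\<close>, so a geometric series in \<open>x - 1\<close> inverts \<open>h\<close> modulo
  \<open>\<ell>\<close> and \<open>x\<^sup>N - 1\<close>.\<close>

lemma prod_roots_unity_coprime:
  assumes l: "prime (l::nat)" and h: "\<not> int l dvd poly h 1"
  shows "\<exists>z. (\<Prod>k\<in>{0..<int (l ^ n)}. cpoly h (chi (l ^ n) k)) = of_int z \<and> \<not> int l dvd z"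
proof -
  define N where "N = l ^ n"
  have N: "N > 0" using prime_gt_0_nat[OF l] by (simp add: N_def)
  have pr: "prime (int l)" using l by simp
  have "coprime (poly h 1) (int l)" using pr h by (metis coprime_commute prime_imp_coprime)
  then obtain a where a: "[poly h 1 * a = 1] (mod int l)" using cong_solve_coprime_int by blast
  then have "int l dvd poly h 1 * a - 1" by (simp add: cong_iff_dvd_diff)
  then obtain c where "poly h 1 * a - 1 = int l * c" by (auto elim: dvdE)
  then have c: "poly h 1 * a = 1 + int l * c" by simp
  have "[:-1, 1:] dvd h - [:poly h 1:]" using poly_eq_0_iff_dvd[of "h - [:poly h 1:]" 1] by simp
  then obtain w where "h - [:poly h 1:] = [:-1, 1:] * w" by (auto elim: dvdE)
  then have h': "h = [:poly h 1:] + [:-1, 1:] * w" by (simp add: algebra_simps)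
  have "of_nat l dvd ([:0, 1:] - 1 :: int poly) ^ l ^ n - ([:0, 1:] ^ l ^ n - 1)"
    by (rule prime_dvd_power_minus_one[OF l])
  then obtain v where v: "([:0, 1:] - 1 :: int poly) ^ N - ([:0, 1:] ^ N - 1) = of_nat l * v"
    by (auto simp: N_def elim: dvdE)
  \<comment> \<open>Chosen so that a h = 1 + l c - y. Then \<open>u\<close>, a times the truncated
    geometric series in \<open>y\<close>, inverts \<open>h\<close> up to y^N and a multiple of l. At
    N-th roots of unity y^N is itself divisible by l, and \<open>s\<close> collects the error
    divided by l.\<close>
  define y where "y = - ([:-1, 1:] * w * [:a:])"
  define u where "u = [:a:] * (\<Sum>i<N. y ^ i)"
  define s where "s = [:c:] * (\<Sum>i<N. y ^ i) - (- (w * [:a:])) ^ N * v"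
  have eq: "cpoly u \<zeta> * cpoly h \<zeta> = cpoly (1 + smult (int l) s) \<zeta>" if \<zeta>: "\<zeta> ^ N = 1" for \<zeta>
  proof -
    have v': "(\<zeta> - 1) ^ N = of_nat l * cpoly v \<zeta>"
      using arg_cong[OF v, of "\<lambda>p. cpoly p \<zeta>"] \<zeta> by (simp add: cpoly_simps)
    let ?y = "cpoly y \<zeta>" and ?g = "cpoly (\<Sum>i<N. y ^ i) \<zeta>"
    have y: "?y = (\<zeta> - 1) * - (cpoly w \<zeta> * of_int a)" by (simp only: y_def cpoly_simps) (simp add: algebra_simps)
    have g: "?g = (\<Sum>i<N. ?y ^ i)" by (simp add: of_int_poly_hom.hom_sum poly_sum cpoly_simps)
    have ah: "of_int a * cpoly h \<zeta> = 1 + of_nat l * of_int c - ?y"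
    proof -
      have "of_int a * cpoly h \<zeta> = of_int (poly h 1 * a) + of_int a * ((\<zeta> - 1) * cpoly w \<zeta>)"
        by (subst h') (simp only: cpoly_simps, simp add: algebra_simps)
      then show ?thesis unfolding c y by (simp add: algebra_simps)
    qed
    have geo: "(1 - ?y) * ?g = 1 - ?y ^ N" unfolding g by (rule one_diff_power_eq[symmetric])
    have "cpoly u \<zeta> * cpoly h \<zeta> = ?g * (of_int a * cpoly h \<zeta>)" by (simp add: u_def cpoly_simps)
    also have "\<dots> = (1 - ?y) * ?g + of_nat l * of_int c * ?g" unfolding ah by (simp add: algebra_simps)
    also have "\<dots> = 1 - ?y ^ N + of_nat l * of_int c * ?g" by (simp add: geo)
    also have "?y ^ N = of_nat l * cpoly v \<zeta> * (- (cpoly w \<zeta> * of_int a)) ^ N"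
      unfolding y power_mult_distrib v' by simp
    finally show ?thesis by (simp add: s_def cpoly_simps algebra_simps)
  qed
  obtain zu where zu: "(\<Prod>k\<in>{0..<int N}. cpoly u (chi N k)) = of_int zu" using prod_roots_unity_int[OF N] by blast
  obtain zh where zh: "(\<Prod>k\<in>{0..<int N}. cpoly h (chi N k)) = of_int zh" using prod_roots_unity_int[OF N] by blast
  obtain zs where zs: "(\<Prod>k\<in>{0..<int N}. cpoly (1 + smult (int l) s) (chi N k)) = of_int zs" "int l dvd zs - 1"
    using prod_roots_unity_int[OF N, of "1 + smult (int l) s"] by blast
  have "of_int (zu * zh) = (of_int zs :: complex)"
    unfolding of_int_mult zu[symmetric] zh[symmetric] zs(1)[symmetric] prod.distrib[symmetric]
    by (rule prod.cong[OF refl]) (rule eq, rule chi_power_self[OF N])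
  then have "zu * zh = zs" by (simp only: of_int_eq_iff)
  moreover have "\<not> int l dvd zs"
  proof
    assume "int l dvd zs"
    then have "int l dvd zs - (zs - 1)" using zs(2) by (rule dvd_diff)
    then show False using pr by (simp add: prime_int_iff)
  qed
  ultimately have "\<not> int l dvd zh" by auto
  then show ?thesis using zh by (auto simp: N_def)
qed

section \<open>Primitive roots of unity of l-power order and the cyclotomic polynomial\<close>

definition prim_set :: "nat \<Rightarrow> nat \<Rightarrow> int set" where
  "prim_set l n = {k \<in> {0..<int (l ^ n)}. \<not> int l dvd k}"

lemma finite_prim_set [simp]: "finite (prim_set l n)"
  unfolding prim_set_def by (rule finite_subset[of _ "{0..<int (l ^ n)}"]) auto

lemma bij_betw_nonprim:
  assumes l: "prime (l::nat)" and n: "n > 0"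
  shows "bij_betw (\<lambda>k. int l * k) {0..<int (l ^ (n - 1))} {k \<in> {0..<int (l ^ n)}. int l dvd k}"
proof (rule bij_betw_byWitness[where f' = "\<lambda>k. k div int l"])
  have l0: "int l > 0" using prime_gt_0_nat[OF l] by simp
  have e: "int (l ^ n) = int l * int (l ^ (n - 1))" using n by (cases n) simp_all
  show "\<forall>a\<in>{0..<int (l ^ (n - 1))}. int l * a div int l = a" using l0 by simp
  show "\<forall>a'\<in>{k \<in> {0..<int (l ^ n)}. int l dvd k}. int l * (a' div int l) = a'" by simp
  show "(\<lambda>k. int l * k) ` {0..<int (l ^ (n - 1))} \<subseteq> {k \<in> {0..<int (l ^ n)}. int l dvd k}"
    unfolding e using l0 by (auto simp: zero_le_mult_iff simp del: of_nat_power)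
  show "(\<lambda>k. k div int l) ` {k \<in> {0..<int (l ^ n)}. int l dvd k} \<subseteq> {0..<int (l ^ (n - 1))}"
    unfolding e using l0 by (auto simp: zero_le_mult_iff simp del: of_nat_power elim!: dvdE)
qed

lemma card_prim_set:
  assumes l: "prime (l::nat)" and n: "n > 0"
  shows "card (prim_set l n) = l ^ n - l ^ (n - 1)"
proof -
  have "{0..<int (l ^ n)} = prim_set l n \<union> {k \<in> {0..<int (l ^ n)}. int l dvd k}" by (auto simp: prim_set_def)
  then have "card {0..<int (l ^ n)} = card (prim_set l n) + card {k \<in> {0..<int (l ^ n)}. int l dvd k}"
    by (metis (no_types, lifting) card_Un_disjoint prim_set_def finite_prim_set disjoint_iff
        finite_Collect_conjI finite_atLeastLessThan_int mem_Collect_eq finite_Un)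
  moreover have "card {k \<in> {0..<int (l ^ n)}. int l dvd k} = card {0..<int (l ^ (n - 1))}"
    using bij_betw_same_card[OF bij_betw_nonprim[OF l n]] by simp
  ultimately show ?thesis by (simp del: of_nat_power)
qed

lemma chi_mult_prime:
  assumes l: "prime (l::nat)" and n: "n > 0"
  shows "chi (l ^ n) (int l * k) = chi (l ^ (n - 1)) k"
proof -
  have "real (l ^ n) = real l * real (l ^ (n - 1))" using n by (cases n) simp_all
  then show ?thesis using prime_gt_0_nat[OF l] by (simp add: chi_def mult.assoc)
qed

text \<open>The indices divisible by \<open>l\<close> yield the roots of unity of the level below;
  this is how primitive products are reached from full ones.\<close>

lemma prod_split_prim:
  fixes f :: "complex \<Rightarrow> 'a::comm_monoid_mult"
  assumes l: "prime (l::nat)" and n: "n > 0"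
  shows "(\<Prod>k\<in>{0..<int (l ^ n)}. f (chi (l ^ n) k))
    = (\<Prod>k\<in>prim_set l n. f (chi (l ^ n) k)) * (\<Prod>k\<in>{0..<int (l ^ (n - 1))}. f (chi (l ^ (n - 1)) k))"
proof -
  let ?B = "{k \<in> {0..<int (l ^ n)}. int l dvd k}"
  have U: "{0..<int (l ^ n)} = prim_set l n \<union> ?B" by (auto simp: prim_set_def)
  have "(\<Prod>k\<in>prim_set l n \<union> ?B. f (chi (l ^ n) k)) = (\<Prod>k\<in>prim_set l n. f (chi (l ^ n) k)) * (\<Prod>k\<in>?B. f (chi (l ^ n) k))"
    by (rule prod.union_disjoint[OF finite_prim_set finite_subset[of _ "{0..<int (l ^ n)}"]]) (auto simp: prim_set_def)
  moreover have "(\<Prod>k\<in>?B. f (chi (l ^ n) k)) = (\<Prod>k\<in>{0..<int (l ^ (n - 1))}. f (chi (l ^ (n - 1)) k))"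
    by (subst prod.reindex_bij_betw[OF bij_betw_nonprim[OF l n], symmetric]) (simp add: chi_mult_prime[OF l n])
  ultimately show ?thesis using U by simp
qed

text \<open>For \<open>n > 0\<close> this is the cyclotomic polynomial of order l^n, the quotient of
  x^(l^n) - 1 by x^(l^(n-1)) - 1.\<close>

definition cyclo :: "nat \<Rightarrow> nat \<Rightarrow> int poly" where
  "cyclo l n = (\<Sum>i<l. [:0, 1:] ^ (l ^ (n - 1) * i))"

lemma cyclo_mult:
  assumes "n > 0"
  shows "([:0, 1:] ^ l ^ (n - 1) - 1) * cyclo l n = [:0, 1:] ^ l ^ n - 1"
proof -
  have "l ^ n = l ^ (n - 1) * l" using assms by (cases n) simp_all
  then show ?thesis
    using power_diff_1_eq[of "[:0, 1:] ^ l ^ (n - 1) :: int poly" l] by (simp add: cyclo_def power_mult)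
qed

lemma poly_cyclo_1: "poly (cyclo l n) 1 = int l"
  by (simp add: cyclo_def poly_sum)

lemma cyclo_root:
  assumes l: "prime (l::nat)" and n: "n > 0" and k: "k \<in> prim_set l n"
  shows "cpoly (cyclo l n) (chi (l ^ n) k) = 0"
proof -
  have N: "l ^ n > 0" using prime_gt_0_nat[OF l] by simp
  let ?z = "chi (l ^ n) k"
  have "(?z ^ l ^ (n - 1) - 1) * cpoly (cyclo l n) ?z = 0"
    using arg_cong[OF cyclo_mult[OF n, of l], of "\<lambda>p. cpoly p ?z"] chi_power_self[OF N]
    by (simp add: cpoly_simps)
  moreover have "?z ^ l ^ (n - 1) \<noteq> 1"
  proof
    assume "?z ^ l ^ (n - 1) = 1"
    then have "int (l ^ n) dvd k * int (l ^ (n - 1))" by (simp only: chi_power chi_eq_1_iff[OF N])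
    moreover have "int (l ^ n) = int l * int (l ^ (n - 1))" using n by (cases n) simp_all
    moreover have "int (l ^ (n - 1)) \<noteq> 0" using prime_gt_0_nat[OF l] by simp
    ultimately have "int l dvd k" by (metis dvd_times_right_cancel_iff)
    with k show False by (simp add: prim_set_def)
  qed
  ultimately show ?thesis by simp
qed

text \<open>Modulo \<open>l\<close> both x^(l^n) - 1 and x^(l^(n-1)) - 1 are powers of x - 1. At a
  primitive root \<zeta> the equation reads l v(\<zeta>) = -(\<zeta> - 1)^\<phi> with \<phi> = l^n -
  l^(n-1), and v(1) = 1 makes v(\<zeta>) an l-adic unit: l is totally ramified.\<close>

lemma cyclo_eisenstein:
  assumes l: "prime (l::nat)" and n: "n > 0"
  obtains v where "cyclo l n = ([:0, 1:] - 1) ^ (l ^ n - l ^ (n - 1)) + of_nat l * v" "poly v 1 = 1"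
proof -
  let ?x = "[:0, 1:] :: int poly"
  define M where "M = l ^ (n - 1)"
  define e where "e = l ^ n - M"
  have N: "l ^ n = M + e" "e > 0"
  proof -
    have "l ^ n = l * M" using n by (cases n) (simp_all add: M_def)
    moreover have "M > 0" "l > 1" using prime_gt_0_nat[OF l] prime_gt_1_nat[OF l] by (simp_all add: M_def)
    ultimately show "l ^ n = M + e" "e > 0" by (auto simp: e_def)
  qed
  have d1: "of_nat l dvd (?x - 1) ^ l ^ n - (?x ^ l ^ n - 1)" by (rule prime_dvd_power_minus_one[OF l])
  have d2: "of_nat l dvd (?x - 1) ^ M - (?x ^ M - 1)" unfolding M_def by (rule prime_dvd_power_minus_one[OF l])
  have "(?x ^ M - 1) * (cyclo l n - (?x - 1) ^ e)
      = ((?x - 1) ^ M - (?x ^ M - 1)) * (?x - 1) ^ e - ((?x - 1) ^ l ^ n - (?x ^ l ^ n - 1))"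
    using cyclo_mult[OF n, of l, folded M_def] by (simp only: N(1) power_add) (simp add: algebra_simps)
  then have dvd: "of_nat l dvd (?x ^ M - 1) * (cyclo l n - (?x - 1) ^ e)"
    using d1 d2 by (simp add: dvd_diff)
  have ofn: "of_nat l = [:int l:]" by (simp add: of_nat_poly)
  \<comment> \<open>The constant \<open>l\<close> is prime in Z[x] and does not divide the monic x^M
    - 1, so that factor can be cancelled modulo \<open>l\<close>.\<close>
  have "prime_elem [:int l:]" using l by (intro lift_prime_elem_poly) simp
  moreover have "\<not> [:int l:] dvd ?x ^ M - 1"
  proof
    assume "[:int l:] dvd ?x ^ M - 1"
    then have "int l dvd coeff (?x ^ M - 1) M" by (simp only: const_poly_dvd_iff)
    moreover have "M \<noteq> 0" using prime_gt_0_nat[OF l] by (simp add: M_def)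
    moreover have "coeff (?x ^ M) M = 1" using coeff_monom[of "1::int" M M] by (simp add: monom_altdef)
    ultimately have "int l dvd 1" by simp
    then show False using prime_gt_1_nat[OF l] by simp
  qed
  ultimately have "[:int l:] dvd cyclo l n - (?x - 1) ^ e"
    using dvd unfolding ofn by (simp add: prime_elem_dvd_mult_iff)
  then obtain v where "cyclo l n - (?x - 1) ^ e = of_nat l * v" unfolding ofn by (auto elim: dvdE)
  then have v: "cyclo l n = (?x - 1) ^ e + of_nat l * v" by (simp add: algebra_simps)
  have "int l = int l * poly v 1"
    using arg_cong[OF v, of "\<lambda>p. poly p 1"] N(2) by (simp add: poly_cyclo_1 of_nat_poly power_0_left)
  then have "poly v 1 = 1" using prime_gt_0_nat[OF l] by simp
  then show ?thesis by (rule that[OF v[unfolded e_def M_def]])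
qed

text \<open>The product of x - \<zeta> over the primitive \<zeta> and the cyclotomic polynomial are
  monic of the same degree. A nonzero difference would have more roots than its degree allows, so
  they are equal, and their value at 1 is l.\<close>

lemma prod_prim_one_minus:
  assumes l: "prime (l::nat)" and n: "n > 0"
  shows "(\<Prod>k\<in>prim_set l n. 1 - chi (l ^ n) k) = of_nat l"
proof -
  define N where "N = l ^ n"
  have N: "N > 0" using prime_gt_0_nat[OF l] by (simp add: N_def)
  have inj: "inj_on (chi N) {0..<int N}"
  proof (rule inj_onI)
    fix a b assume ab: "a \<in> {0..<int N}" "b \<in> {0..<int N}" "chi N a = chi N b"
    have "chi N b * chi N (a - b) = chi N b * 1" using ab(3) by (simp add: chi_add[symmetric])
    moreover have "chi N b \<noteq> 0" by (simp add: chi_def)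
    ultimately have "chi N (a - b) = 1" by simp
    then have "int N dvd a - b" by (simp add: chi_eq_1_iff N)
    then show "a = b" using ab by (auto simp: mod_eq_dvd_iff[symmetric])
  qed
  let ?C = "map_poly of_int (cyclo l n) :: complex poly"
  let ?p = "\<Prod>k\<in>prim_set l n. [:- chi N k, 1:]"
  have sub: "prim_set l n \<subseteq> {0..<int N}" by (auto simp: prim_set_def N_def)
  have deg: "degree ?p = card (prim_set l n)" by (subst degree_prod_eq_sum_degree) auto
  have lc: "lead_coeff ?p = 1" by (simp add: lead_coeff_prod)
  have x: "map_poly of_int [:0, 1:] = (monom 1 1 :: complex poly)" by (simp add: monom_altdef)
  have C: "?C = (\<Sum>i<l. monom 1 (l ^ (n - 1) * i))"
    by (simp add: cyclo_def of_int_poly_hom.hom_sum of_int_poly_hom.hom_power x monom_power)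
  obtain m where m: "l = Suc m" using prime_gt_0_nat[OF l] by (cases l) auto
  have card: "card (prim_set l n) = l ^ (n - 1) * m"
    unfolding card_prim_set[OF l n] using n by (cases n) (simp_all add: m)
  have M0: "l ^ (n - 1) > 0" using prime_gt_0_nat[OF l] by simp
  have coeffC: "coeff ?C j = (if j = l ^ (n - 1) * m then 1 else 0)" if "j \<ge> l ^ (n - 1) * m" for j
  proof -
    have "coeff ?C j = (\<Sum>i<l. if l ^ (n - 1) * i = j then 1 else 0)"
      by (simp only: C coeff_sum coeff_monom)
    also have "\<dots> = (\<Sum>i<l. if i = m then (if l ^ (n - 1) * m = j then 1 else 0) else 0)"
    proof (rule sum.cong[OF refl])
      fix i assume i: "i \<in> {..<l}"
      show "(if l ^ (n - 1) * i = j then 1 else 0) = (if i = m then if l ^ (n - 1) * m = j then 1 else 0 else (0::complex))"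
      proof (cases "i = m")
        case False
        then have "l ^ (n - 1) * i < l ^ (n - 1) * m" using i M0 m by (intro mult_strict_left_mono) auto
        then show ?thesis using that False by auto
      qed simp
    qed
    also have "\<dots> = (if j = l ^ (n - 1) * m then 1 else 0)" by (simp add: sum.delta m eq_commute[of j])
    finally show ?thesis .
  qed
  have "?p = ?C"
  proof (rule ccontr)
    assume ne: "?p \<noteq> ?C"
    define d where "d = ?C - ?p"
    have d0: "d \<noteq> 0" using ne by (simp add: d_def)
    have "coeff d j = 0" if "j \<ge> card (prim_set l n)" for j
      using that coeffC[of j] lc deg by (cases "j = card (prim_set l n)") (auto simp: d_def card coeff_eq_0)
    then have degd: "degree d < card (prim_set l n)"
      using d0 by (metis leading_coeff_0_iff linorder_not_le)
    have "chi N ` prim_set l n \<subseteq> {z. poly d z = 0}"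
    proof
      fix z assume "z \<in> chi N ` prim_set l n"
      then obtain k where k: "k \<in> prim_set l n" "z = chi N k" by blast
      have "poly ?p z = 0" using k by (simp add: poly_prod prod_zero_iff) (auto intro!: bexI[of _ k])
      moreover have "poly ?C z = 0" using cyclo_root[OF l n k(1)] k by (simp add: N_def)
      ultimately show "z \<in> {z. poly d z = 0}" by (simp add: d_def)
    qed
    then have "card (chi N ` prim_set l n) \<le> card {z. poly d z = 0}"
      by (rule card_mono[rotated]) (rule poly_roots_finite[OF d0])
    also have "\<dots> \<le> degree d" by (rule card_poly_roots_bound[OF d0])
    finally show False using degd inj sub by (simp add: card_image inj_on_subset)
  qed
  then have "poly ?p 1 = poly ?C (of_int 1)" by simp
  then show ?thesis unfolding cpoly_of_int poly_cyclo_1 by (simp add: poly_prod N_def)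
qed

section \<open>Expansion in powers of 1 - \<zeta> and valuation of the primitive product\<close>

lemma cpoly_sum: "cpoly (\<Sum>i\<in>A. f i) z = (\<Sum>i\<in>A. cpoly (f i) z)"
  by (simp add: of_int_poly_hom.hom_sum poly_sum)

lemma cpoly_expand:
  defines "r \<equiv> \<lambda>R :: int poly. R \<circ>\<^sub>p [:1, -1:]"
  shows "cpoly R z = (\<Sum>j<J. of_int (coeff (r R) j) * (1 - z) ^ j) + (1 - z) ^ J * cpoly (poly_shift J (r R)) (1 - z)"
proof -
  have "r R = (\<Sum>j<J. smult (coeff (r R) j) (monom 1 j)) + monom 1 J * poly_shift J (r R)"
  proof (rule poly_eqI)
    fix k
    have "(\<Sum>j<J. coeff (r R) j * (if j = k then 1 else 0)) = (if k < J then coeff (r R) k else 0)"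
      by (simp add: if_distrib[of "\<lambda>x. _ * x"] sum.delta cong: if_cong)
    then show "coeff (r R) k = coeff ((\<Sum>j<J. smult (coeff (r R) j) (monom 1 j)) + monom 1 J * poly_shift J (r R)) k"
      by (simp add: coeff_sum coeff_monom_mult coeff_poly_shift)
  qed
  then have "cpoly (r R) (1 - z) = cpoly ((\<Sum>j<J. smult (coeff (r R) j) (monom 1 j)) + monom 1 J * poly_shift J (r R)) (1 - z)"
    by (rule arg_cong)
  moreover have "cpoly (r R) (1 - z) = cpoly R z" unfolding r_def by (simp only: cpoly_simps) simp
  ultimately show ?thesis by (simp only: cpoly_simps cpoly_sum)
qed

text \<open>At an N-th root of unity (1 - z)^N is l times an integer polynomial in z, so the tail
  from degree N m on is divisible by l^m. One \<open>B\<close> serves all roots.\<close>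

lemma cpoly_expand_roots_unity:
  assumes l: "prime (l::nat)"
  obtains B where "\<And>z. z ^ l ^ n = 1 \<Longrightarrow> cpoly R z =
    (\<Sum>j<l ^ n * m. of_int (coeff (R \<circ>\<^sub>p [:1, -1:]) j) * (1 - z) ^ j) + of_nat l ^ m * cpoly B z"
proof -
  define N where "N = l ^ n"
  have "of_nat l dvd ([:0, 1:] - 1 :: int poly) ^ l ^ n - ([:0, 1:] ^ l ^ n - 1)"
    by (rule prime_dvd_power_minus_one[OF l])
  then obtain v where v: "([:0, 1:] - 1 :: int poly) ^ N - ([:0, 1:] ^ N - 1) = of_nat l * v"
    by (auto simp: N_def elim: dvdE)
  define B where "B = smult ((- 1) ^ N) v ^ m * (poly_shift (N * m) (R \<circ>\<^sub>p [:1, -1:]) \<circ>\<^sub>p [:1, -1:])"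
  have "cpoly R z = (\<Sum>j<N * m. of_int (coeff (R \<circ>\<^sub>p [:1, -1:]) j) * (1 - z) ^ j) + of_nat l ^ m * cpoly B z"
    if z: "z ^ N = 1" for z
  proof -
    have v': "(z - 1) ^ N = of_nat l * cpoly v z"
      using arg_cong[OF v, of "\<lambda>p. cpoly p z"] z by (simp add: cpoly_simps)
    have "(1 - z) ^ N = (- 1) ^ N * (z - 1) ^ N" by (simp add: power_mult_distrib[symmetric])
    then have "(1 - z) ^ (N * m) = of_nat l ^ m * ((- 1) ^ N * cpoly v z) ^ m"
      unfolding power_mult v' by (simp add: power_mult_distrib)
    then show ?thesis
      by (subst cpoly_expand[of _ _ "N * m"]) (simp add: B_def cpoly_simps)
  qed
  then show ?thesis using that[of B] unfolding N_def by blast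
qed

text \<open>The product over the primitive roots alone is not shown to be an integer; its \<open>\<ell>\<close>-fold is the
  difference of the full products for \<open>A + \<Phi>\<close> and \<open>A\<close>, where \<open>\<Phi>\<close> is the cyclotomic polynomial.\<close>

lemma prod_prim_dvd:
  assumes l: "prime (l::nat)"
    and r: "\<And>j. j < l * m \<Longrightarrow> int l ^ m dvd coeff (R \<circ>\<^sub>p [:1, -1:]) j"
  shows "\<exists>z. of_nat l * (\<Prod>k\<in>prim_set l 1. cpoly R (chi (l ^ 1) k)) = of_int (int l ^ m * z)"
proof -
  have N: "l ^ 1 > 0" using prime_gt_0_nat[OF l] by simp
  obtain B where B: "\<And>z. z ^ l ^ 1 = 1 \<Longrightarrow> cpoly R z =
    (\<Sum>j<l ^ 1 * m. of_int (coeff (R \<circ>\<^sub>p [:1, -1:]) j) * (1 - z) ^ j) + of_nat l ^ m * cpoly B z"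
    using cpoly_expand_roots_unity[OF l, of 1 R m] by blast
  \<comment> \<open>At the l-th roots of unity, \<open>A\<close> takes the values of
    \<open>R\<close> divided by l^m.\<close>
  define A where "A = (\<Sum>j<l * m. smult (coeff (R \<circ>\<^sub>p [:1, -1:]) j div int l ^ m) ([:1, -1:] ^ j)) + B"
  have RA: "cpoly R z = of_nat l ^ m * cpoly A z" if "z ^ l ^ 1 = 1" for z
  proof -
    have "(\<Sum>j<l * m. of_int (coeff (R \<circ>\<^sub>p [:1, -1:]) j) * (1 - z) ^ j)
       = of_nat l ^ m * (\<Sum>j<l * m. of_int (coeff (R \<circ>\<^sub>p [:1, -1:]) j div int l ^ m) * (1 - z) ^ j)"
      unfolding sum_distrib_left
    proof (rule sum.cong[OF refl])
      fix j assume "j \<in> {..<l * m}"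
      then have "coeff (R \<circ>\<^sub>p [:1, -1:]) j = int l ^ m * (coeff (R \<circ>\<^sub>p [:1, -1:]) j div int l ^ m)"
        using r[of j] by simp
      then have "(of_int (coeff (R \<circ>\<^sub>p [:1, -1:]) j) :: complex) = of_int (int l ^ m * (coeff (R \<circ>\<^sub>p [:1, -1:]) j div int l ^ m))"
        by (rule arg_cong)
      then show "of_int (coeff (R \<circ>\<^sub>p [:1, -1:]) j) * (1 - z) ^ j
          = of_nat l ^ m * (of_int (coeff (R \<circ>\<^sub>p [:1, -1:]) j div int l ^ m) * (1 - z) ^ j)"
        by (simp only: of_int_mult of_int_power of_int_of_nat_eq mult.assoc)
    qed
    then show ?thesis using B[OF that] by (simp add: A_def cpoly_simps cpoly_sum distrib_left)
  qed
  let ?P = "\<lambda>h. \<Prod>k\<in>prim_set l 1. cpoly h (chi (l ^ 1) k)"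
  have split: "(\<Prod>k\<in>{0..<int (l ^ 1)}. cpoly h (chi (l ^ 1) k)) = ?P h * of_int (poly h 1)" for h
  proof -
    have "{0..<int (l ^ (1 - 1))} = {0}" by auto
    then have "(\<Prod>k\<in>{0..<int (l ^ (1 - 1))}. cpoly h (chi (l ^ (1 - 1)) k)) = of_int (poly h 1)"
      using cpoly_of_int[of h 1] by simp
    then show ?thesis using prod_split_prim[OF l, of 1 "cpoly h"] by (simp only: zero_less_one simp_thms)
  qed
  obtain z1 where z1: "?P A * of_int (poly A 1) = of_int z1"
    using prod_roots_unity_int[OF N, of A] split[of A] by metis
  obtain z2 where "?P (A + cyclo l 1) * of_int (poly (A + cyclo l 1) 1) = of_int z2"
    using prod_roots_unity_int[OF N, of "A + cyclo l 1"] split[of "A + cyclo l 1"] by metis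
  moreover have "?P (A + cyclo l 1) = ?P A"
    by (rule prod.cong[OF refl]) (use cyclo_root[OF l, of 1] in \<open>simp add: cpoly_simps\<close>)
  ultimately have "of_nat l * ?P A = of_int (z2 - z1)"
    using z1 by (simp add: poly_cyclo_1 algebra_simps)
  moreover have "?P R = (of_nat l ^ m) ^ card (prim_set l 1) * ?P A"
    unfolding prod_constant[symmetric] prod.distrib[symmetric]
    by (rule prod.cong[OF refl]) (rule RA, rule chi_power_self[OF N])
  \<comment> \<open>Each primitive root contributes a factor l^m. One of them suffices, and there is
    at least one root.\<close>
  moreover have "card (prim_set l 1) > 0" using prime_gt_1_nat[OF l] by (simp add: card_prim_set[OF l])
  then obtain c where "card (prim_set l 1) = Suc c" by (cases "card (prim_set l 1)") auto
  ultimately have "of_nat l * ?P R = of_int (int l ^ m * ((int l ^ m) ^ c * (z2 - z1)))"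
    by (simp add: mult_ac)
  then show ?thesis by blast
qed

text \<open>Put \<pi> = 1 - \<zeta> and e = l^n - l^(n-1). Then R = l^m (l A + \<pi>^d U) with U(1)
  prime to l, and l A is the smaller term l-adically since d < e. To express this by polynomials,
  multiply by V, for which l V is \<pi>^e up to sign: V R = l^m \<pi>^d h with h(1) = U(1). The
  product of all \<pi> is l, and those of V(\<zeta>) and h(\<zeta>) are quotients of integers prime
  to l, which supply \<open>z1\<close> and \<open>z2\<close>.\<close>

lemma prod_prim_valuation:
  assumes l: "prime (l::nat)" and n: "n > 0" and d: "d < l ^ n - l ^ (n - 1)"
    and r_low: "\<And>j. j < d \<Longrightarrow> int l ^ Suc m dvd coeff (R \<circ>\<^sub>p [:1, -1:]) j"
    and r_d: "\<not> int l ^ Suc m dvd coeff (R \<circ>\<^sub>p [:1, -1:]) d"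
    and r_all: "\<And>j. j < l ^ n * Suc m \<Longrightarrow> int l ^ m dvd coeff (R \<circ>\<^sub>p [:1, -1:]) j"
  shows "\<exists>z1 z2. \<not> int l dvd z1 \<and> \<not> int l dvd z2 \<and>
    of_int z1 * (\<Prod>k\<in>prim_set l n. cpoly R (chi (l ^ n) k))
      = of_int (int l ^ (m * (l ^ n - l ^ (n - 1)) + d) * z2)"
proof -
  define N where "N = l ^ n"
  define e where "e = l ^ n - l ^ (n - 1)"
  have N: "N > 0" using prime_gt_0_nat[OF l] by (simp add: N_def)
  have pr: "prime (int l)" using l by simp
  \<comment> \<open>Large enough for the tail to be divisible by l^(m+1), so that it joins the
    coefficients below \<open>d\<close> in \<open>A\<close>.\<close>
  define J where "J = l ^ n * Suc m"
  have "l ^ n \<le> J" by (simp add: J_def)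
  then have dJ: "d < J" using d by linarith
  define r where "r = coeff (R \<circ>\<^sub>p [:1, -1:])"
  obtain B where B: "\<And>z. z ^ l ^ n = 1 \<Longrightarrow> cpoly R z =
    (\<Sum>j<J. of_int (r j) * (1 - z) ^ j) + of_nat l ^ Suc m * cpoly B z"
    using cpoly_expand_roots_unity[OF l, of n R "Suc m"] unfolding J_def r_def by blast
  define A where "A = (\<Sum>j<d. smult (r j div int l ^ Suc m) ([:1, -1:] ^ j)) + B"
  define U where "U = (\<Sum>j\<in>{d..<J}. smult (r j div int l ^ m) ([:1, -1:] ^ (j - d)))"
  have RAU: "cpoly R z = of_nat l ^ m * (of_nat l * cpoly A z + (1 - z) ^ d * cpoly U z)" if z: "z ^ l ^ n = 1" for z
  proof -
    have 1: "(\<Sum>j<d. of_int (r j) * (1 - z) ^ j) = of_nat l ^ Suc m * (\<Sum>j<d. of_int (r j div int l ^ Suc m) * (1 - z) ^ j)"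
      unfolding sum_distrib_left
    proof (rule sum.cong[OF refl])
      fix j assume "j \<in> {..<d}"
      then have "r j = int l ^ Suc m * (r j div int l ^ Suc m)"
        using r_low[of j] unfolding r_def by (intro dvd_mult_div_cancel[symmetric]) simp
      then have "(of_int (r j) :: complex) = of_int (int l ^ Suc m * (r j div int l ^ Suc m))" by (rule arg_cong)
      then show "of_int (r j) * (1 - z) ^ j = of_nat l ^ Suc m * (of_int (r j div int l ^ Suc m) * (1 - z) ^ j)"
        by (simp only: of_int_mult of_int_power of_int_of_nat_eq mult.assoc)
    qed
    have 2: "(\<Sum>j\<in>{d..<J}. of_int (r j) * (1 - z) ^ j)
        = of_nat l ^ m * ((1 - z) ^ d * (\<Sum>j\<in>{d..<J}. of_int (r j div int l ^ m) * (1 - z) ^ (j - d)))"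
      unfolding sum_distrib_left
    proof (rule sum.cong[OF refl])
      fix j assume j: "j \<in> {d..<J}"
      then have "r j = int l ^ m * (r j div int l ^ m)"
        using r_all[of j] unfolding r_def J_def by (intro dvd_mult_div_cancel[symmetric]) simp
      then have "(of_int (r j) :: complex) = of_int (int l ^ m * (r j div int l ^ m))" by (rule arg_cong)
      moreover have "d + (j - d) = j" using j by simp
      then have "(1 - z) ^ j = (1 - z) ^ d * (1 - z) ^ (j - d)" by (metis power_add)
      ultimately have "of_int (r j) * (1 - z) ^ j = of_int (int l ^ m * (r j div int l ^ m)) * ((1 - z) ^ d * (1 - z) ^ (j - d))"
        by (rule arg_cong2[where f = "(*)"])
      also have "\<dots> = of_nat l ^ m * ((1 - z) ^ d * (of_int (r j div int l ^ m) * (1 - z) ^ (j - d)))"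
        by (simp only: of_int_mult of_int_power of_int_of_nat_eq mult_ac)
      finally show "of_int (r j) * (1 - z) ^ j = of_nat l ^ m * ((1 - z) ^ d * (of_int (r j div int l ^ m) * (1 - z) ^ (j - d)))" .
    qed
    have "(\<Sum>j<J. of_int (r j) * (1 - z) ^ j) = (\<Sum>j<d. of_int (r j) * (1 - z) ^ j) + (\<Sum>j\<in>{d..<J}. of_int (r j) * (1 - z) ^ j)"
      unfolding lessThan_atLeast0 by (rule sum.atLeastLessThan_concat[symmetric]) (use dJ in simp_all)
    then have "cpoly R z = of_nat l ^ Suc m * (\<Sum>j<d. of_int (r j div int l ^ Suc m) * (1 - z) ^ j)
        + of_nat l ^ m * ((1 - z) ^ d * (\<Sum>j\<in>{d..<J}. of_int (r j div int l ^ m) * (1 - z) ^ (j - d)))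
        + of_nat l ^ Suc m * cpoly B z"
      using B[OF z] unfolding 1 2 by (rule subst)
    moreover have "cpoly A z = (\<Sum>j<d. of_int (r j div int l ^ Suc m) * (1 - z) ^ j) + cpoly B z"
      unfolding A_def cpoly_simps cpoly_sum by simp
    moreover have "cpoly U z = (\<Sum>j\<in>{d..<J}. of_int (r j div int l ^ m) * (1 - z) ^ (j - d))"
      unfolding U_def cpoly_simps cpoly_sum by simp
    ultimately show ?thesis by (simp only: power_Suc2 distrib_left mult.assoc add_ac)
  qed
  have U1: "\<not> int l dvd poly U 1"
  proof
    have "poly U 1 = (\<Sum>j\<in>{d..<J}. if j = d then r d div int l ^ m else 0)"
      unfolding U_def poly_sum by (rule sum.cong) (auto simp: power_0_left)
    also have "\<dots> = r d div int l ^ m" using dJ by (simp add: sum.delta)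
    finally have U: "poly U 1 = r d div int l ^ m" .
    assume "int l dvd poly U 1"
    then have "int l ^ m * int l dvd int l ^ m * (r d div int l ^ m)" unfolding U by (rule mult_dvd_mono[OF dvd_refl])
    also have "int l ^ m * (r d div int l ^ m) = r d"
      using r_all[of d] dJ unfolding r_def J_def by (intro dvd_mult_div_cancel) simp
    finally show False using r_d by (simp add: r_def mult.commute)
  qed
  obtain V where V: "cyclo l n = ([:0, 1:] - 1) ^ e + of_nat l * V" "poly V 1 = 1"
    unfolding e_def by (rule cyclo_eisenstein[OF l n])
  \<comment> \<open>In V R the factor l V of A is replaced by -(-1)^e \<pi>^e, and \<pi>^d is taken
    out. Since e - d is positive, the second term vanishes at 1.\<close>
  define h where "h = U * V - smult ((- 1) ^ e) ([:1, -1:] ^ (e - d) * A)"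
  have "poly h 1 = poly U 1" using V(2) d by (simp add: h_def e_def power_0_left)
  then have h1: "\<not> int l dvd poly h 1" using U1 by simp
  have V1: "\<not> int l dvd poly V 1" using V(2) pr by (simp add: prime_int_iff)
  let ?P = "\<lambda>f. \<Prod>k\<in>prim_set l n. f (chi N k)"
  have key: "cpoly V z * cpoly R z = of_nat l ^ m * ((1 - z) ^ d * cpoly h z)" if k: "k \<in> prim_set l n" "z = chi N k" for k z
  proof -
    have "z ^ l ^ n = 1" using chi_power_self[OF N] k by (simp add: N_def)
    note R = RAU[OF this]
    have "(z - 1) ^ e + of_nat l * cpoly V z = 0"
      using cyclo_root[OF l n k(1)] k(2) unfolding V(1) N_def by (simp add: cpoly_simps)
    moreover have "(z - 1) ^ e = (- 1) ^ e * (1 - z) ^ e" by (simp add: power_mult_distrib[symmetric])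
    moreover have "(1 - z) ^ e = (1 - z) ^ d * (1 - z) ^ (e - d)"
      using d by (metis e_def le_add_diff_inverse less_imp_le power_add)
    ultimately have lV: "of_nat l * cpoly V z = - ((- 1) ^ e * ((1 - z) ^ d * (1 - z) ^ (e - d)))"
      by (simp add: eq_neg_iff_add_eq_0 add.commute)
    have "cpoly V z * cpoly R z = of_nat l ^ m * ((of_nat l * cpoly V z) * cpoly A z + (1 - z) ^ d * (cpoly U z * cpoly V z))"
      unfolding R by (simp add: algebra_simps)
    also have "\<dots> = of_nat l ^ m * ((1 - z) ^ d * cpoly h z)"
      unfolding lV by (simp add: h_def cpoly_simps algebra_simps)
    finally show ?thesis .
  qed
  have card: "card (prim_set l n) = e" by (simp add: card_prim_set[OF l n] e_def)
  have "?P (cpoly V) * ?P (cpoly R) = ?P (\<lambda>z. of_nat l ^ m * ((1 - z) ^ d * cpoly h z))"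
    unfolding prod.distrib[symmetric] by (rule prod.cong[OF refl]) (rule key, auto)
  also have "\<dots> = (of_nat l ^ m) ^ e * (of_nat l ^ d * ?P (cpoly h))"
    by (simp only: prod.distrib prod_constant card prod_power_distrib[symmetric] prod_prim_one_minus[OF l n, folded N_def])
  finally have PV: "?P (cpoly V) * ?P (cpoly R) = of_nat l ^ (m * e + d) * ?P (cpoly h)"
    by (simp add: power_mult power_add)
  \<comment> \<open>The full products at levels n and n - 1 are integers prime to l, and the
    primitive product is their quotient.\<close>
  have "\<exists>z z'. ?P (cpoly f) * of_int z' = of_int z \<and> \<not> int l dvd z \<and> \<not> int l dvd z'"
    if f1: "\<not> int l dvd poly f 1" for f
  proof -
    obtain z where z: "(\<Prod>k\<in>{0..<int (l ^ n)}. cpoly f (chi (l ^ n) k)) = of_int z" "\<not> int l dvd z"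
      using prod_roots_unity_coprime[OF l f1, of n] by blast
    obtain z' where z': "(\<Prod>k\<in>{0..<int (l ^ (n - 1))}. cpoly f (chi (l ^ (n - 1)) k)) = of_int z'" "\<not> int l dvd z'"
      using prod_roots_unity_coprime[OF l f1, of "n - 1"] by blast
    have "?P (cpoly f) * of_int z' = of_int z"
      using prod_split_prim[OF l n, of "cpoly f"] unfolding z(1) z'(1) N_def by (rule sym)
    then show ?thesis using z(2) z'(2) by blast
  qed
  from this[OF V1] this[OF h1] obtain zV zV' zh zh' where z:
    "?P (cpoly V) * of_int zV' = of_int zV" "\<not> int l dvd zV" "\<not> int l dvd zV'"
    "?P (cpoly h) * of_int zh' = of_int zh" "\<not> int l dvd zh" "\<not> int l dvd zh'" by blast
  have "of_int (zV * zh') * ?P (cpoly R) = (?P (cpoly V) * ?P (cpoly R)) * (of_int zV' * of_int zh')"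
    unfolding of_int_mult z(1)[symmetric] by (simp only: mult_ac)
  also have "\<dots> = of_nat l ^ (m * e + d) * ((?P (cpoly h) * of_int zh') * of_int zV')"
    unfolding PV by (simp only: mult_ac)
  also have "\<dots> = of_int (int l ^ (m * e + d) * (zh * zV'))" unfolding z(4) by simp
  finally have "of_int (zV * zh') * ?P (cpoly R) = of_int (int l ^ (m * e + d) * (zh * zV'))" .
  moreover have "\<not> int l dvd zV * zh'" "\<not> int l dvd zh * zV'"
    using z pr by (simp_all add: prime_dvd_mult_iff)
  ultimately show ?thesis unfolding N_def e_def by blast
qed

section \<open>The Laplacian of the derived multigraph\<close>

lemma laplacian_sym: "laplacian s t E x y = laplacian s t E y x"
  by (simp add: laplacian_def mult.commute)

lemma voltage_matrix_1: "voltage_matrix s t S \<alpha> (\<lambda>_. 1) i j = of_int (laplacian s t S i j)"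
  unfolding voltage_matrix_def laplacian_def of_int_sum
  by (rule sum.cong[OF refl]) (simp only: of_int_mult of_int_diff of_int_of_bool of_bool_conj, simp add: algebra_simps)

lemma set_det_laplacian:
  assumes "finite V" "V \<noteq> {}" "\<And>e. e \<in> E \<Longrightarrow> s e \<in> V \<and> t e \<in> V"
  shows "set_det V (laplacian s t E) = 0"
  using assms by (intro set_det_row_sums_zero laplacian_row_sum) auto

lemma set_det_laplacian_add_const:
  assumes "finite V" "r \<in> V" "\<And>e. e \<in> E \<Longrightarrow> s e \<in> V \<and> t e \<in> V"
  shows "set_det V (\<lambda>i j. of_int (laplacian s t E i j) + c)
    = c * of_nat (card V) ^ 2 * (of_int (set_det (V - {r}) (laplacian s t E)) :: 'a::field_char_0)"
proof -
  have rows: "(\<Sum>j\<in>V. of_int (laplacian s t E i j)) = (0::'a)" for i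
    using laplacian_row_sum[OF assms(1), of E s t i] assms(3) by (simp flip: of_int_sum)
  have "(\<Sum>i\<in>V. of_int (laplacian s t E i j)) = (0::'a)" for j
    using rows[of j] by (simp add: laplacian_sym[of s t E j])
  with rows show ?thesis
    using assms by (simp add: set_det_add_const set_det_of_int)
qed

text \<open>The coefficient at the group element \<tau> when the Laplacian of the derived multigraph
  is read as a matrix over the group ring of Z/N, indexed by the vertices of the base.\<close>

definition cyclic_coeff ::
  "nat \<Rightarrow> ('e \<Rightarrow> 'v) \<Rightarrow> ('e \<Rightarrow> 'v) \<Rightarrow> 'e set \<Rightarrow> ('e \<Rightarrow> int) \<Rightarrow> 'v \<Rightarrow> 'v \<Rightarrow> int \<Rightarrow> int" where
  "cyclic_coeff N s t S a i j \<tau> = (\<Sum>e\<in>S.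
     (of_bool (i = s e \<and> j = s e) + of_bool (i = t e \<and> j = t e)) * of_bool (\<tau> = 0)
     - of_bool (i = s e \<and> j = t e) * of_bool (\<tau> = a e)
     - of_bool (i = t e \<and> j = s e) * of_bool (\<tau> = (- a e) mod int N))"

lemma mod_eq_shift_iff:
  assumes "0 \<le> \<sigma>" "\<sigma> < (N::int)" "0 \<le> \<tau>" "\<tau> < N"
  shows "\<tau> = (\<sigma> + a) mod N \<longleftrightarrow> (\<tau> - \<sigma>) mod N = a mod N"
proof -
  have "\<tau> = (\<sigma> + a) mod N \<longleftrightarrow> \<tau> mod N = (\<sigma> + a) mod N" using assms by simp
  also have "\<dots> \<longleftrightarrow> (\<tau> - \<sigma>) mod N = a mod N" by (simp add: mod_eq_dvd_iff algebra_simps)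
  finally show ?thesis .
qed

lemma laplacian_derived:
  assumes S: "finite S" and a: "\<And>e. e \<in> S \<Longrightarrow> 0 \<le> a e \<and> a e < int N"
    and \<sigma>: "\<sigma> \<in> {0..<int N}" and \<tau>: "\<tau> \<in> {0..<int N}"
    and s': "\<And>e \<rho>. e \<in> S \<Longrightarrow> \<rho> \<in> {0..<int N} \<Longrightarrow> s' (e, \<rho>) = (s e, \<rho>)"
    and t': "\<And>e \<rho>. e \<in> S \<Longrightarrow> \<rho> \<in> {0..<int N} \<Longrightarrow> t' (e, \<rho>) = (t e, (\<rho> + a e) mod int N)"
  shows "laplacian s' t' (S \<times> {0..<int N}) (i, \<sigma>) (j, \<tau>) = cyclic_coeff N s t S a i j ((\<tau> - \<sigma>) mod int N)"
proof -
  let ?Z = "{0..<int N}"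
  have N: "int N > 0" using \<sigma> by auto
  have "laplacian s' t' (S \<times> ?Z) (i, \<sigma>) (j, \<tau>) = (\<Sum>e\<in>S. \<Sum>\<rho>\<in>?Z.
      (of_bool (i = s e) * of_bool (\<sigma> = \<rho>) - of_bool (i = t e) * of_bool (\<sigma> = (\<rho> + a e) mod int N))
    * (of_bool (j = s e) * of_bool (\<tau> = \<rho>) - of_bool (j = t e) * of_bool (\<tau> = (\<rho> + a e) mod int N)))"
    unfolding laplacian_def sum.cartesian_product
    by (rule sum.cong[OF refl]) (clarsimp simp: s' t' of_bool_conj)
  also have "\<dots> = cyclic_coeff N s t S a i j ((\<tau> - \<sigma>) mod int N)"
    unfolding cyclic_coeff_def
  proof (rule sum.cong[OF refl])
    fix e assume e: "e \<in> S"
    define b where "b = a e"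
    have b: "0 \<le> b" "b < int N" using a[OF e] by (auto simp: b_def)
    have shift: "\<sigma>' = (\<rho> + b) mod int N \<longleftrightarrow> \<rho> = (\<sigma>' - b) mod int N"
      if "\<sigma>' \<in> ?Z" "\<rho> \<in> ?Z" for \<sigma>' \<rho>
      using that by (auto simp: mod_simps)
    have d1: "(\<Sum>\<rho>\<in>?Z. of_bool (\<sigma>' = \<rho>) * f \<rho>) = f \<sigma>'" if "\<sigma>' \<in> ?Z" for \<sigma>' and f :: "int \<Rightarrow> int"
    proof -
      have "(\<Sum>\<rho>\<in>?Z. of_bool (\<sigma>' = \<rho>) * f \<rho>) = (\<Sum>\<rho>\<in>?Z. if \<rho> = \<sigma>' then f \<sigma>' else 0)"
        by (rule sum.cong) auto
      then show ?thesis using that by (simp add: sum.delta)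
    qed
    have d2: "(\<Sum>\<rho>\<in>?Z. of_bool (\<sigma>' = (\<rho> + b) mod int N) * f \<rho>) = f ((\<sigma>' - b) mod int N)"
      if "\<sigma>' \<in> ?Z" for \<sigma>' and f :: "int \<Rightarrow> int"
    proof -
      have "(\<Sum>\<rho>\<in>?Z. of_bool (\<sigma>' = (\<rho> + b) mod int N) * f \<rho>)
          = (\<Sum>\<rho>\<in>?Z. of_bool ((\<sigma>' - b) mod int N = \<rho>) * f \<rho>)"
        using shift[OF that] by (intro sum.cong) auto
      also have "\<dots> = f ((\<sigma>' - b) mod int N)" by (rule d1) (use N in simp)
      finally show ?thesis .
    qed
    have alg: "x1 * (y1 * p - y2 * q) - x2 * (y1 * r - y2 * p) = (x1 * y1 + x2 * y2) * p - x1 * y2 * q - x2 * y1 * r"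
      for x1 x2 y1 y2 p q r :: int by (simp add: algebra_simps)
    have unshift: "((\<sigma>' - b) mod int N + b) mod int N = \<sigma>'" if "\<sigma>' \<in> ?Z" for \<sigma>'
      using that by (simp add: mod_simps)
    have eq: "\<tau> = \<sigma> \<longleftrightarrow> (\<tau> - \<sigma>) mod int N = 0"
      using mod_eq_shift_iff[of \<sigma> "int N" \<tau> 0] \<sigma> \<tau> by simp
    have eqb: "\<tau> = (\<sigma> + b) mod int N \<longleftrightarrow> (\<tau> - \<sigma>) mod int N = b"
      using mod_eq_shift_iff[of \<sigma> "int N" \<tau> b] \<sigma> \<tau> b by simp
    have eqc: "\<tau> = (\<sigma> - b) mod int N \<longleftrightarrow> (\<tau> - \<sigma>) mod int N = (- b) mod int N"
      using mod_eq_shift_iff[of \<sigma> "int N" \<tau> "- b"] \<sigma> \<tau> by simp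
    have "(\<Sum>\<rho>\<in>?Z. (of_bool (i = s e) * of_bool (\<sigma> = \<rho>) - of_bool (i = t e) * of_bool (\<sigma> = (\<rho> + b) mod int N) :: int)
        * (of_bool (j = s e) * of_bool (\<tau> = \<rho>) - of_bool (j = t e) * of_bool (\<tau> = (\<rho> + b) mod int N)))
      = (\<Sum>\<rho>\<in>?Z. of_bool (\<sigma> = \<rho>) * (of_bool (i = s e) * (of_bool (j = s e) * of_bool (\<tau> = \<rho>) - of_bool (j = t e) * of_bool (\<tau> = (\<rho> + b) mod int N))))
      - (\<Sum>\<rho>\<in>?Z. of_bool (\<sigma> = (\<rho> + b) mod int N) * (of_bool (i = t e) * (of_bool (j = s e) * of_bool (\<tau> = \<rho>) - of_bool (j = t e) * of_bool (\<tau> = (\<rho> + b) mod int N))))"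
      by (subst sum_subtractf[symmetric], rule sum.cong[OF refl]) (simp add: algebra_simps)
    also have "\<dots> = of_bool (i = s e) * (of_bool (j = s e) * of_bool (\<tau> = \<sigma>) - of_bool (j = t e) * of_bool (\<tau> = (\<sigma> + b) mod int N))
      - of_bool (i = t e) * (of_bool (j = s e) * of_bool (\<tau> = (\<sigma> - b) mod int N) - of_bool (j = t e) * of_bool (\<tau> = \<sigma>))"
      by (simp only: d1[OF \<sigma>] d2[OF \<sigma>] unshift[OF \<sigma>])
    also have "\<dots> = (of_bool (i = s e \<and> j = s e) + of_bool (i = t e \<and> j = t e)) * of_bool ((\<tau> - \<sigma>) mod int N = 0)
     - of_bool (i = s e \<and> j = t e) * of_bool ((\<tau> - \<sigma>) mod int N = b)
     - of_bool (i = t e \<and> j = s e) * of_bool ((\<tau> - \<sigma>) mod int N = (- b) mod int N)"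
      unfolding eq eqb eqc of_bool_conj by (rule alg)
    finally show "(\<Sum>\<rho>\<in>?Z. (of_bool (i = s e) * of_bool (\<sigma> = \<rho>) - of_bool (i = t e) * of_bool (\<sigma> = (\<rho> + a e) mod int N) :: int)
        * (of_bool (j = s e) * of_bool (\<tau> = \<rho>) - of_bool (j = t e) * of_bool (\<tau> = (\<rho> + a e) mod int N)))
      = (of_bool (i = s e \<and> j = s e) + of_bool (i = t e \<and> j = t e)) * of_bool ((\<tau> - \<sigma>) mod int N = 0)
     - of_bool (i = s e \<and> j = t e) * of_bool ((\<tau> - \<sigma>) mod int N = a e)
     - of_bool (i = t e \<and> j = s e) * of_bool ((\<tau> - \<sigma>) mod int N = (- a e) mod int N)"
      unfolding b_def .
  qed
  finally show ?thesis .
qed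

text \<open>A character turns group elements into roots of unity. The weight \<open>w\<close> is
  tied to it only at voltages that occur and their negatives, so powers with approximated exponents
  qualify.\<close>

lemma sum_cyclic_coeff:
  assumes N: "N > 0" and a: "\<And>e. e \<in> S \<Longrightarrow> 0 \<le> a e \<and> a e < int N"
    and w: "\<And>e. e \<in> S \<Longrightarrow> w (\<alpha> e) = chi N (k * a e)" "\<And>e. e \<in> S \<Longrightarrow> w (- \<alpha> e) = chi N (k * (- a e))"
  shows "(\<Sum>\<tau>\<in>{0..<int N}. of_int (cyclic_coeff N s t S a i j \<tau>) * chi N (k * \<tau>)) = voltage_matrix s t S \<alpha> w i j"
proof -
  let ?Z = "{0..<int N}"
  have pick: "(\<Sum>\<tau>\<in>?Z. of_bool (\<tau> = b) * chi N (k * \<tau>)) = chi N (k * b)" if "b \<in> ?Z" for b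
  proof -
    have "(\<Sum>\<tau>\<in>?Z. of_bool (\<tau> = b) * chi N (k * \<tau>)) = (\<Sum>\<tau>\<in>?Z. if \<tau> = b then chi N (k * b) else 0)"
      by (rule sum.cong) auto
    then show ?thesis using that by (simp add: sum.delta)
  qed
  have "(\<Sum>\<tau>\<in>?Z. of_int (cyclic_coeff N s t S a i j \<tau>) * chi N (k * \<tau>))
    = (\<Sum>e\<in>S. \<Sum>\<tau>\<in>?Z. ((of_bool (i = s e \<and> j = s e) + of_bool (i = t e \<and> j = t e)) * of_bool (\<tau> = 0)
     - of_bool (i = s e \<and> j = t e) * of_bool (\<tau> = a e)
     - of_bool (i = t e \<and> j = s e) * of_bool (\<tau> = (- a e) mod int N)) * chi N (k * \<tau>))"
    unfolding cyclic_coeff_def of_int_sum of_int_mult of_int_diff of_int_add of_int_of_bool sum_distrib_right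
    by (rule sum.swap)
  also have "\<dots> = voltage_matrix s t S \<alpha> w i j"
    unfolding voltage_matrix_def
  proof (rule sum.cong[OF refl])
    fix e assume e: "e \<in> S"
    have "(\<Sum>\<tau>\<in>?Z. ((of_bool (i = s e \<and> j = s e) + of_bool (i = t e \<and> j = t e)) * of_bool (\<tau> = 0)
     - of_bool (i = s e \<and> j = t e) * of_bool (\<tau> = a e)
     - of_bool (i = t e \<and> j = s e) * of_bool (\<tau> = (- a e) mod int N)) * chi N (k * \<tau>))
     = (of_bool (i = s e \<and> j = s e) + of_bool (i = t e \<and> j = t e)) * (\<Sum>\<tau>\<in>?Z. of_bool (\<tau> = 0) * chi N (k * \<tau>))
     - of_bool (i = s e \<and> j = t e) * (\<Sum>\<tau>\<in>?Z. of_bool (\<tau> = a e) * chi N (k * \<tau>))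
     - of_bool (i = t e \<and> j = s e) * (\<Sum>\<tau>\<in>?Z. of_bool (\<tau> = (- a e) mod int N) * chi N (k * \<tau>))"
      by (simp only: left_diff_distrib sum_subtractf sum_distrib_left mult.assoc)
    also have "\<dots> = of_bool (i = s e \<and> j = s e) + of_bool (i = t e \<and> j = t e)
     - of_bool (i = s e \<and> j = t e) * w (\<alpha> e) - of_bool (i = t e \<and> j = s e) * w (- \<alpha> e)"
      using N a[OF e] by (simp add: pick w[OF e] chi_mod[OF N])
    finally show "(\<Sum>\<tau>\<in>?Z. ((of_bool (i = s e \<and> j = s e) + of_bool (i = t e \<and> j = t e)) * of_bool (\<tau> = 0)
     - of_bool (i = s e \<and> j = t e) * of_bool (\<tau> = a e)
     - of_bool (i = t e \<and> j = s e) * of_bool (\<tau> = (- a e) mod int N)) * chi N (k * \<tau>))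
     = of_bool (i = s e \<and> j = s e) + of_bool (i = t e \<and> j = t e)
     - of_bool (i = s e \<and> j = t e) * w (\<alpha> e) - of_bool (i = t e \<and> j = s e) * w (- \<alpha> e)" .
  qed
  finally show ?thesis .
qed

text \<open>The formula is exact for every \<open>K \<ge> n\<close>. This leaves \<open>K\<close>
  free to be raised until the coefficients of the polynomial approximate those of
  \<open>Q\<close>.\<close>

lemma (in multigraph) derived_spanning_trees:
  fixes \<alpha> :: "'e \<Rightarrow> 'p::prime_card padic_int"
  assumes \<omega>: "edge_section X rv \<omega>" "S = \<omega> ` undirected_edges X rv" and r: "r \<in> verts X" and K: "n \<le> K"
  defines "N \<equiv> CARD('p) ^ n"
  defines "Y \<equiv> derived_graph X rv S (integer_mod_group N) (\<lambda>s. padic_residue n (\<alpha> s))"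
  defines "rv' \<equiv> derived_inv rv (integer_mod_group N)"
  shows "of_nat N * of_nat (card (spanning_trees Y rv')) =
      of_int (set_det (verts X - {r}) (laplacian (tail X) (head X) S))
      * (\<Prod>k\<in>{1..<int N}. cpoly (approx_poly (verts X) (tail X) (head X) S \<alpha> K) (chi N k))"
    and "Digraph_Component.connected Y \<Longrightarrow> card (spanning_trees Y rv') > 0"
proof -
  let ?Z = "{0..<int N}" and ?V = "verts X" and ?L = "laplacian (tail X) (head X) S"
  let ?G = "integer_mod_group N" and ?a = "\<lambda>s. padic_residue n (\<alpha> s)"
  note orient = edge_section_mem[OF \<omega>]
  have N: "N > 0" using prime_gt_0_nat[OF prime_card[where 'a='p]] by (simp add: N_def)
  have carrier: "carrier ?G = ?Z" using N by (simp add: carrier_integer_mod_group)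
  have S: "S \<subseteq> arcs X" using \<omega> by (auto simp: edge_section_def)
  have finS: "finite S" using S finite_subset[OF _ finite_arcs] by blast
  have a: "0 \<le> ?a e \<and> ?a e < int N" for e
    using padic_seq_range[of "\<alpha> e" n] by (simp add: padic_residue_def N_def)
  have Y: "multigraph Y rv'"
    unfolding Y_def rv'_def
    by (rule multigraph_derived_graph[OF _ _ \<omega>]) (use a in \<open>auto simp: carrier\<close>)
  interpret Y: multigraph Y rv' by fact
  have S': "S \<times> ?Z \<subseteq> arcs Y" using S by (auto simp: Y_def derived_graph_def carrier)
  have orient': "rv' e \<in> S \<times> ?Z \<longleftrightarrow> e \<notin> S \<times> ?Z" if "e \<in> arcs Y" for e
    using that orient by (auto simp: Y_def rv'_def derived_graph_def derived_inv_def carrier)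
  have vY: "verts Y = ?V \<times> ?Z" by (simp add: Y_def derived_graph_def carrier)
  have r': "(r, 0) \<in> verts Y" using r N by (simp add: vY)
  show "card (spanning_trees Y rv') > 0" if "Digraph_Component.connected Y"
    by (rule Y.spanning_trees_pos[OF S' orient' r' that])
  let ?LY = "laplacian (tail Y) (head Y) (S \<times> ?Z)"
  define c where "c i j \<tau> = (of_int (cyclic_coeff N (tail X) (head X) S ?a i j \<tau>) + 1 :: complex)" for i j \<tau>
  define R where "R = approx_poly ?V (tail X) (head X) S \<alpha> K"
  define M where "M k = voltage_matrix (tail X) (head X) S \<alpha> (\<lambda>x. chi N k ^ padic_approx K x)" for k
  have fin: "finite (?V \<times> ?Z)" by simp
  have endsY: "tail Y e \<in> ?V \<times> ?Z \<and> head Y e \<in> ?V \<times> ?Z" if "e \<in> S \<times> ?Z" for e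
    using Y.wellformed[of e] S' that vY by blast
  have LY: "of_int (?LY x y) + 1 = (\<lambda>(i, \<sigma>) (j, \<tau>). c i j ((\<tau> - \<sigma>) mod int N)) x y"
    if xy: "x \<in> ?V \<times> ?Z" "y \<in> ?V \<times> ?Z" for x y
  proof -
    obtain i \<sigma> j \<tau> where xy': "x = (i, \<sigma>)" "y = (j, \<tau>)" "\<sigma> \<in> ?Z" "\<tau> \<in> ?Z" using xy by auto
    have "?LY (i, \<sigma>) (j, \<tau>) = cyclic_coeff N (tail X) (head X) S ?a i j ((\<tau> - \<sigma>) mod int N)"
      by (rule laplacian_derived[OF finS a xy'(3,4)]) (simp_all add: Y_def derived_graph_def)
    then show ?thesis by (simp add: xy' c_def)
  qed
  have "of_nat (card (?V \<times> ?Z)) ^ 2 * of_nat (card (spanning_trees Y rv'))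
      = of_nat (card (?V \<times> ?Z)) ^ 2 * (of_int (set_det (?V \<times> ?Z - {(r, 0)}) ?LY) :: complex)"
    using Y.matrix_tree[OF S' orient' r'] by (metis vY of_int_of_nat_eq)
  also have "\<dots> = set_det (?V \<times> ?Z) (\<lambda>x y. of_int (?LY x y) + 1)"
    by (subst set_det_laplacian_add_const[OF fin r'[unfolded vY] endsY]) simp_all
  also have "\<dots> = set_det (?V \<times> ?Z) (\<lambda>(i, \<sigma>) (j, \<tau>). c i j ((\<tau> - \<sigma>) mod int N))"
    by (rule set_det_cong[OF fin LY])
  also have "\<dots> = (\<Prod>k\<in>?Z. set_det ?V (\<lambda>i j. \<Sum>\<tau>\<in>?Z. c i j \<tau> * chi N (k * \<tau>)))"
    by (rule set_det_circulant[OF N]) simp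
  \<comment> \<open>The all-one matrix transforms to \<open>N\<close> in the block
    \<open>k = 0\<close> and to zero elsewhere. In that block all weights are 1, so
    \<open>M 0\<close> is the Laplacian of the base.\<close>
  also have "\<dots> = (\<Prod>k\<in>?Z. set_det ?V (\<lambda>i j. M k i j + (if k = 0 then of_nat N else 0)))"
  proof (rule prod.cong[OF refl], rule set_det_cong)
    fix k i j assume k: "k \<in> ?Z"
    \<comment> \<open>Exponents matter only modulo \<open>N\<close>, and the residue modulo l^K
      determines the one modulo l^n.\<close>
    have w: "chi N k ^ padic_approx K x = chi N (k * padic_residue n x)" for x :: "'p padic_int"
    proof -
      have "padic_residue K x mod int N = padic_residue n x"
        using padic_mod[OF K, of x] by (simp add: padic_residue_def N_def)
      then show ?thesis using chi_mod[OF N, of k "padic_residue K x"] by (simp add: chi_power int_padic_approx)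
    qed
    have neg: "chi N (k * padic_residue n (- x)) = chi N (k * - padic_residue n x)" for x :: "'p padic_int"
      using chi_mod[OF N, of k "- padic_residue n x"] by (simp add: padic_residue_def uminus_padic_int.rep_eq N_def)
    have "(\<Sum>\<tau>\<in>?Z. c i j \<tau> * chi N (k * \<tau>))
      = (\<Sum>\<tau>\<in>?Z. of_int (cyclic_coeff N (tail X) (head X) S ?a i j \<tau>) * chi N (k * \<tau>)) + (\<Sum>\<tau>\<in>?Z. chi N (\<tau> * k))"
      unfolding c_def by (simp add: distrib_right sum.distrib mult.commute[of k])
    also have "(\<Sum>\<tau>\<in>?Z. of_int (cyclic_coeff N (tail X) (head X) S ?a i j \<tau>) * chi N (k * \<tau>)) = M k i j"
      unfolding M_def by (rule sum_cyclic_coeff[OF N a]) (simp_all only: w neg)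
    also have "(\<Sum>\<tau>\<in>?Z. chi N (\<tau> * k)) = (if k = 0 then of_nat N else 0)"
    proof -
      have "int N dvd k \<longleftrightarrow> k = 0" using k by (auto dest: zdvd_imp_le)
      then show ?thesis by (simp add: sum_chi[OF N])
    qed
    finally show "(\<Sum>\<tau>\<in>?Z. c i j \<tau> * chi N (k * \<tau>)) = M k i j + (if k = 0 then of_nat N else 0)" .
  qed simp
  also have "(\<Prod>k\<in>?Z. set_det ?V (\<lambda>i j. M k i j + (if k = 0 then of_nat N else 0)))
     = set_det ?V (\<lambda>i j. M 0 i j + of_nat N) * (\<Prod>k\<in>{1..<int N}. set_det ?V (M k))"
  proof -
    have "?Z = insert 0 {1..<int N}" using N by auto
    then show ?thesis by (simp only:) (subst prod.insert, auto intro!: prod.cong)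
  qed
  also have "set_det ?V (\<lambda>i j. M 0 i j + of_nat N) = of_nat N * of_nat (card ?V) ^ 2 * of_int (set_det (?V - {r}) ?L)"
    unfolding M_def using S r by (simp add: voltage_matrix_1) (subst set_det_laplacian_add_const[of _ r], auto)
  also have "(\<Prod>k\<in>{1..<int N}. set_det ?V (M k)) = (\<Prod>k\<in>{1..<int N}. cpoly R (chi N k))"
    unfolding R_def M_def by (simp add: poly_approx_poly)
  finally have "of_nat (card ?V) ^ 2 * of_nat N * (of_nat N * of_nat (card (spanning_trees Y rv')))
    = of_nat (card ?V) ^ 2 * of_nat N * (of_int (set_det (?V - {r}) ?L) * (\<Prod>k\<in>{1..<int N}. cpoly R (chi N k)))"
    by (simp add: power2_eq_square mult_ac)
  \<comment> \<open>With g vertices in the base, (g N)^2 on the left meets N g^2 from the block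
    \<open>k = 0\<close>; cancelling the latter leaves one factor \<open>N\<close>.\<close>
  moreover have "of_nat (card ?V) ^ 2 * of_nat N \<noteq> (0 :: complex)" using N r by (auto simp: card_eq_0_iff)
  ultimately show "of_nat N * of_nat (card (spanning_trees Y rv')) =
      of_int (set_det (verts X - {r}) (laplacian (tail X) (head X) S))
      * (\<Prod>k\<in>{1..<int N}. cpoly (approx_poly (verts X) (tail X) (head X) S \<alpha> K) (chi N k))"
    unfolding R_def by (simp only: mult_cancel_left) simp
qed

section \<open>Growth of the number of spanning trees from one level to the next\<close>

lemma prod_prim_of_level_products:
  fixes f :: "complex \<Rightarrow> complex"
  assumes l: "prime (l::nat)" and n: "n > 0"
    and \<kappa>: "of_nat (l ^ n) * of_nat \<kappa> = D * (\<Prod>k\<in>{1..<int (l ^ n)}. f (chi (l ^ n) k))"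
    and \<kappa>': "of_nat (l ^ (n - 1)) * of_nat \<kappa>' = D * (\<Prod>k\<in>{1..<int (l ^ (n - 1))}. f (chi (l ^ (n - 1)) k))"
  shows "of_nat l * of_nat \<kappa> = of_nat \<kappa>' * (\<Prod>k\<in>prim_set l n. f (chi (l ^ n) k))"
proof -
  \<comment> \<open>The level formulas omit the root 1, whereas \<open>prod_split_prim\<close> runs
    over all roots; the value 1 there reconciles them.\<close>
  define g where "g z = (if z = 1 then 1 else f z)" for z
  have ne: "chi N k \<noteq> 1" if "k \<in> {1..<int N}" for k N
    using that by (subst chi_eq_1_iff) (auto dest: zdvd_imp_le)
  have level: "(\<Prod>k\<in>{0..<int N}. g (chi N k)) = (\<Prod>k\<in>{1..<int N}. f (chi N k))" if "N > 0" for N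
  proof -
    have "{0..<int N} = insert 0 {1..<int N}" using that by auto
    then have "(\<Prod>k\<in>{0..<int N}. g (chi N k)) = g (chi N 0) * (\<Prod>k\<in>{1..<int N}. g (chi N k))" by simp
    also have "(\<Prod>k\<in>{1..<int N}. g (chi N k)) = (\<Prod>k\<in>{1..<int N}. f (chi N k))"
      by (rule prod.cong[OF refl]) (simp add: g_def ne)
    finally show ?thesis by (simp add: g_def)
  qed
  have "prim_set l n \<subseteq> {1..<int (l ^ n)}"
  proof
    fix k assume k: "k \<in> prim_set l n"
    then have "k \<noteq> 0" "k \<in> {0..<int (l ^ n)}" by (auto simp: prim_set_def)
    then show "k \<in> {1..<int (l ^ n)}" by simp
  qed
  then have prim: "(\<Prod>k\<in>prim_set l n. g (chi (l ^ n) k)) = (\<Prod>k\<in>prim_set l n. f (chi (l ^ n) k))"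
    by (intro prod.cong[OF refl]) (use ne in \<open>auto simp: g_def\<close>)
  have pos: "l ^ i > 0" for i using prime_gt_0_nat[OF l] by simp
  have pn: "l ^ n = l ^ (n - 1) * l" using n by (cases n) simp_all
  have "of_nat (l ^ (n - 1)) * (of_nat l * of_nat \<kappa>) = of_nat (l ^ n) * (of_nat \<kappa> :: complex)"
    unfolding pn by (simp only: of_nat_mult mult.assoc)
  also have "\<dots> = D * ((\<Prod>k\<in>prim_set l n. f (chi (l ^ n) k)) * (\<Prod>k\<in>{1..<int (l ^ (n - 1))}. f (chi (l ^ (n - 1)) k)))"
    unfolding \<kappa> level[OF pos, symmetric] prim[symmetric] prod_split_prim[OF l n] ..
  also have "\<dots> = (D * (\<Prod>k\<in>{1..<int (l ^ (n - 1))}. f (chi (l ^ (n - 1)) k))) * (\<Prod>k\<in>prim_set l n. f (chi (l ^ n) k))"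
    by (simp only: mult_ac)
  also have "\<dots> = of_nat (l ^ (n - 1)) * (of_nat \<kappa>' * (\<Prod>k\<in>prim_set l n. f (chi (l ^ n) k)))"
    unfolding \<kappa>'[symmetric] by (simp only: mult.assoc)
  finally show ?thesis using prime_gt_0_nat[OF l] by simp
qed

text \<open>At T = 0 every weight 1 - Q_a is 1, and the matrix becomes the Laplacian of the base,
  which is singular.\<close>

lemma fps_nth_0_voltage_det:
  fixes \<alpha> :: "'e \<Rightarrow> 'p::prime_card padic_int"
  assumes "finite V" "V \<noteq> {}" "\<And>e. e \<in> S \<Longrightarrow> s e \<in> V \<and> t e \<in> V"
  shows "fps_nth (set_det V (voltage_matrix s t S \<alpha> (\<lambda>a. 1 - Q_series a))) 0 = 0"
proof -
  have "fps_nth (set_det V (voltage_matrix s t S \<alpha> (\<lambda>a. 1 - Q_series a))) 0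
      = set_det V (voltage_matrix s t S \<alpha> (\<lambda>_. 1 :: 'p padic_int))"
    by (rule voltage_det_rel[where R = "\<lambda>x y. fps_nth x 0 = y"]) (auto simp: assms Q_series_def)
  also have "voltage_matrix s t S \<alpha> (\<lambda>_. 1 :: 'p padic_int) = (\<lambda>i j. of_int (laplacian s t S i j))"
    by (intro ext voltage_matrix_1)
  also have "set_det V \<dots> = 0"
    using assms by (simp add: set_det_of_int[symmetric] set_det_laplacian)
  finally show ?thesis .
qed

theorem theorem6p1:
  fixes X :: "('v, 'e) pre_digraph" and rv :: "'e \<Rightarrow> 'e" and \<omega> :: "'e set \<Rightarrow> 'e" and S :: "'e set"
    and \<alpha> :: "'e \<Rightarrow> 'p::prime_card padic_int"
    and l g t lam :: nat and vs :: "nat \<Rightarrow> 'v" and b :: "nat \<Rightarrow> 'p padic_int"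
    and Q :: "'p padic_int fps" and \<mu> :: enat and \<kappa> :: "nat \<Rightarrow> nat"
    and G :: "nat \<Rightarrow> int monoid" and \<alpha>' :: "nat \<Rightarrow> 'e \<Rightarrow> int"
  assumes "l = CARD('p)"
    and "multigraph X rv" and "Digraph_Component.connected X" and "euler_char X rv \<noteq> 0"
    and "edge_section X rv \<omega>" and "S = \<omega> ` undirected_edges X rv"
    and "\<And>n. G n = integer_mod_group (l ^ n)"
    and "\<And>n s. \<alpha>' n s = padic_residue n (\<alpha> s)"
    and "\<And>n. n \<ge> 1 \<Longrightarrow> Digraph_Component.connected (derived_graph X rv S (G n) (\<alpha>' n))"
    and "bij_betw vs {..<g} (verts X)"
    and "bij_betw b {..<t} (\<alpha> ` S)"
    and "Q = eval_xy (case_sum (\<lambda>y. Q_series (b y)) (\<lambda>y. Q_series (- b y)))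
               (voltage_poly X S \<alpha> g vs t b)"
    and "\<mu> = (INF j\<in>{1..}. padic_val (fps_nth Q j))"
    and "lam = (LEAST j. j \<ge> 1 \<and> padic_val (fps_nth Q j) = \<mu>) - 1"
    and "\<And>n. \<kappa> n = card (spanning_trees (derived_graph X rv S (G n) (\<alpha>' n)) (derived_inv rv (G n)))"
  shows "fps_nth Q 0 = 0 \<and> \<mu> \<noteq> \<infinity> \<and>
    (\<exists>(n0::nat) (\<nu>::int). \<forall>n\<ge>n0.
       int (multiplicity l (\<kappa> n)) = int (the_enat \<mu>) * int l ^ n + int lam * int n + \<nu>)"
proof -
  note l = assms(1) and conn = assms(3) and \<omega> = assms(5,6)
  interpret multigraph X rv by fact
  note orient = edge_section_mem[OF \<omega>]
  have S: "S \<subseteq> arcs X" using \<omega> by (auto simp: edge_section_def)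
  have finS: "finite S" using S finite_subset[OF _ finite_arcs] by blast
  have ends: "tail X e \<in> verts X \<and> head X e \<in> verts X" if "e \<in> S" for e
    using that S by auto
  have pl: "prime l" unfolding l by (rule prime_card)
  have pr: "prime (int l)" using pl by simp
  have V0: "verts X \<noteq> {}" using conn connected_iff_edge_rel[OF wf_digraph] by simp
  then obtain r where r: "r \<in> verts X" by blast
  let ?w = "set_det (verts X) (voltage_matrix (tail X) (head X) S \<alpha> (\<lambda>a. 1 - Q_series a))"
  have Q: "Q = ?w" unfolding assms(12) by (rule eval_voltage_poly[OF S orient assms(10,11)])
  have Q0: "fps_nth Q 0 = 0"
    unfolding Q by (rule fps_nth_0_voltage_det) (use V0 ends in auto)
  define R where "R = approx_poly (verts X) (tail X) (head X) S \<alpha>"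
  have \<alpha>': "\<alpha>' n = (\<lambda>s. padic_residue n (\<alpha> s))" for n using assms(8) by auto
  have \<kappa>_eq: "of_nat (l ^ n) * of_nat (\<kappa> n) = of_int (set_det (verts X - {r}) (laplacian (tail X) (head X) S))
      * (\<Prod>k\<in>{1..<int (l ^ n)}. cpoly (R K) (chi (l ^ n) k))" if "n \<le> K" for n K
    unfolding assms(15) assms(7) \<alpha>' R_def l by (rule derived_spanning_trees(1)[OF \<omega> r that])
  have \<kappa>_pos: "\<kappa> n > 0" if "n \<ge> 1" for n
    using derived_spanning_trees(2)[OF \<omega> r le_refl, of n \<alpha>] assms(9)[OF that]
    unfolding assms(15) assms(7) \<alpha>' l by simp
  have step: "of_nat l * of_nat (\<kappa> n) = of_nat (\<kappa> (n - 1)) * (\<Prod>k\<in>prim_set l n. cpoly (R K) (chi (l ^ n) k))"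
    if "n \<ge> 1" "n \<le> K" for n K
    by (rule prod_prim_of_level_products[OF pl _ \<kappa>_eq \<kappa>_eq]) (use that in auto)
  have approx: "\<exists>K\<ge>n. \<forall>k<J. of_nat l ^ M dvd fps_nth Q k - of_int (coeff (R K \<circ>\<^sub>p [:1, -1:]) k)" for n J M
  proof -
    obtain K0 where "\<forall>K\<ge>K0. \<forall>k<J. of_nat l ^ M dvd fps_nth Q k - of_int (coeff (R K \<circ>\<^sub>p [:1, -1:]) k)"
      using voltage_det_approx[OF finite_verts finS, of J M "tail X" "head X" \<alpha>] unfolding Q R_def l by blast
    then show ?thesis by (intro exI[of _ "max n K0"]) simp
  qed
  have transfer: "int l ^ M dvd coeff p k \<longleftrightarrow> of_nat l ^ M dvd fps_nth Q k"
    if "of_nat l ^ M' dvd fps_nth Q k - of_int (coeff p k)" "M \<le> M'" for M M' k p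
  proof -
    have "(of_nat l ^ M :: 'p padic_int) dvd of_nat l ^ M'" using that(2) by (rule le_imp_power_dvd)
    then have d: "of_nat l ^ M dvd fps_nth Q k - of_int (coeff p k)" using that(1) dvd_trans by blast
    have "int l ^ M dvd coeff p k \<longleftrightarrow> of_nat l ^ M dvd (of_int (coeff p k) :: 'p padic_int)"
      unfolding l by (rule padic_pow_dvd_of_int_iff[symmetric])
    also have "\<dots> \<longleftrightarrow> of_nat l ^ M dvd fps_nth Q k"
      using dvd_add_right_iff[OF d, of "of_int (coeff p k)"] by simp
    finally show ?thesis .
  qed
  have \<mu>_le: "\<mu> \<le> padic_val (fps_nth Q j)" if "j \<ge> 1" for j
    unfolding assms(13) using that by (intro INF_lower) simp
  have \<mu>_dvd: "of_nat l ^ M dvd fps_nth Q j" if "enat M \<le> \<mu>" for M j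
  proof (cases "j = 0")
    case False
    then have "enat M \<le> padic_val (fps_nth Q j)" using \<mu>_le[of j] that order_trans by fastforce
    then show ?thesis unfolding padic_val_ge_iff l .
  qed (simp add: Q0)
  have \<mu>: "\<mu> \<noteq> \<infinity>"
  proof
    assume inf: "\<mu> = \<infinity>"
    \<comment> \<open>If all coefficients of \<open>Q\<close> vanish, level 1 makes l l \<kappa>(1)
      divisible by every power of l. Taking that positive number itself as the exponent M
      contradicts M < l^M.\<close>
    define M where "M = l * (l * \<kappa> 1)"
    obtain K where K: "K \<ge> 1" "\<forall>k<l * M. of_nat l ^ M dvd fps_nth Q k - of_int (coeff (R K \<circ>\<^sub>p [:1, -1:]) k)"
      using approx[of 1 "l * M" M] by blast
    have "int l ^ M dvd coeff (R K \<circ>\<^sub>p [:1, -1:]) j" if "j < l * M" for j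
      using transfer[of M j "R K \<circ>\<^sub>p [:1, -1:]" M] K(2) that \<mu>_dvd[of M j] inf by simp
    then obtain z where z: "of_nat l * (\<Prod>k\<in>prim_set l 1. cpoly (R K) (chi (l ^ 1) k)) = of_int (int l ^ M * z)"
      using prod_prim_dvd[OF pl, of M "R K"] by blast
    have "(of_int (int M) :: complex) = of_nat l * (of_nat l * of_nat (\<kappa> 1))" by (simp add: M_def)
    also have "\<dots> = of_nat (\<kappa> 0) * (of_nat l * (\<Prod>k\<in>prim_set l 1. cpoly (R K) (chi (l ^ 1) k)))"
      using step[of 1 K] K(1) by (simp only: le_refl diff_self_eq_0 mult_ac)
    also have "\<dots> = of_int (int (\<kappa> 0) * (int l ^ M * z))" unfolding z by simp
    finally have "int M = int l ^ M * (int (\<kappa> 0) * z)" by (simp only: of_int_eq_iff mult_ac)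
    then have "int (l ^ M) dvd int M" by simp
    then have "l ^ M dvd M" by (simp only: int_dvd_int_iff)
    moreover have "M > 0" using \<kappa>_pos[of 1] prime_gt_0_nat[OF pl] by (simp add: M_def)
    ultimately have "l ^ M \<le> M" by (rule dvd_imp_le)
    moreover have "M < l ^ M" using prime_gt_1_nat[OF pl] by (simp add: power_gt_expt)
    ultimately show False by simp
  qed
  define m where "m = the_enat \<mu>"
  have m: "\<mu> = enat m" using \<mu> by (auto simp: m_def)
  \<comment> \<open>This is \<lambda> + 1.\<close>
  define d where "d = (LEAST j. j \<ge> 1 \<and> padic_val (fps_nth Q j) = \<mu>)"
  have "\<mu> \<in> (\<lambda>j. padic_val (fps_nth Q j)) ` {1..}" unfolding assms(13) by (rule wellorder_InfI) auto
  then have "\<exists>j. j \<ge> 1 \<and> padic_val (fps_nth Q j) = \<mu>" by auto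
  then have d: "d \<ge> 1" "padic_val (fps_nth Q d) = \<mu>" unfolding d_def by (metis (mono_tags, lifting) LeastI_ex)+
  have d_dvd: "\<not> of_nat l ^ Suc m dvd fps_nth Q d"
    using padic_val_ge_iff[of "Suc m" "fps_nth Q d"] unfolding d(2) m l by simp
  have low_dvd: "of_nat l ^ Suc m dvd fps_nth Q j" if "j < d" for j
  proof (cases "j = 0")
    case False
    then have "padic_val (fps_nth Q j) \<noteq> \<mu>" using not_less_Least[OF that[unfolded d_def]] by simp
    then have "enat m < padic_val (fps_nth Q j)" using \<mu>_le[of j] False unfolding m by simp
    then have "enat (Suc m) \<le> padic_val (fps_nth Q j)" using ileI1 eSuc_enat by metis
    then show ?thesis unfolding padic_val_ge_iff l .
  qed (simp add: Q0)
  \<comment> \<open>The bound on \<open>n\<close> gives l^n - l^(n-1) \<ge> l^(n-1) > n - 1 > d, as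
    \<open>prod_prim_valuation\<close> requires. The 1 on the left is the valuation of the factor
    \<open>l\<close> in \<open>step\<close>.\<close>
  have growth: "multiplicity l (\<kappa> n) + 1 = multiplicity l (\<kappa> (n - 1)) + (m * (l ^ n - l ^ (n - 1)) + d)"
    if n: "n \<ge> d + 2" for n
  proof -
    have n1: "n \<ge> 1" "n > 0" "n - 1 \<ge> 1" using n by auto
    have "d < n - 1" using n by simp
    also have "n - 1 < l ^ (n - 1)" using prime_gt_1_nat[OF pl] by (simp add: power_gt_expt)
    also have "l ^ (n - 1) \<le> l ^ n - l ^ (n - 1)"
    proof -
      have "2 * l ^ (n - 1) \<le> l * l ^ (n - 1)" using prime_ge_2_nat[OF pl] by simp
      also have "\<dots> = l ^ n" using n by (cases n) simp_all
      finally show ?thesis by simp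
    qed
    finally have dn: "d < l ^ n - l ^ (n - 1)" .
    obtain K where K: "K \<ge> n" "\<forall>k<l ^ n * Suc m. of_nat l ^ Suc m dvd fps_nth Q k - of_int (coeff (R K \<circ>\<^sub>p [:1, -1:]) k)"
      using approx[of n "l ^ n * Suc m" "Suc m"] by blast
    have J: "j < l ^ n * Suc m" if "j \<le> d" for j
    proof -
      have "l ^ n \<le> l ^ n * Suc m" by simp
      then show ?thesis using that dn by linarith
    qed
    note tr = transfer[OF K(2)[rule_format]]
    have "\<exists>z1 z2. \<not> int l dvd z1 \<and> \<not> int l dvd z2 \<and>
      of_int z1 * (\<Prod>k\<in>prim_set l n. cpoly (R K) (chi (l ^ n) k))
        = of_int (int l ^ (m * (l ^ n - l ^ (n - 1)) + d) * z2)"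
    proof (rule prod_prim_valuation[OF pl n1(2) dn])
      show "int l ^ Suc m dvd coeff (R K \<circ>\<^sub>p [:1, -1:]) j" if "j < d" for j
        using tr[OF J le_refl, of j] low_dvd[OF that] that by simp
      show "\<not> int l ^ Suc m dvd coeff (R K \<circ>\<^sub>p [:1, -1:]) d"
        using tr[OF J le_refl, of d] d_dvd by simp
      show "int l ^ m dvd coeff (R K \<circ>\<^sub>p [:1, -1:]) j" if "j < l ^ n * Suc m" for j
        using tr[OF that, of m] \<mu>_dvd[of m j] by (simp add: m)
    qed
    then obtain z1 z2 where z: "\<not> int l dvd z1" "\<not> int l dvd z2"
      "of_int z1 * (\<Prod>k\<in>prim_set l n. cpoly (R K) (chi (l ^ n) k))
        = of_int (int l ^ (m * (l ^ n - l ^ (n - 1)) + d) * z2)" by blast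
    let ?e = "m * (l ^ n - l ^ (n - 1)) + d"
    have "(of_int (z1 * (int l * int (\<kappa> n))) :: complex) = of_int z1 * (of_nat l * of_nat (\<kappa> n))" by simp
    also have "\<dots> = of_nat (\<kappa> (n - 1)) * (of_int z1 * (\<Prod>k\<in>prim_set l n. cpoly (R K) (chi (l ^ n) k)))"
      unfolding step[OF n1(1) K(1)] by (simp only: mult_ac)
    also have "\<dots> = of_int (int (\<kappa> (n - 1)) * (int l ^ ?e * z2))" unfolding z(3) by simp
    finally have eq: "z1 * (int l * int (\<kappa> n)) = int (\<kappa> (n - 1)) * (int l ^ ?e * z2)"
      by (simp only: of_int_eq_iff)
    have pe: "prime_elem (int l)" using pr by simp
    have nz: "z1 \<noteq> 0" "z2 \<noteq> 0" "int (\<kappa> n) \<noteq> 0" "int (\<kappa> (n - 1)) \<noteq> 0" "int l \<noteq> 0"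
      using z(1,2) \<kappa>_pos[of n] \<kappa>_pos[of "n - 1"] n1 prime_gt_0_nat[OF pl] by auto
    have mint: "multiplicity (int l) (int x) = multiplicity l x" for x
      by (simp add: multiplicity_def flip: of_nat_power)
    have "multiplicity (int l) (z1 * (int l * int (\<kappa> n))) = 1 + multiplicity l (\<kappa> n)"
      using nz pe z(1) by (simp add: prime_elem_multiplicity_mult_distrib not_dvd_imp_multiplicity_0 mint multiplicity_self prime_elem_not_unit)
    moreover have "multiplicity (int l) (int (\<kappa> (n - 1)) * (int l ^ ?e * z2)) = multiplicity l (\<kappa> (n - 1)) + ?e"
      using nz pe z(2) by (simp add: prime_elem_multiplicity_mult_distrib not_dvd_imp_multiplicity_0 mint
          multiplicity_same_power prime_elem_not_unit)
    ultimately show ?thesis using eq by simp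
  qed
  \<comment> \<open>\<open>growth\<close> first applies at d + 2, to the step that leads from
    \<open>n0\<close> to its successor.\<close>
  define n0 where "n0 = d + 1"
  \<comment> \<open>The value that makes the formula true at \<open>n0\<close>. Each further level
    adds m (l^(n+1) - l^n) + d - 1, and d - 1 is \<lambda>.\<close>
  define \<nu> where "\<nu> = int (multiplicity l (\<kappa> n0)) - int m * int l ^ n0 - int lam * int n0"
  have lam: "int d = int lam + 1" unfolding assms(14) d_def[symmetric] using d(1) by simp
  have "int (multiplicity l (\<kappa> n)) = int m * int l ^ n + int lam * int n + \<nu>" if "n \<ge> n0" for n
    using that
  proof (induction n rule: dec_induct)
    case base
    then show ?case by (simp add: \<nu>_def)
  next
    case (step n)
    have "multiplicity l (\<kappa> (Suc n)) + 1 = multiplicity l (\<kappa> n) + (m * (l ^ Suc n - l ^ n) + d)"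
      using growth[of "Suc n"] step(1) by (simp add: n0_def)
    moreover have "int (l ^ Suc n - l ^ n) = int l ^ Suc n - int l ^ n"
      using prime_gt_0_nat[OF pl] by (subst of_nat_diff) simp_all
    ultimately have "int (multiplicity l (\<kappa> (Suc n))) + 1
        = int (multiplicity l (\<kappa> n)) + (int m * (int l ^ Suc n - int l ^ n) + int d)"
      by (metis of_nat_1 of_nat_add of_nat_mult)
    then show ?case using step.IH lam by (simp add: algebra_simps)
  qed
  then show ?thesis using Q0 \<mu> unfolding m_def[symmetric] by blast
qed

end
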